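(* Fix $\alpha>0$, $\sigma\ge0$, $\pi\in(0,1]$, $\delta>0$ with not both $\pi=1$ and $\sigma=0$; put $\gamma=\pi\delta$ and define $$\sigma'^2=\sigma^2+\alpha^2(1-\pi)\,\frac{\delta(1+\sigma^2/\alpha^2)+1+\sqrt{(\delta(1+\sigma^2/\alpha^2)+1)^2-4\gamma}}{2\gamma}.$$ Then the random projection ridge model with parametrization level $\pi$, aspect ratio $\delta$, signal strength $\alpha^2$ and noise level $\sigma^2$, with its optimal regularization parameter $\lambda^*=\delta(1-\pi+\sigma^2/\alpha^2)$, has the same asymptotic (limit as $d\to\infty$) squared bias, variance and MSE as the ordinary ridge model without the projection step, with the same $\delta$, the same $\alpha^2$, training label noise level $\sigma'^2$ and test label noise level $\sigma^2$, with its optimal regularization parameter $\lambda'^*=\delta\sigma'^2/\alpha^2$.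
   Context: Random projection ridge model. For each $d$, $p=p_d\le d$, $n=n_d$, $p/d\to\pi$, $d/n\to\delta$. $X\in\mathbb{R}^{n\times d}$ has i.i.d. entries (from a fixed distribution) with mean $0$, variance $1$ and finite $(8+\eta)$-th moment for some $\eta>0$. $\theta\sim N(0,\alpha^2 I_d/d)$, $\mathcal{E}\sim N(0,\sigma^2 I_n)$, $Y=X\theta+\mathcal{E}$. $W$ is a $p\times d$ random matrix uniformly distributed on $\{W:WW^\top=I_p\}$. The test point $x\in\mathbb{R}^d$ is distributed as a row of $X$, its label has noise variance $\sigma^2$. $X,\mathcal{E},W,\theta,x$ are independent. $\hat f(x)=x^\top W^\top(\tfrac{1}{n}WX^\top XW^\top+\lambda I_p)^{-1}\tfrac1n WX^\top Y$. $\mathrm{Bias}^2(\lambda)=\mathbb{E}_{\theta,x}(\mathbb{E}_{X,\mathcal{E},W}\hat f(x)-x^\top\theta)^2$; $\mathrm{Var}(\lambda)=\mathbb{E}_{\theta,x}\mathbb{E}_{X,\mathcal{E},W}(\hat f(x)-\mathbb{E}_{X,\mathcal{E},W}\hat f(x))^2$; $\mathrm{MSE}(\lambda)=\mathrm{Bias}^2(\lambda)+\mathrm{Var}(\lambda)+\sigma^2$. Ordinary ridge model. The same with $p=d$ and $W=I_d$ (so $\pi=1$), training noise $\mathcal{E}\sim N(0,\sigma'^2I_n)$, predictor $\hat f(x)=x^\top(\tfrac1nX^\top X+\lambda I_d)^{-1}\tfrac1nX^\top Y$, and $\mathrm{Bias}^2(\lambda)=\mathbb{E}_{\theta,x}(\mathbb{E}_{X,\mathcal{E}}\hat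 f(x)-x^\top\theta)^2$, $\mathrm{Var}(\lambda)=\mathbb{E}_{\theta,x}\mathbb{E}_{X,\mathcal{E}}(\hat f(x)-\mathbb{E}_{X,\mathcal{E}}\hat f(x))^2$, $\mathrm{MSE}(\lambda)=\mathrm{Bias}^2(\lambda)+\mathrm{Var}(\lambda)+\sigma^2$. *)

theory Defs
  imports
    "HOL-Probability.Probability"
    "Jordan_Normal_Form.Gauss_Jordan_Elimination"
begin

text \<open>
  The dimensions \<open>n\<close>, \<open>p\<close>, \<open>d\<close> vary with \<open>d\<close>, so linear algebra uses matrices and vectors with
  explicit carriers.  As these types carry no sigma-algebra, a random \<open>n \<times> d\<close> matrix is
  represented by its entries, i.e. by a measure on functions of index pairs in
  \<open>{..<n} \<times> {..<d}\<close>; the matrix with entries \<open>X\<close> is then \<open>mat n d X\<close>.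
\<close>

subsection \<open>Distributions\<close>

text \<open>For \<open>s = 0\<close> this is the point mass at \<open>m\<close>.\<close>

definition normal_law :: "real \<Rightarrow> real \<Rightarrow> real measure" where
  "normal_law m s = distr std_normal_distribution borel (\<lambda>z. m + s * z)"

definition entry_law :: "real measure \<Rightarrow> bool" where
  "entry_law \<mu> \<longleftrightarrow>
     real_distribution \<mu> \<and>
     (\<integral>z. z \<partial>\<mu>) = 0 \<and>
     (\<integral>z. z\<^sup>2 \<partial>\<mu>) = 1 \<and>
     (\<exists>\<eta>>0. integrable \<mu> (\<lambda>z. \<bar>z\<bar> powr (8 + \<eta>)))"

definition iid_mat :: "nat \<Rightarrow> nat \<Rightarrow> real measure \<Rightarrow> (nat \<times> nat \<Rightarrow> real) measure" where
  "iid_mat n d \<mu> = (\<Pi>\<^sub>M ij\<in>{..<n} \<times> {..<d}. \<mu>)"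

definition iid_vec :: "nat \<Rightarrow> real measure \<Rightarrow> (nat \<Rightarrow> real) measure" where
  "iid_vec n \<mu> = (\<Pi>\<^sub>M i\<in>{..<n}. \<mu>)"

definition mat_entries :: "nat \<Rightarrow> nat \<Rightarrow> real mat \<Rightarrow> nat \<times> nat \<Rightarrow> real" where
  "mat_entries n d A = (\<lambda>ij\<in>{..<n} \<times> {..<d}. A $$ ij)"

text \<open>
  The uniform distribution on \<open>{W. W W\<^sup>T = I}\<close>: the probability measure concentrated on this
  set that is invariant under \<open>W \<mapsto> W Q\<close> for orthogonal \<open>Q\<close>.  For \<open>p \<le> d\<close> the orthogonal group
  acts transitively on the set, so exactly one such measure exists.
\<close>

definition uniform_stiefel :: "nat \<Rightarrow> nat \<Rightarrow> (nat \<times> nat \<Rightarrow> real) measure \<Rightarrow> bool" where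
  "uniform_stiefel p d \<nu> \<longleftrightarrow>
     prob_space \<nu> \<and>
     sets \<nu> = sets (\<Pi>\<^sub>M ij\<in>{..<p} \<times> {..<d}. borel) \<and>
     (AE W in \<nu>. mat p d W * (mat p d W)\<^sup>T = 1\<^sub>m p) \<and>
     (\<forall>Q\<in>carrier_mat d d. Q * Q\<^sup>T = 1\<^sub>m d \<longrightarrow>
        distr \<nu> \<nu> (\<lambda>W. mat_entries p d (mat p d W * Q)) = \<nu>)"

subsection \<open>Squared bias and variance\<close>

text \<open>
  \<open>T\<close> is the law of the training randomness \<open>t\<close>, \<open>S\<close> the law of \<open>s = (\<theta>, x)\<close>; independence of
  the two is expressed by integrating against the two laws separately.
\<close>

definition sq_bias ::
  "'t measure \<Rightarrow> 's measure \<Rightarrow> ('t \<Rightarrow> 's \<Rightarrow> real) \<Rightarrow> ('s \<Rightarrow> real) \<Rightarrow> real" where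
  "sq_bias T S f g = (\<integral>s. ((\<integral>t. f t s \<partial>T) - g s)\<^sup>2 \<partial>S)"

definition pred_var :: "'t measure \<Rightarrow> 's measure \<Rightarrow> ('t \<Rightarrow> 's \<Rightarrow> real) \<Rightarrow> real" where
  "pred_var T S f = (\<integral>s. (\<integral>t. (f t s - (\<integral>t'. f t' s \<partial>T))\<^sup>2 \<partial>T) \<partial>S)"

definition signal_test_law ::
  "real measure \<Rightarrow> real \<Rightarrow> nat \<Rightarrow> ((nat \<Rightarrow> real) \<times> (nat \<Rightarrow> real)) measure" where
  "signal_test_law \<mu> \<alpha> d = iid_vec d (normal_law 0 (\<alpha> / sqrt (real d))) \<Otimes>\<^sub>M iid_vec d \<mu>"

definition test_signal :: "nat \<Rightarrow> (nat \<Rightarrow> real) \<times> (nat \<Rightarrow> real) \<Rightarrow> real" where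
  "test_signal d = (\<lambda>(\<theta>, x). scalar_prod (Matrix.vec d x) (Matrix.vec d \<theta>))"

definition inv_mat :: "real mat \<Rightarrow> real mat" where
  "inv_mat A = the (mat_inverse A)"

subsection \<open>Random projection ridge model\<close>

definition rp_predictor ::
  "real \<Rightarrow> real mat \<Rightarrow> real mat \<Rightarrow> real Matrix.vec \<Rightarrow> real Matrix.vec \<Rightarrow> real" where
  "rp_predictor l W X Y x =
     (let n = dim_row X; p = dim_row W in
      scalar_prod x
        (W\<^sup>T *\<^sub>v (inv_mat ((1 / real n) \<cdot>\<^sub>m (W * X\<^sup>T * X * W\<^sup>T) + l \<cdot>\<^sub>m 1\<^sub>m p) *\<^sub>v
          ((1 / real n) \<cdot>\<^sub>v ((W * X\<^sup>T) *\<^sub>v Y)))))"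

definition rp_train_law ::
  "real measure \<Rightarrow> (nat \<times> nat \<Rightarrow> real) measure \<Rightarrow> real \<Rightarrow> nat \<Rightarrow> nat \<Rightarrow>
     ((nat \<times> nat \<Rightarrow> real) \<times> (nat \<Rightarrow> real) \<times> (nat \<times> nat \<Rightarrow> real)) measure" where
  "rp_train_law \<mu> \<nu> \<sigma> n d = iid_mat n d \<mu> \<Otimes>\<^sub>M (iid_vec n (normal_law 0 \<sigma>) \<Otimes>\<^sub>M \<nu>)"

definition rp_fhat ::
  "real \<Rightarrow> nat \<Rightarrow> nat \<Rightarrow> nat \<Rightarrow>
     (nat \<times> nat \<Rightarrow> real) \<times> (nat \<Rightarrow> real) \<times> (nat \<times> nat \<Rightarrow> real) \<Rightarrow>
     (nat \<Rightarrow> real) \<times> (nat \<Rightarrow> real) \<Rightarrow> real" where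
  "rp_fhat l n p d = (\<lambda>(X, E, W) (\<theta>, x).
     rp_predictor l (mat p d W) (mat n d X)
       (mat n d X *\<^sub>v Matrix.vec d \<theta> + Matrix.vec n E) (Matrix.vec d x))"

definition rp_bias ::
  "real measure \<Rightarrow> (nat \<times> nat \<Rightarrow> real) measure \<Rightarrow> real \<Rightarrow> real \<Rightarrow> nat \<Rightarrow> nat \<Rightarrow> nat \<Rightarrow> real \<Rightarrow> real" where
  "rp_bias \<mu> \<nu> \<alpha> \<sigma> n p d l =
     sq_bias (rp_train_law \<mu> \<nu> \<sigma> n d) (signal_test_law \<mu> \<alpha> d) (rp_fhat l n p d) (test_signal d)"

definition rp_var ::
  "real measure \<Rightarrow> (nat \<times> nat \<Rightarrow> real) measure \<Rightarrow> real \<Rightarrow> real \<Rightarrow> nat \<Rightarrow> nat \<Rightarrow> nat \<Rightarrow> real \<Rightarrow> real" where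
  "rp_var \<mu> \<nu> \<alpha> \<sigma> n p d l =
     pred_var (rp_train_law \<mu> \<nu> \<sigma> n d) (signal_test_law \<mu> \<alpha> d) (rp_fhat l n p d)"

definition rp_mse ::
  "real measure \<Rightarrow> (nat \<times> nat \<Rightarrow> real) measure \<Rightarrow> real \<Rightarrow> real \<Rightarrow> nat \<Rightarrow> nat \<Rightarrow> nat \<Rightarrow> real \<Rightarrow> real" where
  "rp_mse \<mu> \<nu> \<alpha> \<sigma> n p d l = rp_bias \<mu> \<nu> \<alpha> \<sigma> n p d l + rp_var \<mu> \<nu> \<alpha> \<sigma> n p d l + \<sigma>\<^sup>2"

definition rp_regime ::
  "real \<Rightarrow> real \<Rightarrow> (nat \<Rightarrow> nat) \<Rightarrow> (nat \<Rightarrow> nat) \<Rightarrow> (nat \<Rightarrow> (nat \<times> nat \<Rightarrow> real) measure) \<Rightarrow> bool" where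
  "rp_regime \<pi> \<delta> n p \<nu> \<longleftrightarrow>
     (\<forall>d. p d \<le> d) \<and>
     (\<lambda>d. real (p d) / real d) \<longlonglongrightarrow> \<pi> \<and>
     (\<lambda>d. real d / real (n d)) \<longlonglongrightarrow> \<delta> \<and>
     (\<forall>d. uniform_stiefel (p d) d (\<nu> d))"

subsection \<open>Ordinary ridge model\<close>

definition ridge_predictor ::
  "real \<Rightarrow> real mat \<Rightarrow> real Matrix.vec \<Rightarrow> real Matrix.vec \<Rightarrow> real" where
  "ridge_predictor l X Y x =
     (let n = dim_row X; d = dim_col X in
      scalar_prod x
        (inv_mat ((1 / real n) \<cdot>\<^sub>m (X\<^sup>T * X) + l \<cdot>\<^sub>m 1\<^sub>m d) *\<^sub>v ((1 / real n) \<cdot>\<^sub>v (X\<^sup>T *\<^sub>v Y))))"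

definition ridge_train_law ::
  "real measure \<Rightarrow> real \<Rightarrow> nat \<Rightarrow> nat \<Rightarrow> ((nat \<times> nat \<Rightarrow> real) \<times> (nat \<Rightarrow> real)) measure" where
  "ridge_train_law \<mu> \<sigma> n d = iid_mat n d \<mu> \<Otimes>\<^sub>M iid_vec n (normal_law 0 \<sigma>)"

definition ridge_fhat ::
  "real \<Rightarrow> nat \<Rightarrow> nat \<Rightarrow> (nat \<times> nat \<Rightarrow> real) \<times> (nat \<Rightarrow> real) \<Rightarrow>
     (nat \<Rightarrow> real) \<times> (nat \<Rightarrow> real) \<Rightarrow> real" where
  "ridge_fhat l n d = (\<lambda>(X, E) (\<theta>, x).
     ridge_predictor l (mat n d X)
       (mat n d X *\<^sub>v Matrix.vec d \<theta> + Matrix.vec n E) (Matrix.vec d x))"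

text \<open>
  The training noise level \<open>\<sigma>'\<close> may differ from the test noise level \<open>\<sigma>\<close>, which enters only the
  mean squared error.
\<close>

definition ridge_bias ::
  "real measure \<Rightarrow> real \<Rightarrow> real \<Rightarrow> nat \<Rightarrow> nat \<Rightarrow> real \<Rightarrow> real" where
  "ridge_bias \<mu> \<alpha> \<sigma>' n d l =
     sq_bias (ridge_train_law \<mu> \<sigma>' n d) (signal_test_law \<mu> \<alpha> d) (ridge_fhat l n d) (test_signal d)"

definition ridge_var ::
  "real measure \<Rightarrow> real \<Rightarrow> real \<Rightarrow> nat \<Rightarrow> nat \<Rightarrow> real \<Rightarrow> real" where
  "ridge_var \<mu> \<alpha> \<sigma>' n d l =
     pred_var (ridge_train_law \<mu> \<sigma>' n d) (signal_test_law \<mu> \<alpha> d) (ridge_fhat l n d)"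

definition ridge_mse ::
  "real measure \<Rightarrow> real \<Rightarrow> real \<Rightarrow> real \<Rightarrow> nat \<Rightarrow> nat \<Rightarrow> real \<Rightarrow> real" where
  "ridge_mse \<mu> \<alpha> \<sigma>' \<sigma> n d l = ridge_bias \<mu> \<alpha> \<sigma>' n d l + ridge_var \<mu> \<alpha> \<sigma>' n d l + \<sigma>\<^sup>2"

definition ridge_regime :: "real \<Rightarrow> (nat \<Rightarrow> nat) \<Rightarrow> bool" where
  "ridge_regime \<delta> n \<longleftrightarrow> (\<lambda>d. real d / real (n d)) \<longlonglongrightarrow> \<delta>"

subsection \<open>Optimal regularization\<close>

text \<open>\<open>mse d l\<close> is the error in dimension \<open>d\<close>; \<open>l\<close> minimizes its limit over positive parameters.\<close>

definition optimal_regularization :: "(nat \<Rightarrow> real \<Rightarrow> real) \<Rightarrow> real \<Rightarrow> bool" where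
  "optimal_regularization mse l \<longleftrightarrow>
     0 < l \<and>
     (\<exists>M. (\<lambda>d. mse d l) \<longlonglongrightarrow> M \<and>
          (\<forall>l'>0. \<exists>M'. (\<lambda>d. mse d l') \<longlonglongrightarrow> M' \<and> M \<le> M'))"

end

theory Submission
  imports Defs "Jordan_Normal_Form.Determinant"
begin

text \<open>
  Conditionally on \<open>W\<close>, the rows \<open>x\<^sub>i\<close> of \<open>X\<close> are independent with \<open>E x\<^sub>i x\<^sub>i\<^sup>T = I\<close>, and
  \<open>x\<^sub>i\<^sup>T B x\<^sub>i\<close> deviates from the trace of a fixed \<open>B\<close> by \<open>O(\<parallel>B\<parallel>)\<close> in mean square.  Put \<open>S = X\<^sup>T X / n\<close>
  and \<open>R = W\<^sup>T (W S W\<^sup>T + l)\<^sup>-\<^sup>1 W\<close>.  Removing one row from \<open>S\<close> changes \<open>R\<close> by a rank one matrix; this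
  turns \<open>tr (S R) = p - l tr R\<close> into the fixed point equation \<open>\<pi> \<delta> - l T = T / (1 + T)\<close> for the limit
  \<open>T\<close> of \<open>tr R / n\<close>, with an error of order \<open>n\<^sup>-\<^sup>1\<^sup>/\<^sup>2\<close> that is uniform in \<open>W\<close>.  The same device
  gives the limits of \<open>\<parallel>R\<parallel>\<^sup>2 / n\<close> and \<open>\<parallel>(I - W\<^sup>T W) S R\<parallel>\<^sup>2 / n\<close>, and these three quantities determine
  the limit of the error exactly.  The bias depends on \<open>E (R S)\<close>, which up to a negligible term is a
  multiple of the identity because the law of \<open>(X, W)\<close> is invariant under permutations of the
  coordinates; its limit depends on \<open>T\<close> only.  At the optimal parameters both models have the same
  \<open>T\<close>, because the formula for \<open>\<sigma>'\<close> says that \<open>\<sigma>'\<^sup>2 = \<sigma>\<^sup>2 + \<alpha>\<^sup>2 (1 - \<pi>) (1 + 1 / T)\<close>.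
\<close>

section \<open>Finitely supported matrices\<close>

text \<open>The entries of \<open>X\<close> have an arbitrary law, so \<open>X\<close> is not
  rotation invariant and \<open>P = W\<^sup>T W\<close> cannot be rotated to a coordinate
  projection. Instead \<open>P\<close> is a fixed projection, and every error bound sees it only
  through \<open>p\<close> and \<open>d\<close>; this is what lets \<open>W\<close> be integrated
  out at the end. \<open>S\<close> has no deterministic bound. Where it stands beside
  \<open>R\<close>, it is controlled by its mean square Frobenius norm, of order \<open>n\<close>,
  which is small enough for fluctuations divided by \<open>n\<close>. Squared bias plus variance
  comes first, because the mean of the prediction cancels in the sum. The bias then follows from the
  trace of the mean matrix, the variance by subtraction. At parameter \<open>l\<close> that sum
  tends to an increasing affine function of \<open>l\<^sup>2 \<tau> + k (T - l \<tau>)\<close>, with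
  \<open>\<tau>\<close> the limit of \<open>\<parallel>R\<parallel>\<^sup>2 / n\<close> and
  \<open>k\<close> the claimed optimum; at \<open>l = k\<close> only \<open>k T\<close> remains.
  Going to full rank raises the constant of the fixed point equation from
  \<open>\<pi> \<delta>\<close> to \<open>\<delta>\<close>. The same \<open>T\<close> survives
  exactly if the parameter grows by \<open>\<delta> (1 - \<pi>) / T\<close>. Multiplying the new
  parameter by \<open>\<alpha>\<^sup>2 / \<delta>\<close> gives
  \<open>\<sigma>'\<^sup>2\<close>.\<close>

text \<open>
  Matrices of all sizes embed into one type, which is a non-unital ring and, with the Frobenius
  inner product, a real inner product space; products then need no carrier conditions.
  Column vectors are matrices supported in column \<open>0\<close>.
\<close>

typedef fmat = "{f :: nat \<Rightarrow> nat \<Rightarrow> real. \<exists>N. \<forall>i j. f i j \<noteq> 0 \<longrightarrow> i < N \<and> j < N}"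
  morphisms ent Fmat
  by (rule exI[of _ "\<lambda>_ _. 0"]) simp

setup_lifting type_definition_fmat

text \<open>An upper bound for the support rather than a shape, hence monotone in both sizes;
  several matrices can always be given one common size.\<close>

definition dims :: "nat \<Rightarrow> nat \<Rightarrow> fmat \<Rightarrow> bool" where
  "dims m n A \<longleftrightarrow> (\<forall>i j. ent A i j \<noteq> 0 \<longrightarrow> i < m \<and> j < n)"

lemma fmat_eqI: "(\<And>i j. ent A i j = ent B i j) \<Longrightarrow> A = B"
  by (metis ent_inject ext)

lemma dims_exists: "\<exists>N. \<forall>k\<ge>N. dims k k A"
proof -
  obtain N where "\<forall>i j. ent A i j \<noteq> 0 \<longrightarrow> i < N \<and> j < N"
    using ent[of A] by auto
  then show ?thesis
    by (intro exI[of _ N]) (auto simp: dims_def intro: less_le_trans)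
qed

lemma dims_exists2: "\<exists>N. dims N N A \<and> dims N N B"
proof -
  obtain N M where "\<forall>k\<ge>N. dims k k A" "\<forall>k\<ge>M. dims k k B"
    using dims_exists by meson
  then show ?thesis
    by (intro exI[of _ "max N M"]) auto
qed

lemma dims_exists3: "\<exists>N. dims N N A \<and> dims N N B \<and> dims N N C"
proof -
  obtain N M K where "\<forall>k\<ge>N. dims k k A" "\<forall>k\<ge>M. dims k k B" "\<forall>k\<ge>K. dims k k C"
    using dims_exists by meson
  then show ?thesis
    by (intro exI[of _ "max N (max M K)"]) auto
qed

lemma ent_eq_0: "dims m n A \<Longrightarrow> \<not> (i < m \<and> j < n) \<Longrightarrow> ent A i j = 0"
  unfolding dims_def by blast

instantiation fmat :: "{zero, plus, minus, uminus, times, scaleR}"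
begin

lift_definition zero_fmat :: fmat is "\<lambda>_ _. 0" by simp

lift_definition plus_fmat :: "fmat \<Rightarrow> fmat \<Rightarrow> fmat" is "\<lambda>f g i j. f i j + g i j"
proof -
  fix f g :: "nat \<Rightarrow> nat \<Rightarrow> real"
  assume "\<exists>N. \<forall>i j. f i j \<noteq> 0 \<longrightarrow> i < N \<and> j < N" "\<exists>N. \<forall>i j. g i j \<noteq> 0 \<longrightarrow> i < N \<and> j < N"
  then obtain N M where "\<forall>i j. f i j \<noteq> 0 \<longrightarrow> i < N \<and> j < N" "\<forall>i j. g i j \<noteq> 0 \<longrightarrow> i < M \<and> j < M"
    by blast
  then show "\<exists>N. \<forall>i j. f i j + g i j \<noteq> 0 \<longrightarrow> i < N \<and> j < N"
    by (intro exI[of _ "max N M"]) (metis add.left_neutral less_max_iff_disj)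
qed

lift_definition uminus_fmat :: "fmat \<Rightarrow> fmat" is "\<lambda>f i j. - f i j" by simp

lift_definition minus_fmat :: "fmat \<Rightarrow> fmat \<Rightarrow> fmat" is "\<lambda>f g i j. f i j - g i j"
proof -
  fix f g :: "nat \<Rightarrow> nat \<Rightarrow> real"
  assume "\<exists>N. \<forall>i j. f i j \<noteq> 0 \<longrightarrow> i < N \<and> j < N" "\<exists>N. \<forall>i j. g i j \<noteq> 0 \<longrightarrow> i < N \<and> j < N"
  then obtain N M where "\<forall>i j. f i j \<noteq> 0 \<longrightarrow> i < N \<and> j < N" "\<forall>i j. g i j \<noteq> 0 \<longrightarrow> i < M \<and> j < M"
    by blast
  then show "\<exists>N. \<forall>i j. f i j - g i j \<noteq> 0 \<longrightarrow> i < N \<and> j < N"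
    by (intro exI[of _ "max N M"]) (metis diff_self less_max_iff_disj)
qed

text \<open>Summing over the support of row \<open>i\<close> of the left factor keeps the sum finite
  without naming a dimension; \<open>ent_times\<close> turns it into an ordinary bounded
  sum.\<close>

lift_definition times_fmat :: "fmat \<Rightarrow> fmat \<Rightarrow> fmat" is
  "\<lambda>f g i j. \<Sum>k | f i k \<noteq> 0. f i k * g k j"
proof -
  fix f g :: "nat \<Rightarrow> nat \<Rightarrow> real"
  assume "\<exists>N. \<forall>i j. f i j \<noteq> 0 \<longrightarrow> i < N \<and> j < N" "\<exists>N. \<forall>i j. g i j \<noteq> 0 \<longrightarrow> i < N \<and> j < N"
  then obtain N M where *: "\<forall>i j. f i j \<noteq> 0 \<longrightarrow> i < N \<and> j < N" "\<forall>i j. g i j \<noteq> 0 \<longrightarrow> i < M \<and> j < M"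
    by blast
  have "i < max N M \<and> j < max N M" if nz: "(\<Sum>k | f i k \<noteq> 0. f i k * g k j) \<noteq> 0" for i j
  proof -
    obtain k where "f i k * g k j \<noteq> 0"
      using nz by (metis (mono_tags, lifting) sum.neutral)
    with * show ?thesis by (auto simp: less_max_iff_disj)
  qed
  then show "\<exists>N. \<forall>i j. (\<Sum>k | f i k \<noteq> 0. f i k * g k j) \<noteq> 0 \<longrightarrow> i < N \<and> j < N"
    by blast
qed

lift_definition scaleR_fmat :: "real \<Rightarrow> fmat \<Rightarrow> fmat" is "\<lambda>c f i j. c * f i j"
  by (metis mult_zero_right)

instance ..

end

lemmas ent_simps [simp] = zero_fmat.rep_eq plus_fmat.rep_eq minus_fmat.rep_eq uminus_fmat.rep_eq
  scaleR_fmat.rep_eq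

lemma ent_times:
  assumes "dims m n A"
  shows "ent (A * B) i j = (\<Sum>k<n. ent A i k * ent B k j)"
  unfolding times_fmat.rep_eq
  by (rule sum.mono_neutral_left) (use assms in \<open>auto simp: dims_def\<close>)

instantiation fmat :: real_inner
begin

lift_definition inner_fmat :: "fmat \<Rightarrow> fmat \<Rightarrow> real" is
  "\<lambda>f g. \<Sum>(i, j) | f i j \<noteq> 0. f i j * g i j" .

lemma inner_fmat_eq:
  assumes "dims m n A"
  shows "inner A B = (\<Sum>i<m. \<Sum>j<n. ent A i j * ent B i j)"
proof -
  have "inner A B = (\<Sum>(i, j)\<in>{..<m} \<times> {..<n}. ent A i j * ent B i j)"
    unfolding inner_fmat.rep_eq
    by (rule sum.mono_neutral_left) (use assms in \<open>auto simp: dims_def\<close>)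
  then show ?thesis by (simp add: sum.cartesian_product)
qed

definition norm_fmat :: "fmat \<Rightarrow> real" where "norm_fmat A = sqrt (inner A A)"
definition sgn_fmat :: "fmat \<Rightarrow> fmat" where "sgn_fmat A = A /\<^sub>R norm A"
definition dist_fmat :: "fmat \<Rightarrow> fmat \<Rightarrow> real" where "dist_fmat A B = norm (A - B)"
definition uniformity_fmat :: "(fmat \<times> fmat) filter" where
  "uniformity_fmat = (INF e\<in>{0<..}. principal {(A, B). dist A B < e})"
definition open_fmat :: "fmat set \<Rightarrow> bool" where
  "open_fmat U = (\<forall>A\<in>U. \<forall>\<^sub>F (A', B) in uniformity. A' = A \<longrightarrow> B \<in> U)"

instance
proof
  fix A B C :: fmat and a b :: real
  show "A + B + C = A + (B + C)" "A + B = B + A" "0 + A = A" "- A + A = 0" "A - B = A + - B"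
    "a *\<^sub>R (A + B) = a *\<^sub>R A + a *\<^sub>R B" "(a + b) *\<^sub>R A = a *\<^sub>R A + b *\<^sub>R A"
    "a *\<^sub>R b *\<^sub>R A = (a * b) *\<^sub>R A" "1 *\<^sub>R A = A"
    by (rule fmat_eqI, simp add: algebra_simps)+
  obtain N where N: "dims N N A" "dims N N B" "dims N N C"
    using dims_exists3 by blast
  have N': "dims N N (A + B)" "dims N N (a *\<^sub>R A)"
    using N by (auto simp: dims_def) (metis add.left_neutral)+
  show "inner A B = inner B A"
    by (simp add: inner_fmat_eq[OF N(1)] inner_fmat_eq[OF N(2)] mult.commute)
  show "inner (A + B) C = inner A C + inner B C"
    by (simp add: inner_fmat_eq[OF N(1)] inner_fmat_eq[OF N(2)] inner_fmat_eq[OF N'(1)]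
        sum.distrib algebra_simps)
  show "inner (a *\<^sub>R A) B = a * inner A B"
    by (simp add: inner_fmat_eq[OF N(1)] inner_fmat_eq[OF N'(2)] sum_distrib_left algebra_simps)
  show "0 \<le> inner A A"
    by (simp add: inner_fmat_eq[OF N(1)] sum_nonneg)
  show "(inner A A = 0) = (A = 0)"
  proof
    assume "inner A A = 0"
    then have "(\<Sum>j<N. ent A i j * ent A i j) = 0" if "i < N" for i
      using that by (simp add: inner_fmat_eq[OF N(1)] sum_nonneg sum_nonneg_eq_0_iff)
    then have "ent A i j = 0" if "i < N" "j < N" for i j
      using that by (simp add: sum_nonneg_eq_0_iff)
    then have "ent A i j = 0" for i j
      using ent_eq_0[OF N(1)] by (cases "i < N \<and> j < N") auto
    then show "A = 0" by (intro fmat_eqI) simp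
  next
    assume "A = 0"
    then show "inner A A = 0" unfolding inner_fmat_eq[OF N(1)] by simp
  qed
qed (simp_all add: norm_fmat_def sgn_fmat_def dist_fmat_def uniformity_fmat_def open_fmat_def)

end

text \<open>The inner sizes \<open>k\<close> and \<open>l\<close> may differ, because entries
  outside the supports are zero.\<close>

lemma dims_times [intro]:
  assumes "dims m k A" "dims l n B"
  shows "dims m n (A * B)"
proof -
  have "i < m \<and> j < n" if nz: "(\<Sum>l<k. ent A i l * ent B l j) \<noteq> 0" for i j
  proof -
    obtain l where "ent A i l * ent B l j \<noteq> 0"
      using nz by (metis (mono_tags, lifting) sum.neutral)
    then show ?thesis using assms by (auto simp: dims_def)
  qed
  then show ?thesis by (simp add: dims_def ent_times[OF assms(1)])
qed

instance fmat :: "{ring, real_algebra}"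
proof
  fix A B C :: fmat and a :: real
  obtain N where N: "dims N N A" "dims N N B" "dims N N C"
    using dims_exists3 by blast
  have N': "dims N N (A + B)" "dims N N (a *\<^sub>R A)"
    using N by (auto simp: dims_def) (metis add.left_neutral)+
  have AB: "dims N N (A * B)"
    using N by (intro dims_times)
  show "A * B * C = A * (B * C)"
  proof (rule fmat_eqI)
    fix i j
    have "ent (A * B * C) i j = (\<Sum>l<N. \<Sum>k<N. ent A i k * ent B k l * ent C l j)"
      by (simp add: ent_times[OF AB] ent_times[OF N(1)] sum_distrib_right)
    also have "\<dots> = (\<Sum>k<N. \<Sum>l<N. ent A i k * ent B k l * ent C l j)"
      by (rule sum.swap)
    also have "\<dots> = ent (A * (B * C)) i j"
      by (simp add: ent_times[OF N(1)] ent_times[OF N(2)] sum_distrib_left mult.assoc)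
    finally show "ent (A * B * C) i j = ent (A * (B * C)) i j" .
  qed
  show "(A + B) * C = A * C + B * C"
    by (rule fmat_eqI) (simp add: ent_times[OF N(1)] ent_times[OF N(2)] ent_times[OF N'(1)]
        sum.distrib algebra_simps)
  show "A * (B + C) = A * B + A * C"
    by (rule fmat_eqI) (simp add: ent_times[OF N(1)] sum.distrib algebra_simps)
  show "a *\<^sub>R A * B = a *\<^sub>R (A * B)"
    by (rule fmat_eqI) (simp add: ent_times[OF N(1)] ent_times[OF N'(2)] sum_distrib_left algebra_simps)
  show "A * a *\<^sub>R B = a *\<^sub>R (A * B)"
    by (rule fmat_eqI) (simp add: ent_times[OF N(1)] sum_distrib_left algebra_simps)
qed

section \<open>Transposition, local units and trace calculus\<close>

lift_definition tp :: "fmat \<Rightarrow> fmat" is "\<lambda>f i j. f j i" by blast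

text \<open>The infinite identity matrix is not finitely supported, so there are only local units:
  \<open>idm d\<close> acts as identity on matrices that fit into size \<open>d\<close>.\<close>

lift_definition idm :: "nat \<Rightarrow> fmat" is "\<lambda>d i j. if i = j \<and> i < d then 1 else 0" by auto

lemmas ent_tp [simp] = tp.rep_eq
lemmas ent_idm = idm.rep_eq

lemma dims_intros [intro]:
  "dims m n 0"
  "dims m n A \<Longrightarrow> dims m n B \<Longrightarrow> dims m n (A + B)"
  "dims m n A \<Longrightarrow> dims m n B \<Longrightarrow> dims m n (A - B)"
  "dims m n A \<Longrightarrow> dims m n (- A)"
  "dims m n A \<Longrightarrow> dims m n (a *\<^sub>R A)"
  "dims m n A \<Longrightarrow> dims n m (tp A)"
  "dims n n (idm n)"
  unfolding dims_def ent_simps ent_tp ent_idm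
  by (simp_all split: if_splits) (metis add.left_neutral diff_self)+

lemma tp_simps [simp]:
  "tp 0 = 0" "tp (A + B) = tp A + tp B" "tp (A - B) = tp A - tp B" "tp (- A) = - tp A"
  "tp (a *\<^sub>R A) = a *\<^sub>R tp A" "tp (tp A) = A" "tp (idm n) = idm n"
  by (auto intro!: fmat_eqI simp: ent_idm)

lemma tp_times [simp]: "tp (A * B) = tp B * tp A"
proof (rule fmat_eqI)
  fix i j
  obtain N where N: "dims N N A" "dims N N B" using dims_exists2 by blast
  have "dims N N (tp B)" using N by blast
  then show "ent (tp (A * B)) i j = ent (tp B * tp A) i j"
    by (simp add: ent_times[OF N(1)] ent_times mult.commute)
qed

lemma idm_times: "dims m n A \<Longrightarrow> idm m * A = A"
proof (rule fmat_eqI)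
  fix i j assume A: "dims m n A"
  have "ent (idm m * A) i j = (\<Sum>k<m. if k = i then ent A i j else 0)"
    unfolding ent_times[OF dims_intros(7)] by (intro sum.cong refl) (auto simp: ent_idm)
  then show "ent (idm m * A) i j = ent A i j"
    using ent_eq_0[OF A] by auto
qed

lemma times_idm: "dims m n A \<Longrightarrow> A * idm n = A"
  by (metis dims_intros(6) idm_times tp_simps(6,7) tp_times)

lemma inner_tp [simp]: "inner (tp A) (tp B) = inner A B"
proof -
  obtain N where N: "dims N N A" using dims_exists by blast
  then have N': "dims N N (tp A)" by blast
  show ?thesis
    unfolding inner_fmat_eq[OF N] inner_fmat_eq[OF N'] ent_tp by (rule sum.swap)
qed

lemma norm_tp [simp]: "norm (tp A) = norm A"
  by (simp add: norm_eq_sqrt_inner)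

text \<open>Cyclicity of the trace, written as an adjoint rule. Together with its mirror image below
  it carries all later manipulations of traces.\<close>

lemma inner_times_left: "inner (A * B) C = inner B (tp A * C)" for A B C :: fmat
proof -
  obtain N where N: "dims N N A" "dims N N B" "dims N N C" using dims_exists3 by blast
  have AB: "dims N N (A * B)" and A': "dims N N (tp A)" using N by blast+
  have "inner (A * B) C = (\<Sum>i<N. \<Sum>j<N. \<Sum>k<N. ent A i k * ent B k j * ent C i j)"
    by (simp add: inner_fmat_eq[OF AB] ent_times[OF N(1)] sum_distrib_right)
  also have "\<dots> = (\<Sum>j<N. \<Sum>i<N. \<Sum>k<N. ent A i k * ent B k j * ent C i j)"
    by (rule sum.swap)
  also have "\<dots> = (\<Sum>j<N. \<Sum>k<N. \<Sum>i<N. ent A i k * ent B k j * ent C i j)"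
    by (intro sum.cong refl sum.swap)
  also have "\<dots> = (\<Sum>k<N. \<Sum>j<N. \<Sum>i<N. ent A i k * ent B k j * ent C i j)"
    by (rule sum.swap)
  also have "\<dots> = inner B (tp A * C)"
    by (simp add: inner_fmat_eq[OF N(2)] ent_times[OF A'] sum_distrib_left ac_simps)
  finally show ?thesis .
qed

lemma inner_times_right: "inner (A * B) C = inner A (C * tp B)" for A B C :: fmat
proof -
  have "inner (A * B) C = inner (tp B * tp A) (tp C)" by (metis inner_tp tp_times)
  also have "\<dots> = inner (tp A) (B * tp C)" by (simp add: inner_times_left)
  also have "\<dots> = inner A (C * tp B)" by (metis inner_tp tp_simps(6) tp_times)
  finally show ?thesis .
qed

lemma dims_1_1: "dims 1 1 A \<Longrightarrow> A = ent A 0 0 *\<^sub>R idm 1"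
  by (intro fmat_eqI) (auto simp: dims_def ent_idm)

text \<open>A scalar product of columns reappears in the ring as a multiple of \<open>idm 1\<close>;
  this is how scalars are pulled out of rank one products.\<close>

lemma tp_times_col:
  assumes "dims d 1 x" "dims d 1 y"
  shows "tp x * y = inner x y *\<^sub>R idm 1"
proof -
  have d: "dims 1 d (tp x)" using assms by blast
  have "dims 1 1 (tp x * y)" using d assms by blast
  moreover have "ent (tp x * y) 0 0 = inner x y"
    by (simp add: ent_times[OF d] inner_fmat_eq[OF assms(1)])
  ultimately show ?thesis using dims_1_1 by metis
qed

lemma rank_one_times:
  assumes "dims d 1 x" "dims d 1 y"
  shows "x * tp x * y = inner x y *\<^sub>R x"
  using tp_times_col[OF assms] times_idm[OF assms(1)] by (simp add: mult.assoc)

lemma inner_idm_idm: "inner (idm d) (idm d) = real d"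
proof -
  have "inner (idm d) (idm d) = (\<Sum>i<d. \<Sum>j<d. if i = j then 1 else 0)"
    using dims_intros(7)[of d] unfolding inner_fmat_eq[OF dims_intros(7)]
    by (intro sum.cong refl) (auto simp: ent_idm)
  then show ?thesis by simp
qed

text \<open>Thus \<open>inner (idm d) A\<close> is the trace, the form in which traces occur
  below.\<close>

lemma inner_idm: "dims m d A \<Longrightarrow> inner (idm d) A = (\<Sum>j<d. ent A j j)"
proof -
  have "inner (idm d) A = (\<Sum>i<d. \<Sum>j<d. if i = j then ent A j j else 0)"
    unfolding inner_fmat_eq[OF dims_intros(7)]
    by (intro sum.cong refl) (auto simp: ent_idm)
  then show ?thesis by simp
qed

section \<open>Compressed resolvents\<close>

text \<open>Testing with matrices \<open>B\<close> is the same as testing with each of their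
  columns, and gives bounds in the Frobenius norm directly.\<close>

definition psd :: "fmat \<Rightarrow> bool" where
  "psd S \<longleftrightarrow> tp S = S \<and> (\<forall>B. 0 \<le> inner B (S * B))"

definition proj :: "fmat \<Rightarrow> bool" where
  "proj P \<longleftrightarrow> tp P = P \<and> P * P = P"

text \<open>With \<open>P = W\<^sup>T W\<close> and \<open>W W\<^sup>T = I\<close>, the resolvent of \<open>S\<close> is \<open>W\<^sup>T (W S W\<^sup>T + l I)\<^sup>-\<^sup>1 W\<close>.\<close>

definition resolv :: "fmat \<Rightarrow> real \<Rightarrow> fmat \<Rightarrow> fmat \<Rightarrow> bool" where
  "resolv P l S R \<longleftrightarrow> tp R = R \<and> P * R = R \<and> P * S * R + l *\<^sub>R R = P"

text \<open>Nothing forces \<open>x\<close> to be a column: with \<open>x\<close> the transposed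
  data matrix this also covers the Gram matrix.\<close>

lemma psd_rank_one: "psd (x * tp x)"
  by (simp add: psd_def mult.assoc) (metis inner_ge_zero inner_times_left tp_simps(6))

lemma psd_add: "psd A \<Longrightarrow> psd B \<Longrightarrow> psd (A + B)"
  by (simp add: psd_def distrib_right inner_add_right)

lemma psd_scaleR: "psd A \<Longrightarrow> 0 \<le> a \<Longrightarrow> psd (a *\<^sub>R A)"
  by (simp add: psd_def)

lemma psd_0: "psd 0"
  by (simp add: psd_def)

lemma psd_sum: "(\<And>i. i \<in> I \<Longrightarrow> psd (A i)) \<Longrightarrow> psd (\<Sum>i\<in>I. A i)"
  by (induction I rule: infinite_finite_induct) (auto intro: psd_add simp: psd_0)

lemma inner_rank_one: "inner (x * tp x) A = inner x (A * x)"
  by (simp add: inner_times_right)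

section \<open>Identities and bounds for a single resolvent\<close>

context
  fixes P S R :: fmat and l :: real
  assumes P: "proj P" and S: "psd S" and l: "0 < l" and R: "resolv P l S R"
begin

lemma resolv_tp: "tp R = R" and resolv_left: "P * R = R" and resolv_eq: "P * S * R + l *\<^sub>R R = P"
  using R by (auto simp: resolv_def)

lemma resolv_right: "R * P = R"
  using resolv_left resolv_tp P by (metis proj_def tp_times)

lemma resolv_eq': "R * S * P + l *\<^sub>R R = P"
proof -
  have "tp (P * S * R + l *\<^sub>R R) = P" using resolv_eq P by (simp add: proj_def)
  then show ?thesis using P S resolv_tp by (simp add: proj_def psd_def mult.assoc)
qed

text \<open>The resolvent equation multiplied by \<open>R\<close> from the left, where
  \<open>P\<close> is absorbed. It writes \<open>R\<close> as a sum of two positive semidefinite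
  parts, the source of the bounds that follow.\<close>

lemma resolv_quad: "R * S * R + l *\<^sub>R (R * R) = R"
proof -
  have "R * (P * S * R + l *\<^sub>R R) = R" by (simp add: resolv_eq resolv_right)
  then show ?thesis by (simp add: distrib_left resolv_right flip: mult.assoc)
qed

lemma resolv_inner: "inner B (R * B) = inner (R * B) (S * (R * B)) + l * (norm (R * B))\<^sup>2"
proof -
  have "inner B (R * B) = inner B (R * S * R * B) + l * inner B (R * R * B)"
    by (subst resolv_quad[symmetric]) (simp add: distrib_right inner_add_right)
  also have "inner B (R * S * R * B) = inner (R * B) (S * (R * B))"
    by (simp add: inner_times_left resolv_tp mult.assoc)
  also have "inner B (R * R * B) = (norm (R * B))\<^sup>2"
    by (simp add: inner_times_left resolv_tp mult.assoc power2_norm_eq_inner)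
  finally show ?thesis .
qed

lemma resolv_lower: "l * (norm (R * B))\<^sup>2 \<le> inner B (R * B)"
  using S by (simp add: resolv_inner psd_def)

lemma resolv_nonneg: "0 \<le> inner B (R * B)"
  by (rule order.trans[OF _ resolv_lower]) (use l in simp)

text \<open>The operator norm bound \<open>1 / l\<close>: apply Cauchy-Schwarz to
  \<open>resolv_lower\<close> and cancel one factor \<open>norm (R * B)\<close>.\<close>

lemma resolv_norm_left: "norm (R * B) \<le> norm B / l"
proof (cases "norm (R * B) = 0")
  case False
  have "l * norm (R * B) * norm (R * B) \<le> norm B * norm (R * B)"
    using order.trans[OF resolv_lower norm_cauchy_schwarz] by (simp add: power2_eq_square mult.assoc)
  then have "l * norm (R * B) \<le> norm B"
    using False by simp
  then show ?thesis using l by (simp add: field_simps)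
qed (use l in simp)

lemma resolv_norm_right: "norm (B * R) \<le> norm B / l"
  using resolv_norm_left[of "tp B"] norm_tp[of "B * R"] by (simp add: resolv_tp)

lemma resolv_upper: "inner B (R * B) \<le> (norm B)\<^sup>2 / l"
proof -
  have "inner B (R * B) \<le> norm B * (norm B / l)"
    by (rule order.trans[OF norm_cauchy_schwarz]) (intro mult_left_mono resolv_norm_left norm_ge_zero)
  then show ?thesis by (simp add: power2_eq_square)
qed

lemma resolv_norm: "norm R \<le> norm P / l"
  using resolv_norm_left[of P] by (simp add: resolv_right)

text \<open>The resolvent equation paired with \<open>P\<close>. For the projections in use
  \<open>inner P P\<close> is the rank \<open>p\<close>, and \<open>inner P R\<close> is the trace
  of \<open>R\<close>.\<close>

lemma resolv_trace: "inner P P = inner S R + l * inner P R"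
proof -
  have "inner P P = inner P (P * S * R) + l * inner P R"
    by (subst (2) resolv_eq[symmetric]) (simp add: inner_add_right)
  also have "inner P (P * S * R) = inner (S * R) P"
    using P inner_times_left[of P "S * R" P]
    by (simp add: proj_def mult.assoc inner_commute[of P])
  also have "\<dots> = inner S R"
    using P resolv_left by (simp add: inner_times_right resolv_tp)
  finally show ?thesis .
qed

text \<open>\<open>resolv_quad\<close> paired with \<open>P\<close>. It leads to the equation for
  the limit of \<open>norm R\<close> and also evaluates the contribution of the training
  noise.\<close>

lemma resolv_trace2: "inner P R = inner S (R * R) + l * (norm R)\<^sup>2"
proof -
  have "inner P R = inner P (R * S * R) + l * inner P (R * R)"
    by (subst resolv_quad[symmetric]) (simp add: inner_add_right)
  also have "inner P (R * S * R) = inner (R * S * R) P" by (rule inner_commute)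
  also have "\<dots> = inner S (R * R)"
    using inner_times_right[of "R * S" R P] inner_times_left[of R S R]
    by (simp add: resolv_tp resolv_left)
  also have "inner P (R * R) = (norm R)\<^sup>2"
    by (subst inner_commute) (simp add: inner_times_right resolv_left resolv_tp power2_norm_eq_inner)
  finally show ?thesis .
qed

lemma resolv_trace_nonneg: "0 \<le> inner P R"
  using resolv_nonneg[of P] by (simp add: resolv_right)

lemma resolv_trace_le: "inner P R \<le> inner P P / l"
  using resolv_upper[of P] by (simp add: resolv_right power2_norm_eq_inner)

end

text \<open>The resolvent identity. Multiply the equation of \<open>R\<close> by \<open>R'\<close>
  from the left and the transposed equation of \<open>R'\<close> by \<open>R\<close> from the right;
  \<open>P\<close> is absorbed and the terms with \<open>l\<close> cancel.\<close>

lemma resolv_diff: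
  assumes P: "proj P" and S: "psd S" and S': "psd S'" and l: "0 < l"
    and R: "resolv P l S R" and R': "resolv P l S' R'"
  shows "R' - R = R' * (S - S') * R"
proof -
  have "R' * (P * S * R + l *\<^sub>R R) = R'"
    using resolv_eq[OF P S l R] resolv_right[OF P S' l R'] by simp
  moreover have "(R' * S' * P + l *\<^sub>R R') * R = R"
    using resolv_eq'[OF P S' l R'] resolv_left[OF P S l R] by simp
  ultimately have "R' - R = R' * P * S * R + l *\<^sub>R (R' * R) - (R' * S' * (P * R) + l *\<^sub>R (R' * R))"
    by (simp add: algebra_simps mult.assoc)
  then show ?thesis
    using resolv_right[OF P S' l R'] resolv_left[OF P S l R] by (simp add: algebra_simps)
qed

text \<open>Used to recognise a conjugated resolvent as the resolvent of conjugated data.\<close>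

lemma resolv_unique:
  assumes "proj P" "psd S" "0 < l" "resolv P l S R" "resolv P l S R'"
  shows "R = R'"
  using resolv_diff[OF assms(1) assms(2) assms(2) assms(3) assms(4) assms(5)] by simp

text \<open>With \<open>D = idm d - P\<close> one has
  \<open>S * R - idm d = - l R + D S R - D\<close>, and the three parts are pairwise orthogonal
  because \<open>P D\<close>, \<open>D R\<close> and \<open>R D\<close> vanish. They are the
  shrinkage inside the range of \<open>P\<close>, the leakage of the signal from outside this range
  into the estimate, and the discarded complement.\<close>

lemma norm_minus_idm:
  assumes P: "proj P" and S: "psd S" and l: "0 < l" and R: "resolv P l S R"
    and d: "dims d d P" "dims d d S" "dims d d R"
  shows "(norm (R * S - idm d))\<^sup>2 =
    l\<^sup>2 * (norm R)\<^sup>2 + (norm ((idm d - P) * S * R))\<^sup>2 + (real d - (norm P)\<^sup>2)"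
proof -
  note r = resolv_tp[OF P S l R] resolv_left[OF P S l R] resolv_right[OF P S l R] resolv_eq[OF P S l R]
  note PP = P[unfolded proj_def, THEN conjunct1] P[unfolded proj_def, THEN conjunct2]
  define D where "D = idm d - P"
  have II: "idm d * P = P" "P * idm d = P" "idm d * idm d = idm d" "idm d * R = R" "idm d * S = S"
      "R * idm d = R"
    using d by (auto intro!: idm_times times_idm)
  have PD: "P * D = 0" and DD: "D * D = D" and DP: "D * P = 0" and tD: "tp D = D" and RD: "R * D = 0"
    using II PP r by (simp_all add: D_def algebra_simps)
  have "norm (R * S - idm d) = norm (S * R - idm d)"
    using norm_tp[of "R * S - idm d"] S r(1) by (simp add: psd_def)
  then have "(norm (R * S - idm d))\<^sup>2 = inner (S * R - idm d) (S * R - idm d)"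
    by (simp add: power2_norm_eq_inner)
  moreover have "S * R - idm d = - (l *\<^sub>R R) + (D * S * R - D)"
  proof -
    have "S * R - idm d = P * S * R - P + (D * S * R - D)"
      using II by (simp add: D_def algebra_simps flip: mult.assoc)
    moreover have "P * S * R - P = - (l *\<^sub>R R)" using r(4) by (simp add: algebra_simps)
    ultimately show ?thesis by simp
  qed
  moreover have "inner R (D * S * R - D) = 0"
  proof -
    have "inner (P * R) (D * S * R - D) = inner R (P * D * S * R - P * D)"
      by (simp only: inner_times_left PP right_diff_distrib mult.assoc)
    then show ?thesis by (simp add: r PD)
  qed
  moreover have "inner (D * S * R) D = 0"
  proof -
    have "D * R = 0" using II r by (simp add: D_def algebra_simps)
    then show ?thesis using r by (simp add: inner_times_right)
  qed
  moreover have "inner R D = 0"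
    using PD inner_times_left[of P R D] PP r by simp
  moreover have "inner D D = real d - inner P P"
  proof -
    have "inner D P = 0" using PD DP tD inner_times_left[of D D P] DD by simp
    then have "inner (idm d) P = inner P P" by (simp add: D_def inner_diff_left)
    then show ?thesis
      by (simp add: D_def inner_diff_left inner_diff_right inner_idm_idm inner_commute)
  qed
  ultimately show ?thesis
    unfolding D_def[symmetric] power2_norm_eq_inner[of R] power2_norm_eq_inner[of P]
      power2_norm_eq_inner[of "D * S * R"]
    by (simp add: inner_diff_left inner_diff_right inner_add_left inner_add_right inner_commute
        power2_eq_square algebra_simps)
qed

subsection \<open>Removing one observation\<close>

locale leave_one_out =
  fixes P S R S' R' x :: fmat and l c :: real and d :: nat
  assumes P: "proj P" and S': "psd S'" and l: "0 < l" and c: "0 \<le> c"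
    and S_eq: "S = S' + c *\<^sub>R (x * tp x)"
    and R: "resolv P l S R" and R': "resolv P l S' R'"
    and x: "dims d 1 x" and dR: "dims d d R" "dims d d R'" and dP: "dims d d P"
begin

text \<open>\<open>1 + q\<close> is the Sherman-Morrison denominator of the removed row and
  \<open>r\<close> its analogue for the squared resolvent. Both use \<open>R'\<close>, which for
  random data is independent of \<open>x\<close>.\<close>

definition "q = c * inner x (R' * x)"
definition "r = c * inner x (R' * (R' * x))"

lemma S: "psd S"
  unfolding S_eq by (intro psd_add S' psd_scaleR psd_rank_one c)

lemmas R_facts = resolv_tp[OF P S l R] resolv_left[OF P S l R] resolv_right[OF P S l R]
lemmas R'_facts = resolv_tp[OF P S' l R'] resolv_left[OF P S' l R'] resolv_right[OF P S' l R']

lemma r_eq: "r = c * (norm (R' * x))\<^sup>2"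
  by (simp add: r_def inner_times_left[symmetric] R'_facts power2_norm_eq_inner)
     (metis R'_facts(1) inner_times_left)

lemma r_nonneg: "0 \<le> r" using c by (simp add: r_eq)

lemma r_le: "r \<le> q / l"
proof -
  have "l * r \<le> q"
    using mult_left_mono[OF resolv_lower[OF P S' l R', of x] c] by (simp add: r_eq q_def mult_ac)
  then show ?thesis using l by (simp add: field_simps)
qed

lemma q_nonneg: "0 \<le> q"
  using c resolv_nonneg[OF P S' l R'] by (simp add: q_def)

text \<open>Sherman-Morrison without inverses: the resolvent identity gives
  \<open>R x = (1 - w) R' x\<close> with \<open>w = c (x, R x)\<close>, and pairing this with
  \<open>x\<close> yields \<open>w = (1 - w) q\<close>.\<close>

lemma R_x: "R * x = (1 / (1 + q)) *\<^sub>R (R' * x)"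
proof -
  have dx: "dims d 1 (R * x)" "dims d 1 (R' * x)" using dR x by blast+
  define w where "w = c * inner x (R * x)"
  have "R' * x - R * x = R' * (S - S') * R * x"
    using resolv_diff[OF P S S' l R R'] by (metis left_diff_distrib)
  also have "\<dots> = c *\<^sub>R (R' * (x * tp x * (R * x)))"
    by (simp add: S_eq mult.assoc)
  also have "\<dots> = w *\<^sub>R (R' * x)"
    by (simp add: rank_one_times[OF x dx(1)] w_def)
  finally have *: "R * x = (1 - w) *\<^sub>R (R' * x)"
    by (simp add: algebra_simps)
  have "w = (1 - w) * q"
    unfolding w_def[of] by (subst *) (simp add: q_def w_def)
  then have "1 - w = 1 / (1 + q)"
    using q_nonneg by (simp add: field_simps)
  with * show ?thesis by simp
qed

lemma quad_R: "c * inner x (R * x) = q / (1 + q)"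
  by (simp add: R_x q_def)

lemma quad_RR: "c * inner x (R * (R * x)) = r / (1 + q)\<^sup>2"
proof -
  have "inner x (R * (R * x)) = inner (R * x) (R * x)"
    by (simp add: inner_times_left R_facts)
  also have "\<dots> = (norm (R' * x))\<^sup>2 / (1 + q)\<^sup>2"
    unfolding R_x power2_norm_eq_inner by (simp add: power2_eq_square)
  finally show ?thesis by (simp add: r_eq)
qed

lemma diff_eq: "R' - R = (c / (1 + q)) *\<^sub>R (R' * x * tp (R' * x))"
proof -
  have "R' - R = c *\<^sub>R (R' * x * tp (R * x))"
    using resolv_diff[OF P S S' l R R'] by (simp add: S_eq mult.assoc R_facts)
  then show ?thesis by (simp add: R_x)
qed

text \<open>The rank one update applied a second time; it removes \<open>R\<close> from the mixed
  term in favour of \<open>R'\<close>.\<close>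

lemma RR_x: "R * (R * x) = (1 / (1 + q)) *\<^sub>R (R' * (R' * x)) - (r / (1 + q)\<^sup>2) *\<^sub>R (R' * x)"
proof -
  have dx: "dims d 1 (R' * x)" using dR x by blast
  have R: "R = R' - (c / (1 + q)) *\<^sub>R (R' * x * tp (R' * x))"
    using diff_eq by (simp add: algebra_simps)
  have "R * (R' * x) = R' * (R' * x) - (c / (1 + q) * inner (R' * x) (R' * x)) *\<^sub>R (R' * x)"
    by (subst R) (simp only: left_diff_distrib mult_scaleR_left rank_one_times[OF dx dx] scaleR_scaleR)
  then show ?thesis
    unfolding R_x r_eq power2_norm_eq_inner by (simp add: scaleR_diff_right power2_eq_square)
qed

text \<open>Bounds that are uniform in \<open>x\<close>, although \<open>q\<close> and
  \<open>r\<close> are not bounded: \<open>r\<close> is at most \<open>q / l\<close>, and the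
  denominator absorbs \<open>q\<close>.\<close>

lemma r_div_le: "r / (1 + q) \<le> 1 / l" "r / (1 + q)\<^sup>2 \<le> 1 / l"
proof -
  have "r \<le> (1 + q) / l" using r_le l by (simp add: field_simps)
  then show *: "r / (1 + q) \<le> 1 / l" using q_nonneg l by (simp add: field_simps)
  have "r / (1 + q)\<^sup>2 \<le> r / (1 + q)"
    using q_nonneg r_nonneg by (intro divide_left_mono) (auto simp: power2_eq_square)
  with * show "r / (1 + q)\<^sup>2 \<le> 1 / l" by simp
qed

lemma trace_diff: "\<bar>inner P R' - inner P R\<bar> \<le> 1 / l"
proof -
  have "inner P R' - inner P R = inner P (R' - R)" by (simp add: inner_diff_right)
  also have "\<dots> = c / (1 + q) * inner (R' * x * tp (R' * x)) P"
    unfolding diff_eq by (simp only: inner_scaleR_right inner_commute)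
  also have "inner (R' * x * tp (R' * x)) P = (norm (R' * x))\<^sup>2"
    unfolding inner_rank_one by (simp add: R'_facts power2_norm_eq_inner flip: mult.assoc)
  finally have "inner P R' - inner P R = r / (1 + q)" by (simp add: r_eq)
  then show ?thesis using r_div_le r_nonneg q_nonneg by simp
qed

lemma norm_diff: "\<bar>(norm R')\<^sup>2 - (norm R)\<^sup>2\<bar> \<le> 2 / l\<^sup>2"
proof -
  have "(norm R')\<^sup>2 - (norm R)\<^sup>2 = inner (R' - R) (R' + R)"
    by (simp add: power2_norm_eq_inner inner_diff_left inner_add_right inner_commute[of R R'])
  also have "\<dots> = c / (1 + q) * (inner (R' * x) (R' * (R' * x)) + inner (R' * x) (R * (R' * x)))"
    unfolding diff_eq by (simp only: inner_scaleR_left inner_rank_one distrib_left distrib_right inner_add_right)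
  finally have *: "(norm R')\<^sup>2 - (norm R)\<^sup>2 = \<dots>" .
  have "inner (R' * x) (R' * (R' * x)) + inner (R' * x) (R * (R' * x)) \<le> 2 * (norm (R' * x))\<^sup>2 / l"
    using resolv_upper[OF P S' l R', of "R' * x"] resolv_upper[OF P S l R, of "R' * x"] by simp
  then have "(norm R')\<^sup>2 - (norm R)\<^sup>2 \<le> c / (1 + q) * (2 * (norm (R' * x))\<^sup>2 / l)"
    unfolding * using c q_nonneg by (intro mult_left_mono) auto
  also have "\<dots> = 2 / l * (r / (1 + q))" by (simp add: r_eq mult_ac)
  also have "\<dots> \<le> 2 / l * (1 / l)" using r_div_le(1) l by (intro mult_left_mono) auto
  finally have "(norm R')\<^sup>2 - (norm R)\<^sup>2 \<le> 2 / l\<^sup>2" by (simp add: power2_eq_square)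
  moreover have "0 \<le> (norm R')\<^sup>2 - (norm R)\<^sup>2"
    unfolding * using c q_nonneg resolv_nonneg[OF P S' l R'] resolv_nonneg[OF P S l R] by simp
  ultimately show ?thesis by simp
qed

text \<open>Two replacements: the quadratic form by the trace of \<open>R'\<close>, with a random
  error, and this trace by that of \<open>R\<close>, which costs at most \<open>c / l\<close> by
  \<open>trace_diff\<close>.\<close>

lemma q_minus_trace: "\<bar>q - c * inner P R\<bar> \<le> c * \<bar>inner x (R' * x) - inner P R'\<bar> + c / l"
proof -
  have "q - c * inner P R = c * (inner x (R' * x) - inner P R') + c * (inner P R' - inner P R)"
    by (simp add: q_def algebra_simps)
  also have "\<bar>\<dots>\<bar> \<le> c * \<bar>inner x (R' * x) - inner P R'\<bar> + c * (1 / l)"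
    using mult_left_mono[OF trace_diff c] c
    by (intro order.trans[OF abs_triangle_ineq]) (simp add: abs_mult)
  finally show ?thesis by simp
qed

lemma r_minus_norm:
  "\<bar>r - c * (norm R)\<^sup>2\<bar> \<le> c * \<bar>inner x (R' * R' * x) - inner P (R' * R')\<bar> + 2 * c / l\<^sup>2"
proof -
  have "inner P (R' * R') = (norm R')\<^sup>2"
    by (subst inner_commute) (simp add: inner_times_right R'_facts power2_norm_eq_inner)
  then have "r - c * (norm R)\<^sup>2 =
      c * (inner x (R' * R' * x) - inner P (R' * R')) + c * ((norm R')\<^sup>2 - (norm R)\<^sup>2)"
    by (simp add: r_def algebra_simps mult.assoc)
  also have "\<bar>\<dots>\<bar> \<le> c * \<bar>inner x (R' * R' * x) - inner P (R' * R')\<bar> + c * (2 / l\<^sup>2)"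
    using mult_left_mono[OF norm_diff c] c
    by (intro order.trans[OF abs_triangle_ineq]) (simp add: abs_mult)
  finally show ?thesis by (simp add: mult.commute)
qed

text \<open>\<open>S\<close> still contains the row \<open>x\<close>. Its rank one part gives the
  main term, with the factor \<open>c * inner x (D * x)\<close> that \<open>om\<close> approximates.
  The remaining forms contain only \<open>S'\<close> and \<open>R'\<close>, and later they
  concentrate around a trace that is zero.\<close>

lemma cross_term:
  assumes D: "dims d d D"
  shows "\<bar>inner x (D * S * R * R * x) - om * inner x (R * R * x)\<bar> \<le>
    \<bar>inner x (D * S' * R' * R' * x)\<bar> + \<bar>inner x (D * S' * R' * x)\<bar> / l
      + \<bar>inner x (D * x) * c - om\<bar> * inner x (R * R * x)"
proof -
  have dx: "dims d 1 (R * (R * x))" "dims d 1 (D * x)" using dR x D by blast+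
  have pos: "0 \<le> inner x (R * R * x)"
    using inner_ge_zero[of "R * x"] by (simp add: inner_times_left R_facts mult.assoc)
  have "inner x (D * S * R * R * x) =
      inner x (D * S' * (R * (R * x))) + c * inner x (D * (x * tp x * (R * (R * x))))"
    by (simp add: S_eq algebra_simps inner_add_right mult.assoc)
  also have "inner x (D * (x * tp x * (R * (R * x)))) = inner x (R * R * x) * inner x (D * x)"
    unfolding rank_one_times[OF x dx(1)] by (simp add: mult.assoc)
  also have "inner x (D * S' * (R * (R * x))) =
      inner x (D * S' * R' * R' * x) / (1 + q) - r / (1 + q)\<^sup>2 * inner x (D * S' * R' * x)"
    unfolding RR_x by (simp add: right_diff_distrib inner_diff_right mult.assoc)
  finally have "inner x (D * S * R * R * x) - om * inner x (R * R * x) =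
      inner x (D * S' * R' * R' * x) / (1 + q) - r / (1 + q)\<^sup>2 * inner x (D * S' * R' * x)
      + (inner x (D * x) * c - om) * inner x (R * R * x)"
    by (simp add: algebra_simps)
  moreover have "\<bar>inner x (D * S' * R' * R' * x) / (1 + q)\<bar> \<le> \<bar>inner x (D * S' * R' * R' * x)\<bar>"
    using divide_left_mono[of 1 "1 + q" "\<bar>inner x (D * S' * R' * R' * x)\<bar>"] q_nonneg by simp
  moreover have "\<bar>r / (1 + q)\<^sup>2 * inner x (D * S' * R' * x)\<bar> \<le> \<bar>inner x (D * S' * R' * x)\<bar> / l"
    using mult_right_mono[OF r_div_le(2), of "\<bar>inner x (D * S' * R' * x)\<bar>"] r_nonneg
    by (simp add: abs_mult)
  moreover have "\<bar>(inner x (D * x) * c - om) * inner x (R * R * x)\<bar> =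
      \<bar>inner x (D * x) * c - om\<bar> * inner x (R * R * x)"
    using pos by (simp add: abs_mult)
  ultimately show ?thesis by linarith
qed

end

section \<open>Averages over all observations\<close>

locale sample_resolvent =
  fixes n d :: nat and x :: "nat \<Rightarrow> fmat" and P S R :: fmat and S' R' :: "nat \<Rightarrow> fmat" and l :: real
  assumes n: "0 < n" and P: "proj P" and l: "0 < l" and dP: "dims d d P"
    and x: "\<And>i. i < n \<Longrightarrow> dims d 1 (x i)"
    and S_def: "S = (1 / real n) *\<^sub>R (\<Sum>i<n. x i * tp (x i))"
    and S'_def: "\<And>i. i < n \<Longrightarrow> S' i = S - (1 / real n) *\<^sub>R (x i * tp (x i))"
    and R: "resolv P l S R" and R': "\<And>i. i < n \<Longrightarrow> resolv P l (S' i) (R' i)"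
    and dR: "dims d d R" "\<And>i. i < n \<Longrightarrow> dims d d (R' i)"
begin

lemma S: "psd S"
  unfolding S_def by (intro psd_scaleR psd_sum psd_rank_one) simp

lemma S'_eq: "i < n \<Longrightarrow> S' i = (1 / real n) *\<^sub>R (\<Sum>k\<in>{..<n} - {i}. x k * tp (x k))"
  by (simp add: S'_def S_def sum_diff1 flip: scaleR_diff_right)

lemma S': "i < n \<Longrightarrow> psd (S' i)"
  unfolding S'_eq by (intro psd_scaleR psd_sum psd_rank_one) simp

lemma loo: "i < n \<Longrightarrow> leave_one_out P S R (S' i) (R' i) (x i) l (1 / real n) d"
  by unfold_locales (use P S' l R R' x dR dP in \<open>auto simp: S'_def\<close>)

text \<open>\<open>inner P R\<close> is the trace of \<open>R\<close> since
  \<open>P * R = R\<close>. The normalisation is by \<open>n\<close>, the scale on which each single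
  \<open>q i\<close> is comparable with \<open>t\<close>.\<close>

definition "t = inner P R / n"
definition "\<tau> = (norm R)\<^sup>2 / n"
definition "q i = inner (x i) (R' i * x i) / n"
definition "r i = inner (x i) (R' i * (R' i * x i)) / n"

lemma t_nonneg: "0 \<le> t"
  using resolv_trace_nonneg[OF P S l R] by (simp add: t_def)

lemma \<tau>_nonneg: "0 \<le> \<tau>" by (simp add: \<tau>_def)

lemma inner_S: "inner S A = (\<Sum>i<n. inner (x i) (A * x i)) / n"
  by (simp add: S_def inner_sum_left inner_rank_one)

text \<open>Exact, without error term: \<open>inner S R\<close> is an average of quadratic forms in
  the rows, and \<open>quad_R\<close> rewrites each one by the resolvent that omits its row.\<close>

lemma sum_q: "inner P P / n - l * t = (\<Sum>i<n. q i / (1 + q i)) / n"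
proof -
  have "inner P P / n - l * t = inner S R / n"
    using resolv_trace[OF P S l R] by (simp add: t_def diff_divide_distrib[symmetric])
  also have "\<dots> = (\<Sum>i<n. inner (x i) (R * x i) / n) / n"
    by (simp add: inner_S sum_divide_distrib)
  also have "\<dots> = (\<Sum>i<n. q i / (1 + q i)) / n"
    using leave_one_out.quad_R[OF loo] by (simp add: q_def leave_one_out.q_def[OF loo])
  finally show ?thesis .
qed

lemma sum_r: "t - l * \<tau> = (\<Sum>i<n. r i / (1 + q i)\<^sup>2) / n"
proof -
  have "t - l * \<tau> = inner S (R * R) / n"
    using resolv_trace2[OF P S l R] by (simp add: t_def \<tau>_def diff_divide_distrib[symmetric])
  also have "\<dots> = (\<Sum>i<n. inner (x i) (R * (R * x i)) / n) / n"
    by (simp add: inner_S sum_divide_distrib mult.assoc)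
  also have "\<dots> = (\<Sum>i<n. r i / (1 + q i)\<^sup>2) / n"
    using leave_one_out.quad_RR[OF loo]
    by (simp add: r_def q_def leave_one_out.q_def[OF loo] leave_one_out.r_def[OF loo])
  finally show ?thesis .
qed

lemma q_nonneg: "i < n \<Longrightarrow> 0 \<le> q i"
  using leave_one_out.q_nonneg[OF loo] by (simp add: q_def leave_one_out.q_def[OF loo])

definition "e1 i = \<bar>inner (x i) (R' i * x i) - inner P (R' i)\<bar> / n"
definition "e2 i = \<bar>inner (x i) (R' i * R' i * x i) - inner P (R' i * R' i)\<bar> / n"

lemma q_minus_t: "i < n \<Longrightarrow> \<bar>q i - t\<bar> \<le> e1 i + 1 / (n * l)"
  using leave_one_out.q_minus_trace[OF loo]
  by (simp add: q_def t_def e1_def leave_one_out.q_def[OF loo])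

lemma r_minus_\<tau>: "i < n \<Longrightarrow> \<bar>r i - \<tau>\<bar> \<le> e2 i + 2 / (n * l\<^sup>2)"
  using leave_one_out.r_minus_norm[OF loo]
  by (simp add: r_def \<tau>_def e2_def leave_one_out.r_def[OF loo])

end

lemma frac_diff_le:
  fixes a b :: real
  assumes "0 \<le> a" "0 \<le> b"
  shows "\<bar>a / (1 + a) - b / (1 + b)\<bar> \<le> \<bar>a - b\<bar>"
proof -
  have "a / (1 + a) - b / (1 + b) = (a - b) / ((1 + a) * (1 + b))"
    using assms by (simp add: divide_simps) (simp add: algebra_simps)
  moreover have "1 \<le> (1 + a) * (1 + b)"
    using assms mult_mono[of 1 "1 + a" 1 "1 + b"] by simp
  then have "\<bar>(a - b) / ((1 + a) * (1 + b))\<bar> \<le> \<bar>a - b\<bar> / 1"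
    unfolding abs_divide by (intro divide_left_mono) auto
  ultimately show ?thesis by simp
qed

lemma inverse_square_diff_le:
  fixes a b :: real
  assumes "0 \<le> a" "0 \<le> b"
  shows "\<bar>1 / (1 + a)\<^sup>2 - 1 / (1 + b)\<^sup>2\<bar> \<le> 2 * \<bar>a - b\<bar>"
proof -
  have *: "1 / (1 + a) - 1 / (1 + b) = b / (1 + b) - a / (1 + a)"
    using assms by (simp add: divide_simps) (simp add: algebra_simps)
  have "1 / (1 + a)\<^sup>2 - 1 / (1 + b)\<^sup>2 = (1 / (1 + a) + 1 / (1 + b)) * (1 / (1 + a) - 1 / (1 + b))"
    by (simp add: algebra_simps power2_eq_square)
  also have "\<bar>\<dots>\<bar> \<le> 2 * \<bar>a - b\<bar>"
    unfolding abs_mult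
  proof (rule mult_mono)
    have "1 / (1 + a) \<le> 1" "1 / (1 + b) \<le> 1" "0 \<le> 1 / (1 + a)" "0 \<le> 1 / (1 + b)"
      using assms by auto
    then show "\<bar>1 / (1 + a) + 1 / (1 + b)\<bar> \<le> 2" by linarith
    show "\<bar>1 / (1 + a) - 1 / (1 + b)\<bar> \<le> \<bar>a - b\<bar>"
      using frac_diff_le[OF assms] unfolding * by (simp add: abs_minus_commute)
  qed auto
  finally show ?thesis .
qed

context sample_resolvent
begin

text \<open>
  The limit \<open>T\<close> of \<open>t\<close> solves \<open>g - l T = T / (1 + T)\<close>, the fixed point equation obtained from
  \<open>sum_q\<close> by replacing every \<open>q i\<close> with \<open>t\<close>.  The left-hand side minus the right-hand side has
  slope at most \<open>- l\<close>, so an approximate solution is close to \<open>T\<close>.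
\<close>

lemma t_close:
  assumes T: "0 \<le> T" "g - l * T = T / (1 + T)"
  shows "l * \<bar>t - T\<bar> \<le> \<bar>inner P P / n - g\<bar> + (\<Sum>i<n. e1 i) / n + 1 / (n * l)"
proof -
  have "\<bar>(\<Sum>i<n. q i / (1 + q i)) / n - t / (1 + t)\<bar> = \<bar>\<Sum>i<n. q i / (1 + q i) - t / (1 + t)\<bar> / n"
    using n by (simp add: sum_subtractf field_simps abs_divide)
  also have "\<dots> \<le> (\<Sum>i<n. e1 i + 1 / (n * l)) / n"
  proof (rule divide_right_mono)
    show "\<bar>\<Sum>i<n. q i / (1 + q i) - t / (1 + t)\<bar> \<le> (\<Sum>i<n. e1 i + 1 / (n * l))"
      using frac_diff_le[OF q_nonneg t_nonneg] q_minus_t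
      by (intro order.trans[OF sum_abs] sum_mono) (meson lessThan_iff order.trans)
  qed simp
  also have "\<dots> = (\<Sum>i<n. e1 i) / n + 1 / (n * l)"
    using n by (simp add: sum.distrib add_divide_distrib)
  finally have *: "\<bar>inner P P / n - l * t - t / (1 + t)\<bar> \<le> (\<Sum>i<n. e1 i) / n + 1 / (n * l)"
    by (simp add: sum_q)
  have mono: "a / (1 + a) \<le> b / (1 + b)" if "0 \<le> a" "a \<le> b" for a b :: real
    using that by (simp add: field_simps)
  show ?thesis
  proof (cases "T \<le> t")
    case True
    then have "l * \<bar>t - T\<bar> = l * t - l * T" by (simp add: right_diff_distrib)
    with mono[OF T(1) True] * T(2) show ?thesis by linarith
  next
    case False
    then have "l * \<bar>t - T\<bar> = l * T - l * t" by (simp add: right_diff_distrib)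
    moreover have "t / (1 + t) \<le> T / (1 + T)" using mono[OF t_nonneg, of T] False by simp
    ultimately show ?thesis using * T(2) by linarith
  qed
qed

text \<open>Replacing every \<open>r i\<close> by \<open>\<tau>\<close> and every \<open>q i\<close>
  and \<open>t\<close> by \<open>T\<close> in \<open>sum_r\<close> gives
  \<open>T - l \<tau> = \<tau> / (1 + T)^2\<close>, a linear equation solved by the fraction in the
  statement. The random factors \<open>\<tau>\<close> in the error are later replaced by a
  deterministic bound.\<close>

lemma \<tau>_close:
  assumes T: "0 \<le> T"
  shows "l * \<bar>\<tau> - T / (l + 1 / (1 + T)\<^sup>2)\<bar> \<le> (1 + 2 * \<tau>) * \<bar>t - T\<bar>
    + (\<Sum>i<n. e2 i) / n + 2 / (n * l\<^sup>2) + 2 * \<tau> * ((\<Sum>i<n. e1 i) / n + 1 / (n * l))"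
proof -
  define b where "b = 1 / (1 + T)\<^sup>2"
  have b: "0 \<le> b" by (simp add: b_def)
  have step: "\<bar>r i / (1 + q i)\<^sup>2 - \<tau> * b\<bar> \<le>
      e2 i + 2 / (n * l\<^sup>2) + 2 * \<tau> * (e1 i + 1 / (n * l) + \<bar>t - T\<bar>)" if i: "i < n" for i
  proof -
    have "r i / (1 + q i)\<^sup>2 - \<tau> * b = (r i - \<tau>) / (1 + q i)\<^sup>2 + \<tau> * (1 / (1 + q i)\<^sup>2 - b)"
      by (simp add: algebra_simps diff_divide_distrib)
    also have "\<bar>\<dots>\<bar> \<le> \<bar>(r i - \<tau>) / (1 + q i)\<^sup>2\<bar> + \<bar>\<tau> * (1 / (1 + q i)\<^sup>2 - b)\<bar>"
      by (rule abs_triangle_ineq)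
    also have "\<bar>(r i - \<tau>) / (1 + q i)\<^sup>2\<bar> \<le> \<bar>r i - \<tau>\<bar> / 1"
      unfolding abs_divide using q_nonneg[OF i] by (intro divide_left_mono) auto
    also have "\<dots> \<le> e2 i + 2 / (n * l\<^sup>2)" using r_minus_\<tau>[OF i] by simp
    also have "\<bar>\<tau> * (1 / (1 + q i)\<^sup>2 - b)\<bar> = \<tau> * \<bar>1 / (1 + q i)\<^sup>2 - b\<bar>"
      using \<tau>_nonneg by (simp add: abs_mult)
    also have "\<dots> \<le> \<tau> * (2 * \<bar>q i - T\<bar>)"
      unfolding b_def using q_nonneg[OF i] T \<tau>_nonneg
      by (intro mult_left_mono inverse_square_diff_le)
    also have "\<dots> \<le> \<tau> * (2 * (e1 i + 1 / (n * l) + \<bar>t - T\<bar>))"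
      using q_minus_t[OF i] \<tau>_nonneg by (intro mult_left_mono) auto
    finally show ?thesis by (simp add: algebra_simps)
  qed
  have "\<bar>t - l * \<tau> - \<tau> * b\<bar> = \<bar>\<Sum>i<n. r i / (1 + q i)\<^sup>2 - \<tau> * b\<bar> / n"
    using n by (simp add: sum_r sum_subtractf field_simps abs_divide)
  also have "\<dots> \<le> (\<Sum>i<n. e2 i + 2 / (n * l\<^sup>2) + 2 * \<tau> * (e1 i + 1 / (n * l) + \<bar>t - T\<bar>)) / n"
    using step by (intro divide_right_mono order.trans[OF sum_abs] sum_mono) auto
  also have "\<dots> = (\<Sum>i<n. e2 i) / n + 2 / (n * l\<^sup>2) + 2 * \<tau> * ((\<Sum>i<n. e1 i) / n + 1 / (n * l) + \<bar>t - T\<bar>)"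
    using n by (simp add: sum.distrib sum_distrib_left[symmetric] add_divide_distrib distrib_left mult_ac)
  finally have *: "\<bar>t - l * \<tau> - \<tau> * b\<bar> \<le> \<dots>" .
  have "(l + b) * (\<tau> - T / (l + b)) = (t - T) - (t - l * \<tau> - \<tau> * b)"
    using l b by (simp add: right_diff_distrib) (simp add: algebra_simps)
  then have "(l + b) * \<bar>\<tau> - T / (l + b)\<bar> \<le> \<bar>t - T\<bar> + \<bar>t - l * \<tau> - \<tau> * b\<bar>"
    using abs_triangle_ineq4[of "t - T" "t - l * \<tau> - \<tau> * b"] l b abs_mult[of "l + b" "\<tau> - T / (l + b)"]
    by simp
  moreover have "l * \<bar>\<tau> - T / (l + b)\<bar> \<le> (l + b) * \<bar>\<tau> - T / (l + b)\<bar>"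
    using b by (intro mult_right_mono) auto
  ultimately have "l * \<bar>\<tau> - T / (l + b)\<bar> \<le> \<bar>t - T\<bar> + ((\<Sum>i<n. e2 i) / n + 2 / (n * l\<^sup>2)
      + 2 * \<tau> * ((\<Sum>i<n. e1 i) / n + 1 / (n * l) + \<bar>t - T\<bar>))"
    using * by linarith
  then show ?thesis unfolding b_def by (simp add: algebra_simps)
qed

text \<open>Since \<open>D\<close> is a projection, the squared norm equals
  \<open>inner S (D * S * R * R)\<close>, again an average of quadratic forms in the rows. The main
  terms carry the weights \<open>inner (x i) (R * R * x i) / n\<close>, whose average is
  \<open>t - l * \<tau>\<close> by \<open>resolv_trace2\<close>; hence \<open>om\<close> is the only
  new quantity.\<close>

lemma cross_close:
  defines "D \<equiv> idm d - P"
  assumes dS: "dims d d S"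
  shows "\<bar>(norm (D * S * R))\<^sup>2 / n - om * (t - l * \<tau>)\<bar> \<le>
    (\<Sum>i<n. \<bar>inner (x i) (D * S' i * R' i * R' i * x i)\<bar> / n
      + \<bar>inner (x i) (D * S' i * R' i * x i)\<bar> / n / l
      + \<bar>inner (x i) (D * x i) / n - om\<bar> / l) / n"
proof -
  have D: "dims d d D" unfolding D_def using dP by blast
  have DD: "D * D = D" "tp D = D"
    using P idm_times[OF dP] times_idm[OF dP] idm_times[OF dims_intros(7)]
    by (simp_all add: D_def proj_def algebra_simps)
  have "(norm (D * S * R))\<^sup>2 = inner (S * R) (D * S * R)"
    using inner_times_left[of D "S * R" "D * S * R"]
    by (simp add: power2_norm_eq_inner DD mult.assoc) (simp add: DD flip: mult.assoc)
  also have "\<dots> = inner S (D * S * R * R)"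
    by (simp add: inner_times_right resolv_tp[OF P S l R])
  finally have "(norm (D * S * R))\<^sup>2 / n = (\<Sum>i<n. inner (x i) (D * S * R * R * x i) / n) / n"
    by (simp add: inner_S sum_divide_distrib)
  moreover have "t - l * \<tau> = (\<Sum>i<n. inner (x i) (R * R * x i) / n) / n"
    using resolv_trace2[OF P S l R]
    by (simp add: t_def \<tau>_def diff_divide_distrib[symmetric] inner_S sum_divide_distrib)
  ultimately have "\<bar>(norm (D * S * R))\<^sup>2 / n - om * (t - l * \<tau>)\<bar> =
     \<bar>\<Sum>i<n. (inner (x i) (D * S * R * R * x i) - om * inner (x i) (R * R * x i)) / n\<bar> / n"
    using n by (simp add: sum_distrib_left sum_subtractf diff_divide_distrib)
      (simp flip: sum_divide_distrib sum_distrib_left diff_divide_distrib)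
  also have "\<dots> \<le> (\<Sum>i<n. \<bar>inner (x i) (D * S' i * R' i * R' i * x i)\<bar> / n
      + \<bar>inner (x i) (D * S' i * R' i * x i)\<bar> / n / l
      + \<bar>inner (x i) (D * x i) / n - om\<bar> / l) / n"
  proof (intro divide_right_mono order.trans[OF sum_abs] sum_mono)
    fix i assume "i \<in> {..<n}"
    then have i: "i < n" by simp
    have rr: "inner (x i) (R * R * x i) / n \<le> 1 / l"
      using leave_one_out.quad_RR[OF loo[OF i]] leave_one_out.r_div_le(2)[OF loo[OF i]]
      by (simp add: mult.assoc)
    have "\<bar>inner (x i) (D * S * R * R * x i) - om * inner (x i) (R * R * x i)\<bar> / n \<le>
      (\<bar>inner (x i) (D * S' i * R' i * R' i * x i)\<bar> + \<bar>inner (x i) (D * S' i * R' i * x i)\<bar> / l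
      + \<bar>inner (x i) (D * x i) * (1 / n) - om\<bar> * inner (x i) (R * R * x i)) / n"
      using leave_one_out.cross_term[OF loo[OF i] D] by (intro divide_right_mono) auto
    also have "\<dots> = \<bar>inner (x i) (D * S' i * R' i * R' i * x i)\<bar> / n
      + \<bar>inner (x i) (D * S' i * R' i * x i)\<bar> / n / l
      + \<bar>inner (x i) (D * x i) / n - om\<bar> * (inner (x i) (R * R * x i) / n)"
      by (simp add: add_divide_distrib)
    also have "\<dots> \<le> \<bar>inner (x i) (D * S' i * R' i * R' i * x i)\<bar> / n
      + \<bar>inner (x i) (D * S' i * R' i * x i)\<bar> / n / l
      + \<bar>inner (x i) (D * x i) / n - om\<bar> * (1 / l)"
      using rr by (intro add_left_mono mult_left_mono) auto
    finally show "\<bar>(inner (x i) (D * S * R * R * x i) - om * inner (x i) (R * R * x i)) / n\<bar> \<le>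
      \<bar>inner (x i) (D * S' i * R' i * R' i * x i)\<bar> / n
      + \<bar>inner (x i) (D * S' i * R' i * x i)\<bar> / n / l
      + \<bar>inner (x i) (D * x i) / n - om\<bar> / l"
      by simp
  qed simp
  finally show ?thesis .
qed

end

section \<open>Moments of independent entries\<close>

lift_definition colv :: "nat \<Rightarrow> (nat \<Rightarrow> real) \<Rightarrow> fmat" is
  "\<lambda>d f i j. if i < d \<and> j = 0 then f i else 0"
  subgoal for d f by (rule exI[of _ "Suc d"]) auto
  done

lemma dims_colv [intro]: "dims d 1 (colv d f)"
  by (simp add: dims_def colv.rep_eq)

lemma inner_colv:
  assumes "dims d d B"
  shows "inner (colv d f) (B * colv d f) = (\<Sum>j<d. \<Sum>k<d. ent B j k * (f j * f k))"
  unfolding inner_fmat_eq[OF dims_colv] ent_times[OF assms]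
  by (simp add: colv.rep_eq sum_distrib_left ac_simps)

text \<open>Writes a coordinate as a product over all of \<open>J\<close>, so that monomials fall
  under the product formula for integrals.\<close>

lemma prod_of_bool: "finite J \<Longrightarrow> a \<in> J \<Longrightarrow> (\<Prod>i\<in>J. w i ^ (of_bool (i = a) :: nat)) = (w a :: real)"
  by (subst prod.remove[of _ a]) (auto intro!: prod.neutral)

text \<open>Kept apart from \<open>entry_moments\<close>, since noise and signal have variances
  other than one, possibly zero.\<close>

lemma
  assumes N: "real_distribution N" and int: "integrable N (\<lambda>z. z\<^sup>2)" and mean: "(\<integral>z. z \<partial>N) = 0"
    and var: "(\<integral>z. z\<^sup>2 \<partial>N) = v" and J: "finite J" "a \<in> J" "b \<in> J"
  shows iid_second_moment: "integrable (PiM J (\<lambda>_. N)) (\<lambda>w. w a * w b)"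
      "(\<integral>w. w a * w b \<partial>PiM J (\<lambda>_. N)) = v * of_bool (a = b)"
    and iid_first_moment: "integrable (PiM J (\<lambda>_. N)) (\<lambda>w. w a)" "(\<integral>w. w a \<partial>PiM J (\<lambda>_. N)) = 0"
proof -
  interpret N: real_distribution N by fact
  interpret prod: product_sigma_finite "\<lambda>_. N" ..
  have ident: "integrable N (\<lambda>z. z)"
    using N.square_integrable_imp_integrable[of "\<lambda>z. z"] int by simp
  have power: "integrable N (\<lambda>z. z ^ k)" if "k \<le> 2" for k
  proof -
    have "k = 0 \<or> k = 1 \<or> k = 2" using that by auto
    then show ?thesis using ident int by auto
  qed
  have prod: "integrable (PiM J (\<lambda>_. N)) (\<lambda>w. \<Prod>i\<in>J. w i ^ c i)"
    "(\<integral>w. (\<Prod>i\<in>J. w i ^ c i) \<partial>PiM J (\<lambda>_. N)) = (\<Prod>i\<in>J. \<integral>z. z ^ c i \<partial>N)"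
    if "\<And>i. c i \<le> 2" for c :: "'a \<Rightarrow> nat"
    using prod.product_integrable_prod[OF J(1), of "\<lambda>i z. z ^ c i"]
      prod.product_integral_prod[OF J(1), of "\<lambda>i z. z ^ c i"] power that by auto
  define c where "c i = (of_bool (i = a) + of_bool (i = b) :: nat)" for i
  have eq: "(\<lambda>w :: 'a \<Rightarrow> real. \<Prod>i\<in>J. w i ^ c i) = (\<lambda>w. w a * w b)"
    using J by (simp add: c_def power_add prod.distrib prod_of_bool)
  have c: "c i \<le> 2" for i by (simp add: c_def)
  show "integrable (PiM J (\<lambda>_. N)) (\<lambda>w. w a * w b)"
    using prod(1)[of c, OF c] unfolding eq .
  have *: "(\<integral>w. w a * w b \<partial>PiM J (\<lambda>_. N)) = (\<Prod>i\<in>J. \<integral>z. z ^ c i \<partial>N)"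
    using prod(2)[of c, OF c] unfolding eq .
  show "(\<integral>w. w a * w b \<partial>PiM J (\<lambda>_. N)) = v * of_bool (a = b)"
  proof (cases "a = b")
    case True
    then have "(\<Prod>i\<in>J. \<integral>z. z ^ c i \<partial>N) = (\<Prod>i\<in>J. if i = a then v else 1)"
      using var N.prob_space by (intro prod.cong) (auto simp: c_def power2_eq_square)
    with * True J show ?thesis by simp
  next
    case False
    then have "(\<integral>z. z ^ c a \<partial>N) = 0" using mean by (simp add: c_def)
    then have "(\<Prod>i\<in>J. \<integral>z. z ^ c i \<partial>N) = 0"
      using J(2) by (intro prod_zero J(1)) blast
    with * False show ?thesis by simp
  qed
  define e where "e i = (of_bool (i = a) :: nat)" for i
  have eq: "(\<lambda>w :: 'a \<Rightarrow> real. \<Prod>i\<in>J. w i ^ e i) = (\<lambda>w. w a)"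
    using J by (simp add: e_def prod_of_bool)
  have e: "e i \<le> 2" for i by (simp add: e_def)
  show "integrable (PiM J (\<lambda>_. N)) (\<lambda>w. w a)"
    using prod(1)[of e, OF e] unfolding eq .
  have "(\<integral>z. z ^ e a \<partial>N) = 0" using mean by (simp add: e_def)
  then have "(\<Prod>i\<in>J. \<integral>z. z ^ e i \<partial>N) = 0"
    using J(2) by (intro prod_zero J(1)) blast
  then show "(\<integral>w. w a \<partial>PiM J (\<lambda>_. N)) = 0"
    using prod(2)[of e, OF e] unfolding eq by simp
qed

locale entry_moments = real_distribution \<mu> for \<mu> :: "real measure" +
  fixes m4 :: real
  assumes int4: "integrable \<mu> (\<lambda>z. z ^ 4)"
    and mean: "(\<integral>z. z \<partial>\<mu>) = 0" and var: "(\<integral>z. z\<^sup>2 \<partial>\<mu>) = 1"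
    and m4: "m4 = (\<integral>z. z ^ 4 \<partial>\<mu>)"
begin

lemma integrable_power: "k \<le> 4 \<Longrightarrow> integrable \<mu> (\<lambda>z. z ^ k)"
proof (rule Bochner_Integration.integrable_bound[of _ "\<lambda>z. 1 + z ^ 4"])
  assume k: "k \<le> 4"
  have "\<bar>z\<bar> ^ k \<le> 1 + \<bar>z\<bar> ^ 4" for z :: real
  proof (cases "\<bar>z\<bar> \<le> 1")
    case True
    then show ?thesis using power_le_one[of "\<bar>z\<bar>" k] by (intro order.trans[OF _ le_add_same_cancel1[THEN iffD2]]) auto
  next
    case False
    then show ?thesis using power_increasing[of k 4 "\<bar>z\<bar>"] k by simp
  qed
  then show "AE z in \<mu>. norm (z ^ k) \<le> norm (1 + z ^ 4)"
    by (simp add: power_abs)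
qed (use int4 in simp_all)

lemma m4_nonneg: "0 \<le> m4"
  unfolding m4 by simp

sublocale prod: product_sigma_finite "\<lambda>_. \<mu>"
  by standard

lemma prob_PiM: "prob_space (PiM J (\<lambda>_. \<mu>))"
  by (intro prob_space_PiM) (rule prob_space_axioms)

lemma prod_moment:
  assumes J: "finite J" and c: "\<And>i. i \<in> J \<Longrightarrow> c i \<le> 4"
  shows "integrable (PiM J (\<lambda>_. \<mu>)) (\<lambda>w. \<Prod>i\<in>J. w i ^ c i)"
    and "(\<integral>w. (\<Prod>i\<in>J. w i ^ c i) \<partial>PiM J (\<lambda>_. \<mu>)) = (\<Prod>i\<in>J. \<integral>z. z ^ c i \<partial>\<mu>)"
  using prod.product_integrable_prod[OF J, of "\<lambda>i z. z ^ c i"]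
    prod.product_integral_prod[OF J, of "\<lambda>i z. z ^ c i"] integrable_power c by auto

lemma moment2:
  assumes J: "finite J" "a \<in> J" "b \<in> J"
  shows "integrable (PiM J (\<lambda>_. \<mu>)) (\<lambda>w. w a * w b)"
    and "(\<integral>w. w a * w b \<partial>PiM J (\<lambda>_. \<mu>)) = of_bool (a = b)"
  using iid_second_moment[OF real_distribution_axioms integrable_power[of 2] mean var J] by simp_all

text \<open>The pairing formula of Isserlis, corrected by \<open>m4 - 3\<close>: if all four indices
  agree, the three pairings count \<open>3\<close> where \<open>m4\<close> is due.\<close>

lemma moment4:
  assumes J: "finite J" "a \<in> J" "b \<in> J" "e \<in> J" "f \<in> J"
  shows "integrable (PiM J (\<lambda>_. \<mu>)) (\<lambda>w. w a * w b * (w e * w f))"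
    and "(\<integral>w. w a * w b * (w e * w f) \<partial>PiM J (\<lambda>_. \<mu>)) =
      of_bool (a = b \<and> e = f) + of_bool (a = e \<and> b = f) + of_bool (a = f \<and> b = e)
        + (m4 - 3) * of_bool (a = b \<and> b = e \<and> e = f)"
proof -
  define c where "c i = (of_bool (i = a) + of_bool (i = b) + (of_bool (i = e) + of_bool (i = f)) :: nat)" for i
  have eq: "(\<lambda>w :: 'a \<Rightarrow> real. \<Prod>i\<in>J. w i ^ c i) = (\<lambda>w. w a * w b * (w e * w f))"
    using J by (simp add: c_def power_add prod.distrib prod_of_bool)
  have c: "c i \<le> 4" for i by (simp add: c_def)
  show "integrable (PiM J (\<lambda>_. \<mu>)) (\<lambda>w. w a * w b * (w e * w f))"
    using prod_moment(1)[OF J(1), of c] c eq by simp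
  have *: "(\<integral>w. w a * w b * (w e * w f) \<partial>PiM J (\<lambda>_. \<mu>)) = (\<Prod>i\<in>J. \<integral>z. z ^ c i \<partial>\<mu>)"
    using prod_moment(2)[OF J(1), of c] c unfolding eq by simp
  \<comment> \<open>An index that occurs exactly once makes the integral vanish, by the zero mean.
    Otherwise the indices are all equal or form two distinct pairs.\<close>
  consider (all) "a = b" "b = e" "e = f" | (single) g where "g \<in> J" "c g = 1"
    | (pairs) "\<And>i. c i = 0 \<or> c i = 2" "a = b \<and> e = f \<or> a = e \<and> b = f \<or> a = f \<and> b = e"
      "\<not> (a = b \<and> b = e \<and> e = f)"
  proof -
    let ?p = "a = b \<and> e = f \<and> a \<noteq> e \<or> a = e \<and> b = f \<and> a \<noteq> b \<or> a = f \<and> b = e \<and> a \<noteq> b"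
    have *: "(a = b \<and> b = e \<and> e = f) \<or> (\<exists>g\<in>{a, b, e, f}. c g = 1) \<or> ?p"
      unfolding c_def
      by (cases "a = b"; cases "a = e"; cases "a = f"; cases "b = e"; cases "b = f"; cases "e = f") auto
    have **: "c i = 0 \<or> c i = 2" if ?p for i
      using that unfolding c_def by auto
    show thesis
    proof (cases "a = b \<and> b = e \<and> e = f")
      case False
      show thesis
      proof (cases "\<exists>g\<in>{a, b, e, f}. c g = 1")
        case True
        then obtain g where "g \<in> {a, b, e, f}" "c g = 1" by blast
        with J show thesis by (intro single[of g]) auto
      next
        case nsingle: False
        with * False have ?p by argo
        then show thesis by (intro pairs[OF ** _ False]) argo+
      qed
    qed (use all in blast)
  qed
  then show "(\<integral>w. w a * w b * (w e * w f) \<partial>PiM J (\<lambda>_. \<mu>)) =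
      of_bool (a = b \<and> e = f) + of_bool (a = e \<and> b = f) + of_bool (a = f \<and> b = e)
        + (m4 - 3) * of_bool (a = b \<and> b = e \<and> e = f)"
  proof cases
    case all
    have "(\<Prod>i\<in>J. \<integral>z. z ^ c i \<partial>\<mu>) = (\<Prod>i\<in>J. if i = a then m4 else 1)"
      using all prob_space by (intro prod.cong) (auto simp: c_def m4 power4_eq_xxxx mult.assoc)
    with * J show ?thesis using all by simp
  next
    case single
    then have "(\<integral>z. z ^ c g \<partial>\<mu>) = 0" using mean by simp
    then have "(\<Prod>i\<in>J. \<integral>z. z ^ c i \<partial>\<mu>) = 0"
      using single(1) by (intro prod_zero J(1)) blast
    moreover have ne: "\<not> (a = b \<and> e = f)" "\<not> (a = e \<and> b = f)" "\<not> (a = f \<and> b = e)"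
      using single(2) by (auto simp: c_def of_bool_def split: if_splits)
    moreover have "\<not> (a = b \<and> b = e \<and> e = f)" using ne(1) by blast
    ultimately show ?thesis using * by (simp only: of_bool_def if_False)
  next
    case pairs
    have "(\<Prod>i\<in>J. \<integral>z. z ^ c i \<partial>\<mu>) = 1"
    proof (intro prod.neutral ballI)
      fix i show "(\<integral>z. z ^ c i \<partial>\<mu>) = 1"
        using pairs(1)[of i] var prob_space by (elim disjE) simp_all
    qed
    moreover have "of_bool (a = b \<and> e = f) + of_bool (a = e \<and> b = f) + of_bool (a = f \<and> b = e)
        + (m4 - 3) * of_bool (a = b \<and> b = e \<and> e = f) = 1"
      using pairs(2,3) by (elim disjE conjE) auto
    ultimately show ?thesis using * by (simp only:)
  qed
qed

text \<open>The centred products \<open>y p\<close> are orthogonal up to the swap of an index pair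
  and a correction on the diagonal. The constant is \<open>1 + 1 + m4\<close>: the diagonal match,
  the swapped match bounded by Cauchy-Schwarz, and \<open>m4 - 3\<close> enlarged to
  \<open>m4\<close>. The injection \<open>g\<close> selects one row of the data.\<close>

lemma quadratic_form_variance:
  assumes J: "finite J" and g: "inj_on g {..<d}" "g ` {..<d} \<subseteq> J" and B: "dims d d B"
  shows "(\<integral>\<^sup>+w. ennreal ((inner (colv d (\<lambda>j. w (g j))) (B * colv d (\<lambda>j. w (g j))) - inner (idm d) B)\<^sup>2)
      \<partial>PiM J (\<lambda>_. \<mu>)) \<le> ennreal ((m4 + 2) * (norm B)\<^sup>2)"
proof -
  let ?M = "PiM J (\<lambda>_. \<mu>)"
  interpret M: prob_space ?M by (rule prob_PiM)
  define I where "I = {..<d} \<times> {..<d}"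
  define b where "b p = ent B (fst p) (snd p)" for p
  define y where "y p w = w (g (fst p)) * w (g (snd p)) - of_bool (fst p = snd p)" for p and w :: "'a \<Rightarrow> real"
  have fin: "finite I" by (simp add: I_def)
  have gJ: "g i \<in> J" if "i < d" for i using g that by auto
  have geq: "g i = g j \<longleftrightarrow> i = j" if "i < d" "j < d" for i j
    using g that by (auto simp: inj_on_def)
  have Q: "inner (colv d (\<lambda>j. w (g j))) (B * colv d (\<lambda>j. w (g j))) - inner (idm d) B = (\<Sum>p\<in>I. b p * y p w)" for w
  proof -
    have "(\<Sum>p\<in>I. b p * of_bool (fst p = snd p)) = (\<Sum>i<d. \<Sum>j<d. ent B i j * of_bool (i = j))"
      by (simp only: I_def b_def sum.cartesian_product case_prod_unfold)
    also have "\<dots> = inner (idm d) B" by (simp add: inner_idm[OF B])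
    finally have *: "(\<Sum>p\<in>I. b p * of_bool (fst p = snd p)) = inner (idm d) B" .
    have "inner (colv d (\<lambda>j. w (g j))) (B * colv d (\<lambda>j. w (g j))) = (\<Sum>p\<in>I. b p * (w (g (fst p)) * w (g (snd p))))"
      by (simp add: inner_colv[OF B] b_def I_def sum.cartesian_product case_prod_unfold)
    then show ?thesis
      by (simp only: y_def right_diff_distrib sum_subtractf *)
  qed
  have yy: "integrable ?M (\<lambda>w. y p w * y p' w)"
    "(\<integral>w. y p w * y p' w \<partial>?M) = of_bool (p = p') + of_bool (prod.swap p = p')
      + (m4 - 3) * of_bool (fst p = snd p \<and> p = p')" if "p \<in> I" "p' \<in> I" for p p'
  proof -
    obtain j k l m where p: "p = (j, k)" "p' = (l, m)" by fastforce
    have lt: "j < d" "k < d" "l < d" "m < d" using that p by (auto simp: I_def)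
    note m = moment4[OF J gJ[OF lt(1)] gJ[OF lt(2)] gJ[OF lt(3)] gJ[OF lt(4)]]
      moment2[OF J gJ[OF lt(1)] gJ[OF lt(2)]] moment2[OF J gJ[OF lt(3)] gJ[OF lt(4)]]
    have eq: "(\<lambda>w. y p w * y p' w) = (\<lambda>w. w (g j) * w (g k) * (w (g l) * w (g m))
       - of_bool (l = m) * (w (g j) * w (g k)) - of_bool (j = k) * (w (g l) * w (g m)) + of_bool (j = k) * of_bool (l = m))"
      by (simp add: y_def p fun_eq_iff algebra_simps)
    show "integrable ?M (\<lambda>w. y p w * y p' w)"
      unfolding eq using m by (intro Bochner_Integration.integrable_add Bochner_Integration.integrable_diff integrable_mult_right) auto
    show "(\<integral>w. y p w * y p' w \<partial>?M) = of_bool (p = p') + of_bool (prod.swap p = p')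
      + (m4 - 3) * of_bool (fst p = snd p \<and> p = p')"
    proof -
      have "(\<integral>w. y p w * y p' w \<partial>?M) = (\<integral>w. w (g j) * w (g k) * (w (g l) * w (g m)) \<partial>?M)
         - of_bool (l = m) * (\<integral>w. w (g j) * w (g k) \<partial>?M)
         - of_bool (j = k) * (\<integral>w. w (g l) * w (g m) \<partial>?M) + of_bool (j = k) * of_bool (l = m)"
        unfolding eq using m(1,3,5) by (simp add: M.prob_space del: of_bool_eq_iff)
      also have "\<dots> = of_bool (j = l \<and> k = m) + of_bool (k = l \<and> j = m) + (m4 - 3) * of_bool (j = k \<and> j = l \<and> k = m)"
        unfolding m(2,4,6) geq[OF lt(1,2)] geq[OF lt(3,4)] geq[OF lt(1,3)] geq[OF lt(2,4)]
          geq[OF lt(1,4)] geq[OF lt(2,3)]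
        by (cases "j = k"; cases "l = m"; cases "j = l"; cases "k = l") simp_all
      finally show ?thesis by (simp add: p)
    qed
  qed
  have sq: "(\<Sum>p\<in>I. b p * y p w)\<^sup>2 = (\<Sum>p\<in>I. \<Sum>p'\<in>I. b p * b p' * (y p w * y p' w))" for w
    by (simp add: power2_eq_square sum_product ac_simps)
  have int: "integrable ?M (\<lambda>w. (\<Sum>p\<in>I. b p * y p w)\<^sup>2)"
    unfolding sq by (intro Bochner_Integration.integrable_sum integrable_mult_right yy)
  have normB: "(norm B)\<^sup>2 = (\<Sum>p\<in>I. (b p)\<^sup>2)"
    unfolding power2_norm_eq_inner inner_fmat_eq[OF B]
    by (simp add: b_def I_def sum.cartesian_product case_prod_unfold power2_eq_square)
  have "(\<integral>w. (\<Sum>p\<in>I. b p * y p w)\<^sup>2 \<partial>?M) = (\<Sum>p\<in>I. \<Sum>p'\<in>I. b p * b p' * (\<integral>w. y p w * y p' w \<partial>?M))"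
    unfolding sq by (simp add: yy)
  also have "\<dots> = (\<Sum>p\<in>I. \<Sum>p'\<in>I. b p * b p' * (of_bool (p = p') + of_bool (prod.swap p = p')
      + (m4 - 3) * of_bool (fst p = snd p \<and> p = p')))"
    by (intro sum.cong refl) (simp add: yy)
  also have "\<dots> \<le> (\<Sum>p\<in>I. (b p)\<^sup>2 + b p * b (prod.swap p) + m4 * (b p)\<^sup>2)"
  proof (rule sum_mono)
    fix p assume p: "p \<in> I"
    then have sw: "prod.swap p \<in> I" by (auto simp: I_def)
    have "(\<Sum>p'\<in>I. b p * b p' * (of_bool (p = p') + of_bool (prod.swap p = p')
      + (m4 - 3) * of_bool (fst p = snd p \<and> p = p'))) =
      (\<Sum>p'\<in>I. (if p = p' then b p * b p * (1 + (m4 - 3) * of_bool (fst p = snd p)) else 0)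
         + (if prod.swap p = p' then b p * b p' else 0))"
      by (intro sum.cong refl) (simp add: distrib_left)
    also have "\<dots> = b p * b p * (1 + (m4 - 3) * of_bool (fst p = snd p)) + b p * b (prod.swap p)"
      using p sw fin by (simp add: sum.distrib)
    also have "\<dots> \<le> b p * b p * (1 + m4) + b p * b (prod.swap p)"
      using m4_nonneg by (intro add_right_mono mult_left_mono) auto
    finally show "(\<Sum>p'\<in>I. b p * b p' * (of_bool (p = p') + of_bool (prod.swap p = p')
      + (m4 - 3) * of_bool (fst p = snd p \<and> p = p'))) \<le> (b p)\<^sup>2 + b p * b (prod.swap p) + m4 * (b p)\<^sup>2"
      by (simp add: power2_eq_square algebra_simps)
  qed
  also have "\<dots> = (norm B)\<^sup>2 + inner B (tp B) + m4 * (norm B)\<^sup>2"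
  proof -
    have "(\<Sum>p\<in>I. b p * b (prod.swap p)) = inner B (tp B)"
      by (simp add: inner_fmat_eq[OF B] b_def I_def sum.cartesian_product case_prod_unfold)
    then show ?thesis by (simp add: sum.distrib normB sum_distrib_left)
  qed
  also have "\<dots> \<le> (m4 + 2) * (norm B)\<^sup>2"
    using norm_cauchy_schwarz[of B "tp B"] by (simp add: power2_eq_square algebra_simps)
  finally have le: "(\<integral>w. (\<Sum>p\<in>I. b p * y p w)\<^sup>2 \<partial>?M) \<le> (m4 + 2) * (norm B)\<^sup>2" .
  show ?thesis
    unfolding Q using int le by (subst nn_integral_eq_integral) (auto intro: ennreal_leI)
qed

end

section \<open>Random resolvents\<close>

lift_definition ofm :: "real mat \<Rightarrow> fmat" is
  "\<lambda>A i j. if i < dim_row A \<and> j < dim_col A then A $$ (i, j) else 0"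
  subgoal for A by (rule exI[of _ "max (dim_row A) (dim_col A)"]) auto
  done

lemma dims_ofm: "A \<in> carrier_mat m n \<Longrightarrow> dims m n (ofm A)"
  by (auto simp: dims_def ofm.rep_eq)

lemma ofm_add: "A \<in> carrier_mat m n \<Longrightarrow> B \<in> carrier_mat m n \<Longrightarrow> ofm (A + B) = ofm A + ofm B"
  by (auto intro!: fmat_eqI simp: ofm.rep_eq)

lemma ofm_smult: "ofm (a \<cdot>\<^sub>m A) = a *\<^sub>R ofm A"
  by (auto intro!: fmat_eqI simp: ofm.rep_eq)

lemma ofm_transpose: "ofm (A\<^sup>T) = tp (ofm A)"
  by (auto intro!: fmat_eqI simp: ofm.rep_eq)

lemma ofm_one: "ofm (1\<^sub>m n) = idm n"
  by (auto intro!: fmat_eqI simp: ofm.rep_eq ent_idm)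

lemma ofm_mult:
  assumes "A \<in> carrier_mat m k" "B \<in> carrier_mat k n"
  shows "ofm (A * B) = ofm A * ofm B"
proof (rule fmat_eqI)
  fix i j
  have "ent (ofm A * ofm B) i j = (\<Sum>l<k. ent (ofm A) i l * ent (ofm B) l j)"
    by (rule ent_times[OF dims_ofm[OF assms(1)]])
  then show "ent (ofm (A * B)) i j = ent (ofm A * ofm B) i j"
    using assms by (auto simp: ofm.rep_eq scalar_prod_def atLeast0LessThan intro!: sum.cong)
qed

definition ofv :: "real Matrix.vec \<Rightarrow> fmat" where
  "ofv v = colv (dim_vec v) (\<lambda>i. v $ i)"

lemma dims_ofv: "v \<in> carrier_vec d \<Longrightarrow> dims d 1 (ofv v)"
  by (metis carrier_vecD dims_colv ofv_def)

lemma ofv_mult: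
  assumes "A \<in> carrier_mat m k" "v \<in> carrier_vec k"
  shows "ofv (A *\<^sub>v v) = ofm A * ofv v"
proof (rule fmat_eqI)
  fix i j
  have "ent (ofm A * ofv v) i j = (\<Sum>l<k. ent (ofm A) i l * ent (ofv v) l j)"
    by (rule ent_times[OF dims_ofm[OF assms(1)]])
  then show "ent (ofv (A *\<^sub>v v)) i j = ent (ofm A * ofv v) i j"
    using assms
    by (auto simp: ofm.rep_eq ofv_def colv.rep_eq scalar_prod_def atLeast0LessThan intro!: sum.cong)
qed

lemma ofv_add: "v \<in> carrier_vec k \<Longrightarrow> w \<in> carrier_vec k \<Longrightarrow> ofv (v + w) = ofv v + ofv w"
  by (auto intro!: fmat_eqI simp: ofv_def colv.rep_eq)

lemma ofv_smult: "ofv (a \<cdot>\<^sub>v v) = a *\<^sub>R ofv v"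
  by (auto intro!: fmat_eqI simp: ofv_def colv.rep_eq)

lemma scalar_prod_ofv:
  assumes "v \<in> carrier_vec k" "w \<in> carrier_vec k"
  shows "scalar_prod v w = inner (ofv v) (ofv w)"
  using assms unfolding inner_fmat_eq[OF dims_ofv[OF assms(1)]]
  by (simp add: ofv_def colv.rep_eq scalar_prod_def atLeast0LessThan)

lemma ofv_eq_0_iff: "ofv v = 0 \<longleftrightarrow> v = 0\<^sub>v (dim_vec v)"
proof
  assume *: "ofv v = 0"
  have "v $ i = 0" if "i < dim_vec v" for i
    using arg_cong[OF *, of "\<lambda>A. ent A i 0"] that by (simp add: ofv_def colv.rep_eq)
  then show "v = 0\<^sub>v (dim_vec v)" by auto
next
  assume "v = 0\<^sub>v (dim_vec v)"
  then have "v $ i = 0" if "i < dim_vec v" for i using that by (metis index_zero_vec(1))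
  then show "ofv v = 0" by (auto intro!: fmat_eqI simp: ofv_def colv.rep_eq)
qed

text \<open>Identifies the inverse found by elimination with the adjugate formula, which makes its
  entries rational functions of the entries of \<open>A\<close>, hence accessible to
  measurability.\<close>

lemma inv_mat_adj:
  assumes A: "A \<in> carrier_mat n n" and det: "Determinant.det A \<noteq> 0"
  shows "inv_mat A = (1 / Determinant.det A) \<cdot>\<^sub>m adj_mat A"
    and "A * inv_mat A = 1\<^sub>m n" and "inv_mat A * A = 1\<^sub>m n" and "inv_mat A \<in> carrier_mat n n"
proof -
  let ?B = "(1 / Determinant.det A) \<cdot>\<^sub>m adj_mat A"
  note adj = adj_mat[OF A]
  have B: "?B \<in> carrier_mat n n" "?B * A = 1\<^sub>m n" "A * ?B = 1\<^sub>m n"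
    using adj A det
    by (simp_all add: mult_smult_assoc_mat[OF adj(1) A] mult_smult_distrib[OF A adj(1)] smult_smult_assoc)
      (auto intro!: eq_matI)
  \<comment> \<open>Elimination can fail only on a matrix that is not a unit of the matrix ring; the
    adjugate exhibits \<open>A\<close> as a unit.\<close>
  then have "A \<in> Units (ring_mat TYPE(real) n ())"
    using A by (auto simp: Units_def ring_mat_def)
  then obtain C where C: "mat_inverse A = Some C"
    using mat_inverse(1)[OF A, of "()"] by fastforce
  then have AC: "A * C = 1\<^sub>m n" "C * A = 1\<^sub>m n" "C \<in> carrier_mat n n"
    using mat_inverse(2)[OF A] by auto
  have "C = ?B * A * C" using B(2) AC by simp
  also have "\<dots> = ?B * (A * C)" by (rule assoc_mult_mat[OF B(1) A AC(3)])
  also have "\<dots> = ?B" unfolding AC(1) by (rule right_mult_one_mat[OF B(1)])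
  finally show "inv_mat A = ?B" using C by (simp add: inv_mat_def)
  then show "A * inv_mat A = 1\<^sub>m n" "inv_mat A * A = 1\<^sub>m n" "inv_mat A \<in> carrier_mat n n"
    using B by simp_all
qed

section \<open>The resolvent of the random data\<close>

definition rmat :: "nat \<Rightarrow> nat \<Rightarrow> (nat \<times> nat \<Rightarrow> real) \<Rightarrow> fmat" where
  "rmat m n w = ofm (mat m n w)"

lemma dims_rmat [intro]: "dims m n (rmat m n w)"
  unfolding rmat_def by (intro dims_ofm) simp

lemma ent_rmat: "ent (rmat m n w) i j = (if i < m \<and> j < n then w (i, j) else 0)"
  by (simp add: rmat_def ofm.rep_eq)

definition gram :: "nat \<Rightarrow> nat \<Rightarrow> (nat \<times> nat \<Rightarrow> real) \<Rightarrow> fmat" where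
  "gram n d X = (1 / real n) *\<^sub>R (tp (rmat n d X) * rmat n d X)"

definition inner_mat :: "real \<Rightarrow> nat \<Rightarrow> nat \<Rightarrow> nat \<Rightarrow> (nat \<times> nat \<Rightarrow> real) \<Rightarrow> (nat \<times> nat \<Rightarrow> real) \<Rightarrow> real mat" where
  "inner_mat l n p d X W =
    (1 / real n) \<cdot>\<^sub>m (mat p d W * (mat n d X)\<^sup>T * mat n d X * (mat p d W)\<^sup>T) + l \<cdot>\<^sub>m 1\<^sub>m p"

definition rp_resolvent ::
  "real \<Rightarrow> nat \<Rightarrow> nat \<Rightarrow> nat \<Rightarrow> (nat \<times> nat \<Rightarrow> real) \<Rightarrow> (nat \<times> nat \<Rightarrow> real) \<Rightarrow> fmat" where
  "rp_resolvent l n p d X W =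
    tp (rmat p d W) * ofm (inv_mat (inner_mat l n p d X W)) * rmat p d W"

lemma inner_mat_carrier: "inner_mat l n p d X W \<in> carrier_mat p p"
  by (auto simp: inner_mat_def)

lemma dims_gram [intro]: "dims d d (gram n d X)"
  unfolding gram_def by blast

lemma psd_gram: "psd (gram n d X)"
  using psd_rank_one[of "tp (rmat n d X)"] by (auto simp: gram_def intro!: psd_scaleR)

lemma ofm_inner_mat:
  "ofm (inner_mat l n p d X W) = rmat p d W * gram n d X * tp (rmat p d W) + l *\<^sub>R idm p"
proof -
  let ?W = "mat p d W" and ?X = "mat n d X"
  have c: "?W \<in> carrier_mat p d" "?X \<in> carrier_mat n d" "?W\<^sup>T \<in> carrier_mat d p" "?X\<^sup>T \<in> carrier_mat d n"
    "?W * ?X\<^sup>T \<in> carrier_mat p n" "?W * ?X\<^sup>T * ?X \<in> carrier_mat p d"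
    "?W * ?X\<^sup>T * ?X * ?W\<^sup>T \<in> carrier_mat p p"
    by auto
  have "ofm (?W * ?X\<^sup>T * ?X * ?W\<^sup>T) = ofm ?W * tp (ofm ?X) * ofm ?X * tp (ofm ?W)"
    unfolding ofm_mult[OF c(6,3)] ofm_mult[OF c(5,2)] ofm_mult[OF c(1,4)] ofm_transpose ..
  then have "ofm (inner_mat l n p d X W) =
     (1 / real n) *\<^sub>R (rmat p d W * tp (rmat n d X) * rmat n d X * tp (rmat p d W)) + l *\<^sub>R idm p"
    unfolding inner_mat_def rmat_def
    by (subst ofm_add[of _ p p]) (use c(7) in \<open>simp_all add: ofm_smult ofm_one\<close>)
  then show ?thesis by (simp add: gram_def mult.assoc)
qed

text \<open>A kernel vector \<open>v\<close> would give \<open>0 = (v, A v) >= l (v, v)\<close>.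
  This holds at every point of the sample space, not only where \<open>W W\<^sup>T = I\<close>, so
  the resolvent is measurable without exceptional sets.\<close>

lemma det_inner_mat:
  assumes "0 < l"
  shows "Determinant.det (inner_mat l n p d X W) \<noteq> 0"
proof
  let ?A = "inner_mat l n p d X W"
  assume "Determinant.det ?A = 0"
  then obtain v where v: "v \<in> carrier_vec p" "v \<noteq> 0\<^sub>v p" "?A *\<^sub>v v = 0\<^sub>v p"
    using det_0_iff_vec_prod_zero_field[OF inner_mat_carrier] by blast
  have "ofm ?A * ofv v = 0"
    using ofv_mult[OF inner_mat_carrier v(1), of l n d X W] v(3) ofv_eq_0_iff[of "0\<^sub>v p"] by simp
  then have "0 = inner (ofv v) (ofm ?A * ofv v)" by simp
  also have "\<dots> = inner (tp (rmat p d W) * ofv v) (gram n d X * (tp (rmat p d W) * ofv v))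
      + l * inner (ofv v) (ofv v)"
    using idm_times[OF dims_ofv[OF v(1)]]
    by (simp add: ofm_inner_mat distrib_right inner_add_right inner_times_left mult.assoc)
  also have "\<dots> \<ge> l * inner (ofv v) (ofv v)"
    using psd_gram by (simp add: psd_def)
  finally have "inner (ofv v) (ofv v) = 0"
    using assms inner_ge_zero[of "ofv v"] by (simp add: mult_le_0_iff)
  then have "ofv v = 0" by simp
  then show False using v ofv_eq_0_iff by auto
qed

lemma dims_inv_inner_mat:
  "0 < l \<Longrightarrow> dims p p (ofm (inv_mat (inner_mat l n p d X W)))"
  by (intro dims_ofm inv_mat_adj(4) inner_mat_carrier det_inner_mat)

lemma dims_rp_resolvent: "0 < l \<Longrightarrow> dims d d (rp_resolvent l n p d X W)"
  unfolding rp_resolvent_def using dims_inv_inner_mat by blast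

lemma proj_gram_of_coisometry:
  assumes "rmat p d W * tp (rmat p d W) = idm p"
  shows "proj (tp (rmat p d W) * rmat p d W)"
    and "inner (tp (rmat p d W) * rmat p d W) (tp (rmat p d W) * rmat p d W) = real p"
proof -
  let ?W = "rmat p d W"
  have *: "?W * (tp ?W * X) = idm p * X" for X
    using assms by (simp flip: mult.assoc)
  show "proj (tp ?W * ?W)"
    by (simp add: proj_def mult.assoc * idm_times[OF dims_rmat])
  have "inner (tp ?W * ?W) (tp ?W * ?W) = inner ?W (?W * tp ?W * ?W)"
    by (simp add: inner_times_left mult.assoc)
  also have "\<dots> = inner (?W * tp ?W) (idm p)"
    unfolding inner_times_right[of ?W] by (simp add: assms idm_times[OF dims_rmat])
  finally show "inner (tp ?W * ?W) (tp ?W * ?W) = real p"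
    by (simp add: assms inner_idm_idm)
qed

lemma resolv_rp_resolvent:
  assumes l: "0 < l" and W: "rmat p d W * tp (rmat p d W) = idm p"
  shows "resolv (tp (rmat p d W) * rmat p d W) l (gram n d X) (rp_resolvent l n p d X W)"
proof -
  let ?W = "rmat p d W" and ?A = "inner_mat l n p d X W" and ?S = "gram n d X"
  define G where "G = ofm (inv_mat ?A)"
  note inv = inv_mat_adj[OF inner_mat_carrier det_inner_mat[OF l]]
  have dG: "dims p p G" unfolding G_def by (rule dims_inv_inner_mat[OF l])
  have AG: "ofm ?A * G = idm p"
    unfolding G_def ofm_mult[OF inner_mat_carrier inv(4), symmetric] inv(2) ofm_one ..
  have tA: "tp (ofm ?A) = ofm ?A"
    using psd_gram[of n d X] by (simp add: ofm_inner_mat psd_def mult.assoc)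
  have dG': "dims p p (tp G)" using dG by blast
  have tGA: "tp G * ofm ?A = idm p"
    using arg_cong[OF AG, of tp] by (simp add: tA)
  \<comment> \<open>\<open>tp G\<close> is a left inverse and \<open>G\<close> a right inverse of
    the same symmetric matrix, so they coincide.\<close>
  have "tp G = tp G * (ofm ?A * G)" using AG times_idm[OF dG'] by simp
  also have "\<dots> = G" using tGA idm_times[OF dG] by (simp flip: mult.assoc)
  finally have tG: "tp G = G" .
  have R: "rp_resolvent l n p d X W = tp ?W * (G * ?W)"
    by (simp add: rp_resolvent_def G_def mult.assoc)
  have WW: "?W * (tp ?W * X) = idm p * X" for X
    using W by (simp flip: mult.assoc)
  have dGW: "dims p d (G * ?W)" using dG by blast
  show ?thesis
    unfolding resolv_def R
  proof (intro conjI)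
    show "tp (tp ?W * (G * ?W)) = tp ?W * (G * ?W)"
      by (simp add: tG mult.assoc)
    show "tp ?W * ?W * (tp ?W * (G * ?W)) = tp ?W * (G * ?W)"
      by (simp add: mult.assoc WW idm_times[OF dGW])
    have "tp ?W * (ofm ?A * G) * ?W = tp ?W * ?W"
      by (simp add: AG mult.assoc idm_times[OF dims_rmat])
    then show "tp ?W * ?W * ?S * (tp ?W * (G * ?W)) + l *\<^sub>R (tp ?W * (G * ?W)) = tp ?W * ?W"
      by (simp add: ofm_inner_mat algebra_simps mult.assoc idm_times[OF dGW])
  qed
qed

subsection \<open>Measurability\<close>

text \<open>Entrywise, so that no sigma-algebra on \<open>fmat\<close> is required; scalar
  statistics are finite sums of entries.\<close>

definition mmeas :: "'a measure \<Rightarrow> ('a \<Rightarrow> fmat) \<Rightarrow> bool" where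
  "mmeas M A \<longleftrightarrow> (\<forall>i j. (\<lambda>w. ent (A w) i j) \<in> borel_measurable M)"

lemma mmeas_const: "mmeas M (\<lambda>_. C)"
  and mmeas_add: "mmeas M A \<Longrightarrow> mmeas M B \<Longrightarrow> mmeas M (\<lambda>w. A w + B w)"
  and mmeas_diff: "mmeas M A \<Longrightarrow> mmeas M B \<Longrightarrow> mmeas M (\<lambda>w. A w - B w)"
  and mmeas_scaleR: "mmeas M A \<Longrightarrow> mmeas M (\<lambda>w. a *\<^sub>R A w)"
  and mmeas_tp: "mmeas M A \<Longrightarrow> mmeas M (\<lambda>w. tp (A w))"
  by (auto simp: mmeas_def intro!: borel_measurable_add borel_measurable_diff borel_measurable_times)

lemma mmeas_times:
  assumes "mmeas M A" "mmeas M B" "\<And>w. dims m n (A w)"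
  shows "mmeas M (\<lambda>w. A w * B w)"
  unfolding mmeas_def ent_times[OF assms(3)]
  using assms(1,2) by (auto simp: mmeas_def intro!: borel_measurable_sum borel_measurable_times)

lemma mmeas_inner:
  assumes "mmeas M A" "mmeas M B" "\<And>w. dims m n (A w)"
  shows "(\<lambda>w. inner (A w) (B w)) \<in> borel_measurable M"
  unfolding inner_fmat_eq[OF assms(3)]
  using assms(1,2) by (auto simp: mmeas_def intro!: borel_measurable_sum borel_measurable_times)

lemma mmeas_norm:
  assumes "mmeas M A" "\<And>w. dims m n (A w)"
  shows "(\<lambda>w. norm (A w)) \<in> borel_measurable M"
  unfolding norm_eq_sqrt_inner using mmeas_inner[OF assms(1) assms] by simp

lemma mmeas_rmat:
  assumes "\<And>i j. i < m \<Longrightarrow> j < n \<Longrightarrow> (\<lambda>w. X w (i, j)) \<in> borel_measurable M"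
  shows "mmeas M (\<lambda>w. rmat m n (X w))"
  unfolding mmeas_def ent_rmat
proof (intro allI)
  fix i j
  show "(\<lambda>w. if i < m \<and> j < n then X w (i, j) else 0) \<in> borel_measurable M"
    using assms by (cases "i < m \<and> j < n") auto
qed

lemma mmeas_gram:
  assumes "\<And>i j. i < n \<Longrightarrow> j < d \<Longrightarrow> (\<lambda>w. X w (i, j)) \<in> borel_measurable M"
  shows "mmeas M (\<lambda>w. gram n d (X w))"
  unfolding gram_def
  by (intro mmeas_scaleR mmeas_times[of _ _ _ d n] mmeas_tp mmeas_rmat assms) blast+

lemma measurable_det:
  assumes A: "\<And>w. A w \<in> carrier_mat n n"
    and meas: "\<And>i j. i < n \<Longrightarrow> j < n \<Longrightarrow> (\<lambda>w. A w $$ (i, j) :: real) \<in> borel_measurable M"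
  shows "(\<lambda>w. Determinant.det (A w)) \<in> borel_measurable M"
  unfolding det_def'[OF A]
  by (intro borel_measurable_sum borel_measurable_times borel_measurable_const borel_measurable_prod meas)
    (auto dest: permutes_in_image)

text \<open>An entry of the inverse is a quotient of determinants by the adjugate formula, and
  determinants are polynomials by the Leibniz formula.\<close>

lemma measurable_inv_mat:
  assumes A: "\<And>w. A w \<in> carrier_mat n n"
    and meas: "\<And>i j. i < n \<Longrightarrow> j < n \<Longrightarrow> (\<lambda>w. A w $$ (i, j) :: real) \<in> borel_measurable M"
    and det: "\<And>w. Determinant.det (A w) \<noteq> 0"
    and ij: "i < n" "j < n"
  shows "(\<lambda>w. inv_mat (A w) $$ (i, j)) \<in> borel_measurable M"
proof -
  have "inv_mat (A w) $$ (i, j) =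
      1 / Determinant.det (A w) * ((-1) ^ (j + i) * Determinant.det (mat_delete (A w) j i))" for w
    using ij A[of w] adj_mat(1)[OF A[of w]]
    by (simp add: inv_mat_adj(1)[OF A det] adj_mat_def cofactor_def)
  moreover have "(\<lambda>w. Determinant.det (mat_delete (A w) j i)) \<in> borel_measurable M"
  proof (rule measurable_det)
    show "mat_delete (A w) j i \<in> carrier_mat (n - 1) (n - 1)" for w
      using A[of w] by (simp add: mat_delete_def)
    fix k l assume kl: "k < n - 1" "l < n - 1"
    have "mat_delete (A w) j i $$ (k, l) =
        A w $$ (if k < j then k else Suc k, if l < i then l else Suc l)" for w
      using A[of w] kl by (simp add: mat_delete_def)
    then show "(\<lambda>w. mat_delete (A w) j i $$ (k, l)) \<in> borel_measurable M"
      using kl by (simp add: meas)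
  qed
  moreover have "(\<lambda>w. Determinant.det (A w)) \<in> borel_measurable M"
    by (rule measurable_det[OF A meas])
  ultimately show ?thesis by simp
qed

lemma mmeas_ofm_inv:
  assumes A: "\<And>w. A w \<in> carrier_mat n n" and meas: "mmeas M (\<lambda>w. ofm (A w))"
    and det: "\<And>w. Determinant.det (A w) \<noteq> 0"
  shows "mmeas M (\<lambda>w. ofm (inv_mat (A w)))"
  unfolding mmeas_def
proof (intro allI)
  fix i j
  have "(\<lambda>w. A w $$ (i, j)) \<in> borel_measurable M" if "i < n" "j < n" for i j
  proof -
    have "ent (ofm (A w)) i j = A w $$ (i, j)" for w
      using A[of w] that by (simp add: ofm.rep_eq)
    then show ?thesis using meas[unfolded mmeas_def, rule_format, of i j] by simp
  qed
  from measurable_inv_mat[OF A this det]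
  have *: "(\<lambda>w. inv_mat (A w) $$ (i, j)) \<in> borel_measurable M" if "i < n" "j < n"
    using that by blast
  show "(\<lambda>w. ent (ofm (inv_mat (A w))) i j) \<in> borel_measurable M"
  proof (cases "i < n \<and> j < n")
    case True
    then have "ent (ofm (inv_mat (A w))) i j = inv_mat (A w) $$ (i, j)" for w
      using inv_mat_adj(4)[OF A det, of w] by (simp add: ofm.rep_eq)
    with * True show ?thesis by simp
  next
    case False
    have "ent (ofm (inv_mat (A w))) i j = 0" for w
      using ent_eq_0[OF dims_ofm[OF inv_mat_adj(4)[OF A det, of w]] False] .
    then show ?thesis by simp
  qed
qed

lemma mmeas_rp_resolvent:
  assumes l: "0 < l"
    and X: "\<And>i j. i < n \<Longrightarrow> j < d \<Longrightarrow> (\<lambda>w. X w (i, j)) \<in> borel_measurable M"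
    and W: "\<And>i j. i < p \<Longrightarrow> j < d \<Longrightarrow> (\<lambda>w. W w (i, j)) \<in> borel_measurable M"
  shows "mmeas M (\<lambda>w. rp_resolvent l n p d (X w) (W w))"
proof -
  have d: "dims d p (tp (rmat p d W))" "dims d p (tp (rmat p d W) * A)" if "dims p p A" for W A
    using that by blast+
  have "mmeas M (\<lambda>w. ofm (inner_mat l n p d (X w) (W w)))"
    unfolding ofm_inner_mat
    by (intro mmeas_add mmeas_const mmeas_times[of _ _ _ p d] mmeas_tp mmeas_rmat mmeas_gram X W) blast+
  then have "mmeas M (\<lambda>w. ofm (inv_mat (inner_mat l n p d (X w) (W w))))"
    by (intro mmeas_ofm_inv[of _ p] inner_mat_carrier det_inner_mat l)
  then show ?thesis
    unfolding rp_resolvent_def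
    by (intro mmeas_times[of _ _ _ d p] mmeas_tp mmeas_rmat W)
      (use dims_inv_inner_mat[OF l] in blast)+
qed

subsection \<open>Concentration for a fixed projection\<close>

lemma norm_proj_le:
  assumes "proj D"
  shows "norm (D * A) \<le> norm A"
proof (cases "norm (D * A) = 0")
  case False
  have "(norm (D * A))\<^sup>2 = inner A (D * A)"
    using assms inner_times_left[of D A "D * A"]
    by (simp add: power2_norm_eq_inner proj_def flip: mult.assoc)
  also have "\<dots> \<le> norm A * norm (D * A)" by (rule norm_cauchy_schwarz)
  finally show ?thesis using False by (simp add: power2_eq_square)
qed simp

section \<open>Removing a row of the data and concentration of its quadratic forms\<close>

definition obs :: "nat \<Rightarrow> (nat \<times> nat \<Rightarrow> real) \<Rightarrow> nat \<Rightarrow> fmat" where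
  "obs d X i = colv d (\<lambda>j. X (i, j))"

text \<open>The row is set to zero instead of deleted, so \<open>n\<close> and the factor
  \<open>1 / n\<close> in \<open>gram\<close> stay the same.\<close>

definition drop_obs :: "nat \<Rightarrow> (nat \<times> nat \<Rightarrow> real) \<Rightarrow> nat \<times> nat \<Rightarrow> real" where
  "drop_obs i X = (\<lambda>(k, j). if k = i then 0 else X (k, j))"

lemma dims_obs [intro]: "dims d 1 (obs d X i)"
  unfolding obs_def by blast

lemma ent_obs: "ent (obs d X i) j k = (if j < d \<and> k = 0 then X (i, j) else 0)"
  by (simp add: obs_def colv.rep_eq)

lemma ent_rank_one_obs:
  "ent (obs d X i * tp (obs d X i)) j k = (if j < d \<and> k < d then X (i, j) * X (i, k) else 0)"
  by (simp add: ent_times[OF dims_obs] ent_obs)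

lemma gram_eq: "gram n d X = (1 / real n) *\<^sub>R (\<Sum>i<n. obs d X i * tp (obs d X i))"
proof -
  have sum: "ent (\<Sum>i\<in>I. A i) j k = (\<Sum>i\<in>I. ent (A i) j k)" for I and A :: "nat \<Rightarrow> fmat" and j k
    by (induction I rule: infinite_finite_induct) auto
  have d: "dims d n (tp (rmat n d X))" by blast
  have "tp (rmat n d X) * rmat n d X = (\<Sum>i<n. obs d X i * tp (obs d X i))"
    by (rule fmat_eqI) (auto simp: sum ent_times[OF d] ent_rank_one_obs ent_rmat intro!: sum.cong)
  then show ?thesis by (simp add: gram_def)
qed

lemma gram_drop_obs:
  assumes "i < n"
  shows "gram n d (drop_obs i X) = gram n d X - (1 / real n) *\<^sub>R (obs d X i * tp (obs d X i))"
proof -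
  have "obs d (drop_obs i X) k = (if k = i then 0 else obs d X k)" for k
    by (rule fmat_eqI) (simp add: ent_obs drop_obs_def)
  then have "(\<Sum>k<n. obs d (drop_obs i X) k * tp (obs d (drop_obs i X) k))
      = (\<Sum>k<n. if k = i then 0 else obs d X k * tp (obs d X k))"
    by (intro sum.cong) auto
  also have "\<dots> = (\<Sum>k\<in>{..<n} - {i}. obs d X k * tp (obs d X k))"
    using assms by (subst sum.remove[of _ i]) auto
  also have "\<dots> = (\<Sum>k<n. obs d X k * tp (obs d X k)) - obs d X i * tp (obs d X i)"
    using assms by (subst sum_diff1) auto
  finally show ?thesis by (simp add: gram_eq scaleR_diff_right)
qed

lemma nn_integral_ennreal_le:
  assumes "\<And>w. f w \<le> h w" "integrable M h" "\<And>w. 0 \<le> h w" "(\<integral>w. h w \<partial>M) \<le> b"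
  shows "(\<integral>\<^sup>+w. ennreal (f w) \<partial>M) \<le> ennreal b"
proof -
  have "(\<integral>\<^sup>+w. ennreal (f w) \<partial>M) \<le> (\<integral>\<^sup>+w. ennreal (h w) \<partial>M)"
    using assms(1) by (intro nn_integral_mono ennreal_leI)
  also have "\<dots> = ennreal (\<integral>w. h w \<partial>M)"
    using assms by (intro nn_integral_eq_integral) auto
  finally show ?thesis using assms(4) by (meson ennreal_leI order.trans)
qed

text \<open>The variance of \<open>\<bar>f\<bar>\<close> is nonnegative. The hypothesis is a
  nonnegative integral, so integrability comes out as a conclusion.\<close>

lemma (in prob_space) abs_integral_le_sqrt:
  assumes f[measurable]: "f \<in> borel_measurable M" and le: "(\<integral>\<^sup>+w. ennreal ((f w)\<^sup>2) \<partial>M) \<le> ennreal b" and b: "0 \<le> b"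
  shows "integrable M f" and "(\<integral>w. \<bar>f w\<bar> \<partial>M) \<le> sqrt b"
proof -
  have sq: "integrable M (\<lambda>w. (f w)\<^sup>2)"
    using le by (intro integrableI_nonneg) (auto simp: top.not_eq_extremum[symmetric] top_unique)
  show int: "integrable M f"
    using square_integrable_imp_integrable[OF f sq] .
  have "0 \<le> (\<integral>w. (\<bar>f w\<bar> - (\<integral>w. \<bar>f w\<bar> \<partial>M))\<^sup>2 \<partial>M)" by simp
  also have "\<dots> = (\<integral>w. (f w)\<^sup>2 \<partial>M) - (\<integral>w. \<bar>f w\<bar> \<partial>M)\<^sup>2"
    using variance_eq[of "\<lambda>w. \<bar>f w\<bar>"] int sq by simp
  also have "(\<integral>w. (f w)\<^sup>2 \<partial>M) \<le> b"
    using le b sq by (subst (asm) nn_integral_eq_integral) auto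
  finally show "(\<integral>w. \<bar>f w\<bar> \<partial>M) \<le> sqrt b"
    by (intro real_le_rsqrt) simp
qed

context entry_moments
begin

lemma sets_iid [measurable_cong]: "sets (iid_mat n d \<mu>) = sets (\<Pi>\<^sub>M ij\<in>{..<n} \<times> {..<d}. borel)"
  unfolding iid_mat_def by (intro sets_PiM_cong) auto

lemma prob_iid: "prob_space (iid_mat n d \<mu>)"
  unfolding iid_mat_def by (rule prob_PiM)

lemma measurable_entry:
  "i < n \<Longrightarrow> j < d \<Longrightarrow> (\<lambda>X. X (i, j)) \<in> borel_measurable (iid_mat n d \<mu>)"
  unfolding measurable_cong_sets[OF sets_iid refl]
  by (intro measurable_component_singleton) simp

lemma measurable_drop_entry:
  "k < n \<Longrightarrow> j < d \<Longrightarrow> (\<lambda>X. drop_obs i X (k, j)) \<in> borel_measurable (iid_mat n d \<mu>)"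
  using measurable_entry by (simp add: drop_obs_def)

lemma mmeas_obs: "i < n \<Longrightarrow> mmeas (iid_mat n d \<mu>) (\<lambda>X. obs d X i)"
  unfolding mmeas_def ent_obs
proof (intro allI)
  fix j k assume i: "i < n"
  show "(\<lambda>X. if j < d \<and> k = 0 then X (i, j) else 0) \<in> borel_measurable (iid_mat n d \<mu>)"
    using measurable_entry[OF i] by (cases "j < d \<and> k = 0") auto
qed

lemma mmeas_quad:
  assumes "i < n" "mmeas (iid_mat n d \<mu>) B" "\<And>X. dims d d (B X)"
  shows "(\<lambda>X. inner (obs d X i) (B X * obs d X i)) \<in> borel_measurable (iid_mat n d \<mu>)"
  by (intro mmeas_inner[of _ _ _ d 1] mmeas_times[of _ _ _ d d] mmeas_obs assms) blast

text \<open>Row \<open>i\<close> is independent of the others. By Tonelli it is integrated first,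
  with \<open>B (drop_obs i X)\<close> frozen, and \<open>quadratic_form_variance\<close> applies to
  the inner integral.\<close>

lemma loo_variance:
  assumes i: "i < n" and B: "mmeas (iid_mat n d \<mu>) (\<lambda>X. B (drop_obs i X))" and dB: "\<And>X. dims d d (B X)"
  shows "(\<integral>\<^sup>+X. ennreal ((inner (obs d X i) (B (drop_obs i X) * obs d X i)
      - inner (idm d) (B (drop_obs i X)))\<^sup>2) \<partial>iid_mat n d \<mu>)
    \<le> (\<integral>\<^sup>+X. ennreal ((m4 + 2) * (norm (B (drop_obs i X)))\<^sup>2) \<partial>iid_mat n d \<mu>)"
proof -
  define J where "J = {i} \<times> {..<d}"
  define I where "I = ({..<n} \<times> {..<d}) - J"
  have IJ: "I \<inter> J = {}" "finite I" "finite J" "I \<union> J = {..<n} \<times> {..<d}"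
    using i by (auto simp: I_def J_def)
  have iid: "iid_mat n d \<mu> = PiM (I \<union> J) (\<lambda>_. \<mu>)"
    by (simp add: iid_mat_def IJ(4))
  interpret PJ: prob_space "PiM J (\<lambda>_. \<mu>)" by (rule prob_PiM)
  have obs: "obs d (merge I J (x, y)) i = colv d (\<lambda>j. y (i, j))" for x y
    by (rule fmat_eqI) (auto simp: ent_obs colv.rep_eq I_def J_def merge_def)
  have drop: "drop_obs i (merge I J (x, y)) = drop_obs i (merge I J (x, y'))" for x y y'
    by (auto simp: drop_obs_def I_def J_def merge_def fun_eq_iff)
  have m: "(\<lambda>X. ennreal ((inner (obs d X i) (B (drop_obs i X) * obs d X i)
      - inner (idm d) (B (drop_obs i X)))\<^sup>2)) \<in> borel_measurable (PiM (I \<union> J) (\<lambda>_. \<mu>))"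
    "(\<lambda>X. ennreal ((m4 + 2) * (norm (B (drop_obs i X)))\<^sup>2)) \<in> borel_measurable (PiM (I \<union> J) (\<lambda>_. \<mu>))"
    using mmeas_quad[OF i B dB] mmeas_inner[OF mmeas_const B dims_intros(7)] mmeas_norm[OF B dB]
    unfolding iid by measurable
  show ?thesis
    unfolding iid prod.product_nn_integral_fold[OF IJ(1,2,3) m(1)]
      prod.product_nn_integral_fold[OF IJ(1,2,3) m(2)]
  proof (rule nn_integral_mono)
    fix x
    \<comment> \<open>The filler \<open>0\<close> for row \<open>i\<close> is arbitrary:
      \<open>drop_obs i\<close> does not see it.\<close>
    define C where "C = B (drop_obs i (merge I J (x, \<lambda>_. 0)))"
    have C: "B (drop_obs i (merge I J (x, y))) = C" for y
      unfolding C_def by (rule arg_cong[OF drop])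
    have "(\<integral>\<^sup>+y. ennreal ((inner (colv d (\<lambda>j. y (i, j))) (C * colv d (\<lambda>j. y (i, j))) - inner (idm d) C)\<^sup>2)
         \<partial>PiM J (\<lambda>_. \<mu>)) \<le> ennreal ((m4 + 2) * (norm C)\<^sup>2)"
      by (rule quadratic_form_variance) (auto simp: J_def C_def inj_on_def intro: dB)
    then show "(\<integral>\<^sup>+y. ennreal ((inner (obs d (merge I J (x, y)) i)
           (B (drop_obs i (merge I J (x, y))) * obs d (merge I J (x, y)) i)
        - inner (idm d) (B (drop_obs i (merge I J (x, y)))))\<^sup>2) \<partial>PiM J (\<lambda>_. \<mu>))
      \<le> (\<integral>\<^sup>+y. ennreal ((m4 + 2) * (norm (B (drop_obs i (merge I J (x, y)))))\<^sup>2) \<partial>PiM J (\<lambda>_. \<mu>))"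
      unfolding obs C by (simp add: PJ.emeasure_space_1)
  qed
qed

text \<open>The form in which concentration is used. If the mean square norm of \<open>B\<close> is
  of order \<open>n\<close>, the deviation is of order \<open>sqrt n\<close>, and dividing by
  \<open>n\<close> makes it vanish.\<close>

lemma loo_deviation:
  assumes i: "i < n" and B: "mmeas (iid_mat n d \<mu>) (\<lambda>X. B (drop_obs i X))" and dB: "\<And>X. dims d d (B X)"
    and le: "(\<integral>\<^sup>+X. ennreal ((norm (B (drop_obs i X)))\<^sup>2) \<partial>iid_mat n d \<mu>) \<le> ennreal b" and b: "0 \<le> b"
  shows "integrable (iid_mat n d \<mu>) (\<lambda>X. \<bar>inner (obs d X i) (B (drop_obs i X) * obs d X i)
      - inner (idm d) (B (drop_obs i X))\<bar>)"
    and "(\<integral>X. \<bar>inner (obs d X i) (B (drop_obs i X) * obs d X i)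
      - inner (idm d) (B (drop_obs i X))\<bar> \<partial>iid_mat n d \<mu>) \<le> sqrt (m4 + 2) * sqrt b"
proof -
  let ?f = "\<lambda>X. inner (obs d X i) (B (drop_obs i X) * obs d X i) - inner (idm d) (B (drop_obs i X))"
  interpret M: prob_space "iid_mat n d \<mu>" by (rule prob_iid)
  have f: "?f \<in> borel_measurable (iid_mat n d \<mu>)"
    using mmeas_quad[OF i B dB] mmeas_inner[OF mmeas_const B dims_intros(7)] by measurable
  have "(\<integral>\<^sup>+X. ennreal ((?f X)\<^sup>2) \<partial>iid_mat n d \<mu>) \<le>
      (\<integral>\<^sup>+X. ennreal (m4 + 2) * ennreal ((norm (B (drop_obs i X)))\<^sup>2) \<partial>iid_mat n d \<mu>)"
    using loo_variance[OF i B dB] m4_nonneg by (simp add: ennreal_mult)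
  also have "\<dots> = ennreal (m4 + 2) * (\<integral>\<^sup>+X. ennreal ((norm (B (drop_obs i X)))\<^sup>2) \<partial>iid_mat n d \<mu>)"
    by (intro nn_integral_cmult measurable_compose[OF _ measurable_ennreal] borel_measurable_power
        mmeas_norm[OF B dB])
  also have "\<dots> \<le> ennreal (m4 + 2) * ennreal b"
    by (intro mult_left_mono le) auto
  also have "\<dots> = ennreal ((m4 + 2) * b)" using m4_nonneg b by (simp add: ennreal_mult)
  finally have *: "(\<integral>\<^sup>+X. ennreal ((?f X)\<^sup>2) \<partial>iid_mat n d \<mu>) \<le> ennreal ((m4 + 2) * b)" .
  have "0 \<le> (m4 + 2) * b" using m4_nonneg b by simp
  from M.abs_integral_le_sqrt[OF f * this]
  show "integrable (iid_mat n d \<mu>) (\<lambda>X. \<bar>?f X\<bar>)"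
    and "(\<integral>X. \<bar>?f X\<bar> \<partial>iid_mat n d \<mu>) \<le> sqrt (m4 + 2) * sqrt b"
    by (simp_all add: real_sqrt_mult)
qed

text \<open>Bounds the mean square Frobenius norm of \<open>S\<close>. The three terms come from the
  coincidences \<open>j = k\<close>, \<open>i = i'\<close>, and both, in the fourfold sum of
  \<open>norm_gram\<close>.\<close>

definition gram_bound :: "nat \<Rightarrow> nat \<Rightarrow> real" where
  "gram_bound n d = d + (real d)\<^sup>2 / n + m4 * d / n"

lemma gram_bound_nonneg: "0 \<le> gram_bound n d"
  using m4_nonneg by (simp add: gram_bound_def)

lemma norm_gram:
  "(norm (gram n d X))\<^sup>2 = (1 / real n)\<^sup>2 *
     (\<Sum>j<d. \<Sum>k<d. \<Sum>i<n. \<Sum>i'<n. X (i, j) * X (i, k) * (X (i', j) * X (i', k)))"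
proof -
  have d: "dims d n (tp (rmat n d X))" by blast
  have e: "ent (gram n d X) j k = (1 / real n) * (\<Sum>i<n. X (i, j) * X (i, k))" if "j < d" "k < d" for j k
    using that by (simp add: gram_def ent_times[OF d] ent_rmat)
  have "(norm (gram n d X))\<^sup>2 = (\<Sum>j<d. \<Sum>k<d. ((1 / real n) * (\<Sum>i<n. X (i, j) * X (i, k)))\<^sup>2)"
    unfolding power2_norm_eq_inner inner_fmat_eq[OF dims_gram] by (simp add: e power2_eq_square)
  also have "\<dots> = (\<Sum>j<d. \<Sum>k<d. (1 / real n)\<^sup>2 * (\<Sum>i<n. \<Sum>i'<n. X (i, j) * X (i, k) * (X (i', j) * X (i', k))))"
    unfolding power_mult_distrib by (simp add: power2_eq_square sum_product)
  finally show ?thesis by (simp add: sum_distrib_left)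
qed

lemma expectation_norm_gram:
  assumes n: "0 < n"
  shows "integrable (iid_mat n d \<mu>) (\<lambda>X. (norm (gram n d X))\<^sup>2)"
    and "(\<integral>X. (norm (gram n d X))\<^sup>2 \<partial>iid_mat n d \<mu>) \<le> gram_bound n d"
proof -
  let ?M = "PiM ({..<n} \<times> {..<d}) (\<lambda>_. \<mu>)"
  have int: "integrable ?M (\<lambda>X. X (i, j) * X (i, k) * (X (i', j) * X (i', k)))"
    "(\<integral>X. X (i, j) * X (i, k) * (X (i', j) * X (i', k)) \<partial>?M) \<le>
      of_bool (j = k) + of_bool (i = i') + m4 * of_bool (i = i' \<and> j = k)"
    if jk: "j < d" "k < d" "i < n" "i' < n" for i j k i'
  proof -
    have mem: "finite ({..<n} \<times> {..<d})" "(i, j) \<in> {..<n} \<times> {..<d}" "(i, k) \<in> {..<n} \<times> {..<d}"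
      "(i', j) \<in> {..<n} \<times> {..<d}" "(i', k) \<in> {..<n} \<times> {..<d}"
      using jk by auto
    show "integrable ?M (\<lambda>X. X (i, j) * X (i, k) * (X (i', j) * X (i', k)))"
      by (rule moment4(1)[OF mem])
    show "(\<integral>X. X (i, j) * X (i, k) * (X (i', j) * X (i', k)) \<partial>?M) \<le>
      of_bool (j = k) + of_bool (i = i') + m4 * of_bool (i = i' \<and> j = k)"
      unfolding moment4(2)[OF mem] by (cases "j = k"; cases "i = i'") simp_all
  qed
  show "integrable (iid_mat n d \<mu>) (\<lambda>X. (norm (gram n d X))\<^sup>2)"
    unfolding norm_gram iid_mat_def
    by (intro integrable_mult_right Bochner_Integration.integrable_sum int) auto
  have "(\<integral>X. (norm (gram n d X))\<^sup>2 \<partial>iid_mat n d \<mu>) = (1 / real n)\<^sup>2 * (\<Sum>j<d. \<Sum>k<d. \<Sum>i<n. \<Sum>i'<n.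
      (\<integral>X. X (i, j) * X (i, k) * (X (i', j) * X (i', k)) \<partial>?M))"
  proof -
    have "has_bochner_integral ?M
        (\<lambda>X. \<Sum>j<d. \<Sum>k<d. \<Sum>i<n. \<Sum>i'<n. X (i, j) * X (i, k) * (X (i', j) * X (i', k)))
        (\<Sum>j<d. \<Sum>k<d. \<Sum>i<n. \<Sum>i'<n. (\<integral>X. X (i, j) * X (i, k) * (X (i', j) * X (i', k)) \<partial>?M))"
      by (intro has_bochner_integral_sum has_bochner_integral_integrable int) auto
    from has_bochner_integral_integral_eq[OF this] show ?thesis
      unfolding norm_gram iid_mat_def by simp
  qed
  also have "\<dots> \<le> (1 / real n)\<^sup>2 * (\<Sum>j<d. \<Sum>k<d. \<Sum>i<n. \<Sum>i'<n.
      of_bool (j = k) + of_bool (i = i') + m4 * of_bool (i = i' \<and> j = k))"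
    by (intro mult_left_mono sum_mono int) auto
  also have "(\<Sum>j<d. \<Sum>k<d. \<Sum>i<n. \<Sum>i'<n.
      of_bool (j = k) + of_bool (i = i') + m4 * of_bool (i = i' \<and> j = k)) =
      real n * n * d + real n * d * d + m4 * n * d"
  proof -
    have "of_bool (i = i' \<and> j = k) = of_bool (j = k) * (of_bool (i = i') :: real)" for i i' j k :: nat
      by auto
    then show ?thesis
      by (simp add: sum.distrib flip: sum_distrib_left sum_distrib_right) (simp add: algebra_simps)
  qed
  also have "(1 / real n)\<^sup>2 * (real n * n * d + real n * d * d + m4 * n * d) = gram_bound n d"
    using n by (simp add: gram_bound_def field_simps power2_eq_square)
  finally show "(\<integral>X. (norm (gram n d X))\<^sup>2 \<partial>iid_mat n d \<mu>) \<le> gram_bound n d" .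
qed

text \<open>Restoring the row adds a positive semidefinite matrix, whose inner product with the
  positive semidefinite rest is nonnegative.\<close>

lemma norm_gram_drop_le:
  assumes "i < n"
  shows "norm (gram n d (drop_obs i X)) \<le> norm (gram n d X)"
proof -
  let ?S = "gram n d (drop_obs i X)" and ?x = "obs d X i"
  have S: "gram n d X = ?S + (1 / real n) *\<^sub>R (?x * tp ?x)"
    using gram_drop_obs[OF assms] by simp
  have "0 \<le> inner (?x * tp ?x) ?S"
    unfolding inner_rank_one using psd_gram by (simp add: psd_def)
  then have "(norm ?S)\<^sup>2 \<le> (norm (gram n d X))\<^sup>2"
    unfolding power2_norm_eq_inner S by (simp add: inner_add_left inner_add_right inner_commute)
  then show ?thesis by (simp add: norm_le_square[symmetric] power2_norm_eq_inner norm_le)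
qed

end

section \<open>The three normalised statistics and their mean deviations for fixed
  \<open>W\<close>\<close>

definition proj_of :: "nat \<Rightarrow> nat \<Rightarrow> (nat \<times> nat \<Rightarrow> real) \<Rightarrow> fmat" where
  "proj_of p d W = tp (rmat p d W) * rmat p d W"

definition res_trace where
  "res_trace l n p d X W = inner (proj_of p d W) (rp_resolvent l n p d X W) / real n"

definition res_norm where
  "res_norm l n p d X W = (norm (rp_resolvent l n p d X W))\<^sup>2 / real n"

definition res_cross where
  "res_cross l n p d X W =
     (norm ((idm d - proj_of p d W) * gram n d X * rp_resolvent l n p d X W))\<^sup>2 / real n"

lemma dims_proj_of [intro]: "dims d d (proj_of p d W)"
  unfolding proj_of_def by blast

text \<open>Here \<open>W\<close> is deterministic and only \<open>X\<close> is random. The final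
  bounds contain \<open>n\<close>, \<open>p\<close>, \<open>d\<close>, \<open>l\<close> and
  \<open>m4\<close>, but not \<open>W\<close> itself.\<close>

locale fixed_projection = entry_moments +
  fixes n p d :: nat and l :: real and W :: "nat \<times> nat \<Rightarrow> real"
  assumes n: "0 < n" and l: "0 < l" and W: "rmat p d W * tp (rmat p d W) = idm p"
begin

abbreviation "M \<equiv> iid_mat n d \<mu>"
abbreviation "P \<equiv> proj_of p d W"
abbreviation "D \<equiv> idm d - P"
abbreviation "S \<equiv> gram n d"
abbreviation "R \<equiv> \<lambda>X. rp_resolvent l n p d X W"

lemma P: "proj P" and PP: "inner P P = real p"
  unfolding proj_of_def using proj_gram_of_coisometry[OF W] by auto

lemma R: "resolv P l (S X) (R X)"
  unfolding proj_of_def by (rule resolv_rp_resolvent[OF l W])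

lemma R_facts: "tp (R X) = R X" "P * R X = R X"
  using R by (auto simp: resolv_def)

lemma dims_R: "dims d d (R X)"
  by (rule dims_rp_resolvent[OF l])

lemma dims_D [intro]: "dims d d D" by blast

lemma sample: "sample_resolvent n d (obs d X) P (S X) (R X)
    (\<lambda>i. S (drop_obs i X)) (\<lambda>i. R (drop_obs i X)) l"
  by unfold_locales (rule n P l dims_proj_of dims_obs gram_eq gram_drop_obs R dims_R | assumption)+

lemma D: "proj D"
  using P idm_times[OF dims_proj_of] times_idm[OF dims_proj_of] idm_times[OF dims_intros(7)]
  by (auto simp: proj_def algebra_simps)

lemma norm_D: "(norm D)\<^sup>2 = real d - real p"
proof -
  have "inner (idm d) P = inner P P"
    using P inner_times_left[of P P "idm d"] times_idm[OF dims_proj_of]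
    by (simp add: proj_def inner_commute)
  then show ?thesis
    by (simp add: power2_norm_eq_inner inner_diff_left inner_diff_right inner_idm_idm PP inner_commute)
qed

lemma p_le_d: "p \<le> d"
  using norm_D zero_le_power2[of "norm D"] by simp

lemma trace_D: "inner (idm d) D = real d - real p"
  using norm_D D inner_times_left[of D D "idm d"] times_idm[OF dims_D]
  by (simp add: proj_def inner_commute power2_norm_eq_inner)

lemma trace_R: "inner (idm d) (R X * A) = inner P (R X * A)"
proof -
  have "inner (idm d) (P * (R X * A)) = inner P (R X * A)"
    using P times_idm[OF dims_proj_of] inner_times_left[of P "R X * A" "idm d"]
    by (simp add: proj_def inner_commute)
  then show ?thesis by (simp add: R_facts flip: mult.assoc)
qed

lemma DR: "D * R X = 0"
  using idm_times[OF dims_R] R_facts by (simp add: left_diff_distrib)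

text \<open>Cyclicity brings \<open>R X\<close> next to \<open>D\<close>, and
  \<open>D * R X = 0\<close>. Hence the mixed quadratic forms fluctuate around zero.\<close>

lemma trace_DAR: "inner (idm d) (D * A * R X) = 0"
proof -
  have "inner (D * A * R X) (idm d) = inner (D * A) (R X)"
    by (simp add: inner_times_right R_facts idm_times[OF dims_R])
  also have "\<dots> = inner A (D * R X)"
    using D by (simp add: inner_times_left proj_def)
  finally show ?thesis by (simp add: DR inner_commute)
qed

lemma trace_DARR: "inner (idm d) (D * A * R X * R Y) = 0"
  using trace_DAR[of "A * R X" Y] by (simp add: mult.assoc)

lemma norm_R: "(norm (R X))\<^sup>2 \<le> d / l\<^sup>2"
proof -
  have "(norm (R X))\<^sup>2 \<le> (norm P / l)\<^sup>2"
    using resolv_norm[OF P psd_gram l R] by (intro power_mono) auto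
  also have "\<dots> = p / l\<^sup>2" by (simp add: power_divide power2_norm_eq_inner PP)
  also have "\<dots> \<le> d / l\<^sup>2" using p_le_d by (intro divide_right_mono) auto
  finally show ?thesis .
qed

lemma norm_AR: "(norm (A * R X))\<^sup>2 \<le> (norm A)\<^sup>2 / l\<^sup>2"
proof -
  have "(norm (A * R X))\<^sup>2 \<le> (norm A / l)\<^sup>2"
    using resolv_norm_right[OF P psd_gram l R] by (intro power_mono) auto
  then show ?thesis by (simp add: power_divide)
qed

lemma norm_DA: "(norm (D * A))\<^sup>2 \<le> (norm A)\<^sup>2"
  using norm_proj_le[OF D] by (intro power_mono) auto

lemma mmeas_R': "mmeas M (\<lambda>X. R (drop_obs i X))"
  by (intro mmeas_rp_resolvent l measurable_entry measurable_drop_entry; simp)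

lemma mmeas_S': "mmeas M (\<lambda>X. S (drop_obs i X))"
  by (intro mmeas_gram measurable_drop_entry)

lemma prob_M: "prob_space M" by (rule prob_iid)

lemma nn_const_le:
  assumes "\<And>X. f X \<le> b"
  shows "(\<integral>\<^sup>+X. ennreal (f X) \<partial>M) \<le> ennreal b"
proof -
  interpret M: prob_space M by (rule prob_M)
  have "(\<integral>\<^sup>+X. ennreal (f X) \<partial>M) \<le> (\<integral>\<^sup>+X. ennreal b \<partial>M)"
    using assms by (intro nn_integral_mono ennreal_leI)
  then show ?thesis by (simp add: M.emeasure_space_1)
qed

text \<open>Fluctuations around traces, for the five kinds of quadratic form in the estimates.
  \<open>E3\<close> and \<open>E4\<close> subtract nothing because their traces vanish;
  \<open>E5\<close> subtracts the trace of \<open>D\<close>.\<close>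

definition "E1 X i = \<bar>inner (obs d X i) (R (drop_obs i X) * obs d X i) - inner P (R (drop_obs i X))\<bar> / n"
definition "E2 X i = \<bar>inner (obs d X i) (R (drop_obs i X) * R (drop_obs i X) * obs d X i)
   - inner P (R (drop_obs i X) * R (drop_obs i X))\<bar> / n"
definition "E3 X i = \<bar>inner (obs d X i)
   (D * S (drop_obs i X) * R (drop_obs i X) * R (drop_obs i X) * obs d X i)\<bar> / n"
definition "E4 X i = \<bar>inner (obs d X i) (D * S (drop_obs i X) * R (drop_obs i X) * obs d X i)\<bar> / n"
definition "E5 X i = \<bar>inner (obs d X i) (D * obs d X i) - (real d - real p)\<bar> / n"

definition "\<rho> = sqrt (m4 + 2)"

lemma E1: assumes "i < n"
  shows "integrable M (\<lambda>X. E1 X i)" "(\<integral>X. E1 X i \<partial>M) \<le> \<rho> * sqrt (d / l\<^sup>2) / n"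
proof -
  have eq: "inner (idm d) (R X) = inner P (R X)" for X
    using trace_R[of X "idm d"] times_idm[OF dims_R] by simp
  have b: "0 \<le> d / l\<^sup>2" by simp
  note * = loo_deviation[OF assms mmeas_R' dims_R nn_const_le[OF norm_R] b, unfolded eq]
  show "integrable M (\<lambda>X. E1 X i)" unfolding E1_def using *(1) by simp
  show "(\<integral>X. E1 X i \<partial>M) \<le> \<rho> * sqrt (d / l\<^sup>2) / n"
    unfolding E1_def \<rho>_def using *(2) n by (simp add: divide_right_mono)
qed

lemma E2: assumes "i < n"
  shows "integrable M (\<lambda>X. E2 X i)" "(\<integral>X. E2 X i \<partial>M) \<le> \<rho> * sqrt (d / l\<^sup>2 / l\<^sup>2) / n"
proof -
  have b: "0 \<le> d / l\<^sup>2 / l\<^sup>2" by simp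
  have d: "dims d d (R X * R X)" for X using dims_R by blast
  have m: "mmeas M (\<lambda>X. R (drop_obs i X) * R (drop_obs i X))"
    by (intro mmeas_times[OF mmeas_R' mmeas_R' dims_R])
  have "(norm (R X * R X))\<^sup>2 \<le> d / l\<^sup>2 / l\<^sup>2" for X
    using order.trans[OF norm_AR[of "R X" X] divide_right_mono[OF norm_R[of X]]] by simp
  note * = loo_deviation[where B = "\<lambda>X. R X * R X", OF assms m d nn_const_le[OF this] b, unfolded trace_R]
  show "integrable M (\<lambda>X. E2 X i)" unfolding E2_def using *(1) by simp
  show "(\<integral>X. E2 X i \<partial>M) \<le> \<rho> * sqrt (d / l\<^sup>2 / l\<^sup>2) / n"
    unfolding E2_def \<rho>_def using *(2) n by (simp add: divide_right_mono)
qed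

text \<open>Here the norm of \<open>B\<close> is bounded by the random norm of \<open>S\<close>, so
  only its mean square can be controlled; \<open>norm_gram_drop_le\<close> passes from the reduced
  to the full sample.\<close>

lemma nn_norm_DSR:
  assumes "i < n" "\<And>X. (norm (B X))\<^sup>2 \<le> (norm (S X))\<^sup>2 / c" "0 < c"
  shows "(\<integral>\<^sup>+X. ennreal ((norm (B (drop_obs i X)))\<^sup>2) \<partial>M) \<le> ennreal (gram_bound n d / c)"
proof (rule nn_integral_ennreal_le)
  show "integrable M (\<lambda>X. (norm (S X))\<^sup>2 / c)"
    using expectation_norm_gram(1)[OF n] by simp
  show "(\<integral>X. (norm (S X))\<^sup>2 / c \<partial>M) \<le> gram_bound n d / c"
    using expectation_norm_gram(2)[OF n] assms(3) by (simp add: divide_right_mono)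
  show "(norm (B (drop_obs i X)))\<^sup>2 \<le> (norm (S X))\<^sup>2 / c" for X
    using assms(2)[of "drop_obs i X"] norm_gram_drop_le[OF assms(1), of d X] assms(3)
    by (elim order.trans) (auto intro!: divide_right_mono power_mono)
qed (use assms(3) in simp)

lemma E3: assumes "i < n"
  shows "integrable M (\<lambda>X. E3 X i)" "(\<integral>X. E3 X i \<partial>M) \<le> \<rho> * sqrt (gram_bound n d / (l\<^sup>2 * l\<^sup>2)) / n"
proof -
  have b: "0 \<le> gram_bound n d / (l\<^sup>2 * l\<^sup>2)" using gram_bound_nonneg by simp
  have d: "dims d d (D * S X * R X * R X)" for X using dims_R by blast
  have m: "mmeas M (\<lambda>X. D * S (drop_obs i X) * R (drop_obs i X) * R (drop_obs i X))"
    by (intro mmeas_times[of _ _ _ d d] mmeas_R' mmeas_S' mmeas_const) (use dims_R in blast)+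
  have c: "0 < l\<^sup>2 * l\<^sup>2" using l by simp
  have "(norm (D * S X * R X * R X))\<^sup>2 \<le> (norm (S X))\<^sup>2 / (l\<^sup>2 * l\<^sup>2)" for X
  proof -
    have "(norm (D * S X * R X * R X))\<^sup>2 \<le> (norm (D * S X * R X))\<^sup>2 / l\<^sup>2" by (rule norm_AR)
    also have "\<dots> \<le> (norm (D * S X))\<^sup>2 / l\<^sup>2 / l\<^sup>2" by (intro divide_right_mono norm_AR) simp
    also have "\<dots> \<le> (norm (S X))\<^sup>2 / l\<^sup>2 / l\<^sup>2" by (intro divide_right_mono norm_DA) auto
    finally show ?thesis by simp
  qed
  note * = loo_deviation[where B = "\<lambda>X. D * S X * R X * R X", OF assms m d nn_norm_DSR[OF assms this c] b, unfolded trace_DARR]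
  show "integrable M (\<lambda>X. E3 X i)" unfolding E3_def using *(1) by simp
  show "(\<integral>X. E3 X i \<partial>M) \<le> \<rho> * sqrt (gram_bound n d / (l\<^sup>2 * l\<^sup>2)) / n"
    unfolding E3_def \<rho>_def using *(2) n by (simp add: divide_right_mono)
qed

lemma E4: assumes "i < n"
  shows "integrable M (\<lambda>X. E4 X i)" "(\<integral>X. E4 X i \<partial>M) \<le> \<rho> * sqrt (gram_bound n d / l\<^sup>2) / n"
proof -
  have b: "0 \<le> gram_bound n d / l\<^sup>2" using gram_bound_nonneg by simp
  have d: "dims d d (D * S X * R X)" for X using dims_R by blast
  have m: "mmeas M (\<lambda>X. D * S (drop_obs i X) * R (drop_obs i X))"
    by (intro mmeas_times[of _ _ _ d d] mmeas_R' mmeas_S' mmeas_const) (use dims_R in blast)+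
  have c: "0 < l\<^sup>2" using l by simp
  have "(norm (D * S X * R X))\<^sup>2 \<le> (norm (S X))\<^sup>2 / l\<^sup>2" for X
    using order.trans[OF norm_AR[of "D * S X" X] divide_right_mono[OF norm_DA[of "S X"]]] by simp
  note * = loo_deviation[where B = "\<lambda>X. D * S X * R X", OF assms m d nn_norm_DSR[OF assms this c] b, unfolded trace_DAR]
  show "integrable M (\<lambda>X. E4 X i)" unfolding E4_def using *(1) by simp
  show "(\<integral>X. E4 X i \<partial>M) \<le> \<rho> * sqrt (gram_bound n d / l\<^sup>2) / n"
    unfolding E4_def \<rho>_def using *(2) n by (simp add: divide_right_mono)
qed

lemma E5: assumes "i < n"
  shows "integrable M (\<lambda>X. E5 X i)" "(\<integral>X. E5 X i \<partial>M) \<le> \<rho> * sqrt d / n"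
proof -
  have b: "0 \<le> real d" by simp
  have "(norm D)\<^sup>2 \<le> real d" using norm_D by simp
  note * = loo_deviation[where B = "\<lambda>X. D", OF assms mmeas_const dims_D nn_const_le[OF this] b, unfolded trace_D]
  show "integrable M (\<lambda>X. E5 X i)" unfolding E5_def using *(1) by simp
  show "(\<integral>X. E5 X i \<partial>M) \<le> \<rho> * sqrt d / n"
    unfolding E5_def \<rho>_def using *(2) n by (simp add: divide_right_mono)
qed

lemma average_le:
  assumes "\<And>i. i < n \<Longrightarrow> integrable M (\<lambda>X. f X i)" "\<And>i. i < n \<Longrightarrow> (\<integral>X. f X i \<partial>M) \<le> b"
  shows "integrable M (\<lambda>X. (\<Sum>i<n. f X i) / n)" "(\<integral>X. (\<Sum>i<n. f X i) / n \<partial>M) \<le> b"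
proof -
  show "integrable M (\<lambda>X. (\<Sum>i<n. f X i) / n)" 
    using assms(1) by (intro integrable_divide Bochner_Integration.integrable_sum) auto
  have "(\<integral>X. (\<Sum>i<n. f X i) / n \<partial>M) = (\<Sum>i<n. \<integral>X. f X i \<partial>M) / n"
    using assms(1) by simp
  also have "\<dots> \<le> (\<Sum>i<n. b) / n"
    using assms(2) by (intro divide_right_mono sum_mono) auto
  finally show "(\<integral>X. (\<Sum>i<n. f X i) / n \<partial>M) \<le> b" using n by simp
qed

text \<open>These are the error terms of \<open>t_close\<close>, \<open>\<tau>_close\<close> and
  \<open>cross_close\<close> with bounds on their expectations inserted. In
  \<open>norm_bound\<close> the random factor \<open>\<tau>\<close> is replaced by its bound
  \<open>d / (n * l\<^sup>2)\<close>.\<close>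

definition "trace_bound g = (\<bar>p / n - g\<bar> + \<rho> * sqrt (d / l\<^sup>2) / n + 1 / (n * l)) / l"

definition "norm_bound g = ((1 + 2 * (d / (n * l\<^sup>2))) * trace_bound g
    + \<rho> * sqrt (d / l\<^sup>2 / l\<^sup>2) / n + 2 / (n * l\<^sup>2)
    + 2 * (d / (n * l\<^sup>2)) * (\<rho> * sqrt (d / l\<^sup>2) / n + 1 / (n * l))) / l"

definition "cross_bound om = \<rho> * sqrt (gram_bound n d / (l\<^sup>2 * l\<^sup>2)) / n
    + \<rho> * sqrt (gram_bound n d / l\<^sup>2) / n / l + (\<rho> * sqrt d / n + \<bar>(real d - real p) / n - om\<bar>) / l"

lemma res_norm_le: "res_norm l n p d X W \<le> d / (n * l\<^sup>2)"
  using norm_R[of X] n l by (simp add: res_norm_def field_simps)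

text \<open>Exposes the pointwise majorant \<open>h\<close>, because the estimate for the norm uses
  the deviation of the trace pointwise.\<close>

lemma trace_aux:
  assumes T: "0 \<le> T" "g - l * T = T / (1 + T)"
  defines "h \<equiv> \<lambda>X. (\<bar>p / n - g\<bar> + (\<Sum>i<n. E1 X i) / n + 1 / (n * l)) / l"
  shows "\<bar>res_trace l n p d X W - T\<bar> \<le> h X" "integrable M h" "(\<integral>X. h X \<partial>M) \<le> trace_bound g"
proof -
  interpret M: prob_space M by (rule prob_M)
  interpret s: sample_resolvent n d "obs d X" P "S X" "R X"
    "\<lambda>i. S (drop_obs i X)" "\<lambda>i. R (drop_obs i X)" l by (rule sample)
  have "l * \<bar>res_trace l n p d X W - T\<bar> \<le> \<bar>p / n - g\<bar> + (\<Sum>i<n. E1 X i) / n + 1 / (n * l)"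
    using s.t_close[OF T] by (simp add: res_trace_def s.t_def s.e1_def E1_def PP)
  then show "\<bar>res_trace l n p d X W - T\<bar> \<le> h X"
    using l by (simp add: h_def pos_le_divide_eq mult.commute)
  show "integrable M h" unfolding h_def using average_le[OF E1] by simp
  have "(\<integral>X. h X \<partial>M) = (\<bar>p / n - g\<bar> + (\<integral>X. (\<Sum>i<n. E1 X i) / n \<partial>M) + 1 / (n * l)) / l"
    unfolding h_def using average_le(1)[OF E1] by (simp add: M.prob_space)
  then show "(\<integral>X. h X \<partial>M) \<le> trace_bound g"
    unfolding trace_bound_def using average_le(2)[OF E1] l
    by (simp only:) (intro divide_right_mono add_mono; simp)
qed

lemma trace_deviation:
  assumes T: "0 \<le> T" "g - l * T = T / (1 + T)"
  shows "(\<integral>\<^sup>+X. ennreal \<bar>res_trace l n p d X W - T\<bar> \<partial>M) \<le> ennreal (trace_bound g)"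
  by (rule nn_integral_ennreal_le[OF trace_aux(1)[OF T] trace_aux(2)[OF T] _ trace_aux(3)[OF T]])
    (use order.trans[OF abs_ge_zero trace_aux(1)[OF T]] in blast)

lemma norm_deviation:
  assumes T: "0 \<le> T" "g - l * T = T / (1 + T)"
  shows "(\<integral>\<^sup>+X. ennreal \<bar>res_norm l n p d X W - T / (l + 1 / (1 + T)\<^sup>2)\<bar> \<partial>M) \<le> ennreal (norm_bound g)"
proof -
  interpret M: prob_space M by (rule prob_M)
  define h where "h = (\<lambda>X. (\<bar>p / n - g\<bar> + (\<Sum>i<n. E1 X i) / n + 1 / (n * l)) / l)"
  define C where "C = d / (n * l\<^sup>2)"
  define k where "k = (\<lambda>X. ((1 + 2 * C) * h X + (\<Sum>i<n. E2 X i) / n + 2 / (n * l\<^sup>2)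
     + 2 * C * ((\<Sum>i<n. E1 X i) / n + 1 / (n * l))) / l)"
  note h = trace_aux[OF T, folded h_def]
  have C: "0 \<le> C" by (simp add: C_def)
  have le: "\<bar>res_norm l n p d X W - T / (l + 1 / (1 + T)\<^sup>2)\<bar> \<le> k X" for X
  proof -
    interpret s: sample_resolvent n d "obs d X" P "S X" "R X"
      "\<lambda>i. S (drop_obs i X)" "\<lambda>i. R (drop_obs i X)" l by (rule sample)
    define \<tau> where "\<tau> = res_norm l n p d X W"
    have \<tau>: "0 \<le> \<tau>" "\<tau> \<le> C" using res_norm_le by (auto simp: \<tau>_def C_def res_norm_def)
    have hX: "\<bar>res_trace l n p d X W - T\<bar> \<le> h X"
      using trace_aux(1)[OF T] by (simp add: h_def)
    have E1: "0 \<le> (\<Sum>i<n. E1 X i) / n + 1 / (n * l)"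
      using l by (intro add_nonneg_nonneg divide_nonneg_nonneg sum_nonneg) (auto simp: E1_def)
    have "l * \<bar>\<tau> - T / (l + 1 / (1 + T)\<^sup>2)\<bar> \<le> (1 + 2 * \<tau>) * \<bar>res_trace l n p d X W - T\<bar>
      + (\<Sum>i<n. E2 X i) / n + 2 / (n * l\<^sup>2) + 2 * \<tau> * ((\<Sum>i<n. E1 X i) / n + 1 / (n * l))"
      using s.\<tau>_close[OF T(1)]
      by (simp add: res_trace_def s.t_def s.e1_def E1_def s.e2_def E2_def s.\<tau>_def \<tau>_def res_norm_def)
    also have "\<dots> \<le> (1 + 2 * C) * h X + (\<Sum>i<n. E2 X i) / n + 2 / (n * l\<^sup>2)
       + 2 * C * ((\<Sum>i<n. E1 X i) / n + 1 / (n * l))"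
      using \<tau> C hX E1 by (intro add_mono mult_mono order_refl) auto
    finally show ?thesis
      using l by (simp add: k_def \<tau>_def pos_le_divide_eq mult.commute)
  qed
  have int: "integrable M k"
    unfolding k_def using h(2) average_le(1)[OF E1] average_le(1)[OF E2] by simp
  have "(\<integral>X. k X \<partial>M) = ((1 + 2 * C) * (\<integral>X. h X \<partial>M) + (\<integral>X. (\<Sum>i<n. E2 X i) / n \<partial>M) + 2 / (n * l\<^sup>2)
     + 2 * C * ((\<integral>X. (\<Sum>i<n. E1 X i) / n \<partial>M) + 1 / (n * l))) / l"
    unfolding k_def using h(2) average_le(1)[OF E1] average_le(1)[OF E2] by (simp add: M.prob_space)
  also have "\<dots> \<le> norm_bound g"
    unfolding norm_bound_def C_def[symmetric] using h(3) average_le(2)[OF E1] average_le(2)[OF E2] C l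
    by (intro divide_right_mono add_mono mult_left_mono) auto
  finally show ?thesis
    using nn_integral_ennreal_le[OF le int order.trans[OF abs_ge_zero le]] by blast
qed

text \<open>The comparison value is itself random; its limit is supplied by the two preceding
  deviations.\<close>

lemma cross_deviation:
  "(\<integral>\<^sup>+X. ennreal \<bar>res_cross l n p d X W - om * (res_trace l n p d X W - l * res_norm l n p d X W)\<bar> \<partial>M)
    \<le> ennreal (cross_bound om)"
proof -
  interpret M: prob_space M by (rule prob_M)
  define c where "c = \<bar>(real d - real p) / n - om\<bar>"
  define k where "k = (\<lambda>X. (\<Sum>i<n. E3 X i + E4 X i / l + (E5 X i + c) / l) / n)"
  have le: "\<bar>res_cross l n p d X W - om * (res_trace l n p d X W - l * res_norm l n p d X W)\<bar> \<le> k X" for X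
  proof -
    interpret s: sample_resolvent n d "obs d X" P "S X" "R X"
      "\<lambda>i. S (drop_obs i X)" "\<lambda>i. R (drop_obs i X)" l by (rule sample)
    have "\<bar>res_cross l n p d X W - om * (res_trace l n p d X W - l * res_norm l n p d X W)\<bar> \<le>
      (\<Sum>i<n. E3 X i + E4 X i / l + \<bar>inner (obs d X i) (D * obs d X i) / n - om\<bar> / l) / n"
      using s.cross_close[OF dims_gram]
      by (simp add: res_trace_def s.t_def s.\<tau>_def res_norm_def res_cross_def E3_def E4_def)
    also have "\<dots> \<le> k X"
      unfolding k_def
    proof (intro divide_right_mono sum_mono add_mono order_refl)
      fix i
      have "E5 X i = \<bar>inner (obs d X i) (D * obs d X i) / n - (real d - real p) / n\<bar>"
        by (simp add: E5_def diff_divide_distrib[symmetric])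
      then show "\<bar>inner (obs d X i) (D * obs d X i) / n - om\<bar> \<le> E5 X i + c"
        unfolding c_def by linarith
    qed (use l in auto)
    finally show ?thesis .
  qed
  have i: "integrable M (\<lambda>X. E3 X i + E4 X i / l + (E5 X i + c) / l)" if "i < n" for i
    using E3(1)[OF that] E4(1)[OF that] E5(1)[OF that] by simp
  have "(\<integral>X. E3 X i + E4 X i / l + (E5 X i + c) / l \<partial>M) \<le> cross_bound om" if "i < n" for i
  proof -
    have "(\<integral>X. E3 X i + E4 X i / l + (E5 X i + c) / l \<partial>M) =
        (\<integral>X. E3 X i \<partial>M) + (\<integral>X. E4 X i \<partial>M) / l + ((\<integral>X. E5 X i \<partial>M) + c) / l"
      using E3(1)[OF that] E4(1)[OF that] E5(1)[OF that] by (simp add: M.prob_space)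
    also have "\<dots> \<le> cross_bound om"
      unfolding cross_bound_def c_def[symmetric] using E3(2)[OF that] E4(2)[OF that] E5(2)[OF that] l
      by (intro divide_right_mono add_mono) auto
    finally show ?thesis .
  qed
  note k = average_le[where f = "\<lambda>X i. E3 X i + E4 X i / l + (E5 X i + c) / l", OF i this, folded k_def]
  show ?thesis
    by (rule nn_integral_ennreal_le[OF le k(1) order.trans[OF abs_ge_zero le] k(2)])
qed

end

section \<open>Exact bias and variance\<close>

lemma pair_integral_product:
  fixes f :: "'a \<Rightarrow> real" and g :: "'b \<Rightarrow> real"
  assumes "prob_space A" "prob_space B" and f: "integrable A f" and g: "integrable B g"
  shows "integrable (A \<Otimes>\<^sub>M B) (\<lambda>x. f (fst x) * g (snd x))"
    and "(\<integral>x. f (fst x) * g (snd x) \<partial>(A \<Otimes>\<^sub>M B)) = (\<integral>x. f x \<partial>A) * (\<integral>x. g x \<partial>B)"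
proof -
  interpret A: prob_space A by fact
  interpret B: prob_space B by fact
  interpret AB: pair_sigma_finite A B ..
  have [measurable]: "f \<in> borel_measurable A" "g \<in> borel_measurable B" using f g by auto
  show int: "integrable (A \<Otimes>\<^sub>M B) (\<lambda>x. f (fst x) * g (snd x))"
    by (rule AB.Fubini_integrable) (use f g in \<open>auto simp: abs_mult\<close>)
  show "(\<integral>x. f (fst x) * g (snd x) \<partial>(A \<Otimes>\<^sub>M B)) = (\<integral>x. f x \<partial>A) * (\<integral>x. g x \<partial>B)"
    by (subst AB.integral_fst'[OF int, symmetric]) simp
qed

text \<open>The training law lists \<open>X\<close>, noise, \<open>W\<close>; to factor integrals,
  the noise has to be split off from the pair \<open>(X, W)\<close>.\<close>

lemma distr_triple_swap:
  assumes "prob_space A" "prob_space B" "prob_space C"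
  shows "distr (A \<Otimes>\<^sub>M (B \<Otimes>\<^sub>M C)) (B \<Otimes>\<^sub>M (A \<Otimes>\<^sub>M C)) (\<lambda>(a, b, c). (b, a, c)) = B \<Otimes>\<^sub>M (A \<Otimes>\<^sub>M C)"
proof (rule measure_eqI)
  interpret A: prob_space A by fact
  interpret B: prob_space B by fact
  interpret C: prob_space C by fact
  interpret AB: pair_sigma_finite A B ..
  interpret BC: prob_space "B \<Otimes>\<^sub>M C" by (rule prob_space_pair) fact+
  interpret AC: prob_space "A \<Otimes>\<^sub>M C" by (rule prob_space_pair) fact+
  let ?D = "distr (A \<Otimes>\<^sub>M (B \<Otimes>\<^sub>M C)) (B \<Otimes>\<^sub>M (A \<Otimes>\<^sub>M C)) (\<lambda>(a, b, c). (b, a, c))"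
  show "sets ?D = sets (B \<Otimes>\<^sub>M (A \<Otimes>\<^sub>M C))" by simp
  fix X assume "X \<in> sets ?D"
  then have X[measurable]: "X \<in> sets (B \<Otimes>\<^sub>M (A \<Otimes>\<^sub>M C))" by simp
  have "emeasure ?D X = (\<integral>\<^sup>+t. indicator X (case t of (a, b, c) \<Rightarrow> (b, a, c)) \<partial>(A \<Otimes>\<^sub>M (B \<Otimes>\<^sub>M C)))"
    by (subst nn_integral_indicator[symmetric], simp, subst nn_integral_distr) simp_all
  also have "\<dots> = (\<integral>\<^sup>+a. \<integral>\<^sup>+b. \<integral>\<^sup>+c. indicator X (b, a, c) \<partial>C \<partial>B \<partial>A)"
    by (subst BC.nn_integral_fst[symmetric], measurable)
      (auto intro!: nn_integral_cong simp: C.nn_integral_fst[symmetric])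
  also have "\<dots> = (\<integral>\<^sup>+b. \<integral>\<^sup>+a. \<integral>\<^sup>+c. indicator X (b, a, c) \<partial>C \<partial>A \<partial>B)"
    by (rule AB.Fubini'[symmetric]) measurable
  also have "\<dots> = (\<integral>\<^sup>+t. indicator X t \<partial>(B \<Otimes>\<^sub>M (A \<Otimes>\<^sub>M C)))"
    by (subst AC.nn_integral_fst[symmetric], measurable)
      (auto intro!: nn_integral_cong simp: C.nn_integral_fst[symmetric])
  finally show "emeasure ?D X = emeasure (B \<Otimes>\<^sub>M (A \<Otimes>\<^sub>M C)) X" by simp
qed

lemma triple_integral:
  fixes F :: "'b \<times> 'a \<times> 'c \<Rightarrow> real"
  assumes "prob_space A" "prob_space B" "prob_space C" and F: "integrable (B \<Otimes>\<^sub>M (A \<Otimes>\<^sub>M C)) F"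
  shows "integrable (A \<Otimes>\<^sub>M (B \<Otimes>\<^sub>M C)) (\<lambda>(a, b, c). F (b, a, c))"
    and "(\<integral>(a, b, c). F (b, a, c) \<partial>(A \<Otimes>\<^sub>M (B \<Otimes>\<^sub>M C))) = (\<integral>t. F t \<partial>(B \<Otimes>\<^sub>M (A \<Otimes>\<^sub>M C)))"
proof -
  let ?\<phi> = "\<lambda>(a, b, c). (b, a, c)"
  have \<phi>: "?\<phi> \<in> measurable (A \<Otimes>\<^sub>M (B \<Otimes>\<^sub>M C)) (B \<Otimes>\<^sub>M (A \<Otimes>\<^sub>M C))" by measurable
  note D = distr_triple_swap[OF assms(1-3)]
  have c: "(\<lambda>t. F (?\<phi> t)) = (\<lambda>(a, b, c). F (b, a, c))" by auto
  have "integrable (distr (A \<Otimes>\<^sub>M (B \<Otimes>\<^sub>M C)) (B \<Otimes>\<^sub>M (A \<Otimes>\<^sub>M C)) ?\<phi>) F" by (simp only: D F)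
  from integrable_distr[OF \<phi> this] show "integrable (A \<Otimes>\<^sub>M (B \<Otimes>\<^sub>M C)) (\<lambda>(a, b, c). F (b, a, c))"
    by (simp only: c)
  have "F \<in> borel_measurable (B \<Otimes>\<^sub>M (A \<Otimes>\<^sub>M C))" using F by auto
  from integral_distr[OF \<phi> this]
  show "(\<integral>(a, b, c). F (b, a, c) \<partial>(A \<Otimes>\<^sub>M (B \<Otimes>\<^sub>M C))) = (\<integral>t. F t \<partial>(B \<Otimes>\<^sub>M (A \<Otimes>\<^sub>M C)))"
    by (simp only: c D)
qed

lemma normal_law_moments:
  shows "real_distribution (normal_law 0 s)" "integrable (normal_law 0 s) (\<lambda>z. z\<^sup>2)"
    "(\<integral>z. z \<partial>normal_law 0 s) = 0" "(\<integral>z. z\<^sup>2 \<partial>normal_law 0 s) = s\<^sup>2"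
proof -
  interpret N: real_distribution std_normal_distribution by (rule real_dist_normal_dist)
  have eq: "normal_law 0 s = distr std_normal_distribution borel (\<lambda>z. s * z)"
    by (simp add: normal_law_def)
  have [measurable]: "(\<lambda>z. s * z) \<in> borel_measurable std_normal_distribution"
    by (intro borel_measurable_times) (auto simp: measurable_cong_sets[OF N.events_eq_borel refl])
  show "real_distribution (normal_law 0 s)"
    unfolding eq by (intro N.real_distribution_distr) simp
  have i: "integrable std_normal_distribution (\<lambda>z. s\<^sup>2 * z\<^sup>2)"
    using integrable_std_normal_distribution_moment[of 2] by simp
  show "integrable (normal_law 0 s) (\<lambda>z. z\<^sup>2)"
    unfolding eq by (subst integrable_distr_eq) (use i in \<open>simp_all add: power_mult_distrib\<close>)
  have "(\<integral>z. z \<partial>normal_law 0 s) = (\<integral>z. s * z ^ 1 \<partial>std_normal_distribution)"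
    unfolding eq by (subst integral_distr) simp_all
  also have "\<dots> = 0"
    using integral_std_normal_distribution_moment_odd[of 1] by simp
  finally show "(\<integral>z. z \<partial>normal_law 0 s) = 0" .
  have "(\<integral>z. z\<^sup>2 \<partial>normal_law 0 s) = (\<integral>z. s\<^sup>2 * z\<^sup>2 \<partial>std_normal_distribution)"
    unfolding eq by (subst integral_distr) (simp_all add: power_mult_distrib)
  also have "\<dots> = s\<^sup>2"
    using std_normal_distribution_even_moments(1)[of 1] by simp
  finally show "(\<integral>z. z\<^sup>2 \<partial>normal_law 0 s) = s\<^sup>2" .
qed

lemma integrable_product_of_squares:
  fixes f g :: "'a \<Rightarrow> real"
  assumes [measurable]: "f \<in> borel_measurable M" "g \<in> borel_measurable M"
    and "integrable M (\<lambda>x. (f x)\<^sup>2)" "integrable M (\<lambda>x. (g x)\<^sup>2)"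
  shows "integrable M (\<lambda>x. f x * g x)"
proof (rule Bochner_Integration.integrable_bound)
  show "integrable M (\<lambda>x. (f x)\<^sup>2 + (g x)\<^sup>2)" using assms by simp
  have "\<bar>a * b\<bar> \<le> \<bar>a\<^sup>2 + b\<^sup>2\<bar>" for a b :: real
  proof -
    have "0 \<le> (\<bar>a\<bar> - \<bar>b\<bar>)\<^sup>2" by simp
    then have "2 * (\<bar>a\<bar> * \<bar>b\<bar>) \<le> a\<^sup>2 + b\<^sup>2" by (simp add: power2_diff)
    moreover have "0 \<le> \<bar>a\<bar> * \<bar>b\<bar>" by simp
    ultimately have "\<bar>a\<bar> * \<bar>b\<bar> \<le> a\<^sup>2 + b\<^sup>2" by linarith
    then show ?thesis by (simp add: abs_mult)
  qed
  then show "AE x in M. norm (f x * g x) \<le> norm ((f x)\<^sup>2 + (g x)\<^sup>2)" by simp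
qed simp

text \<open>
  The predictor is a sum of products of a function of the test data and a function of the training
  data, where the former are orthogonal.
\<close>

lemma orthogonal_expansion:
  fixes u :: "'i \<Rightarrow> 's \<Rightarrow> real" and v :: "'i \<Rightarrow> 't \<Rightarrow> real"
  assumes "prob_space T" and I: "finite I"
    and u: "\<And>a b. a \<in> I \<Longrightarrow> b \<in> I \<Longrightarrow> integrable S (\<lambda>s. u a s * u b s)"
      "\<And>a b. a \<in> I \<Longrightarrow> b \<in> I \<Longrightarrow> (\<integral>s. u a s * u b s \<partial>S) = (if a = b then c a else 0)"
    and v: "\<And>a. a \<in> I \<Longrightarrow> v a \<in> borel_measurable T" "\<And>a. a \<in> I \<Longrightarrow> integrable T (\<lambda>t. (v a t)\<^sup>2)"
    and f: "\<And>t s. f t s = (\<Sum>a\<in>I. u a s * v a t)"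
    and g: "\<And>s. g s = (\<Sum>a\<in>I. u a s * h a)"
  shows "sq_bias T S f g = (\<Sum>a\<in>I. c a * ((\<integral>t. v a t \<partial>T) - h a)\<^sup>2)"
    and "pred_var T S f = (\<Sum>a\<in>I. c a * ((\<integral>t. (v a t)\<^sup>2 \<partial>T) - (\<integral>t. v a t \<partial>T)\<^sup>2))"
proof -
  interpret T: prob_space T by fact
  have vi: "integrable T (v a)" if "a \<in> I" for a
    using T.square_integrable_imp_integrable[OF v[OF that]] .
  define m where "m a = (\<integral>t. v a t \<partial>T)" for a
  have mean: "(\<integral>t. f t s \<partial>T) = (\<Sum>a\<in>I. u a s * m a)" for s
    unfolding f m_def using vi by simp
  have sq: "(\<Sum>a\<in>I. u a s * k a)\<^sup>2 = (\<Sum>a\<in>I. \<Sum>b\<in>I. k a * k b * (u a s * u b s))" for s k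
    by (simp add: power2_eq_square sum_product ac_simps)
  have diag: "(\<Sum>a\<in>I. \<Sum>b\<in>I. K a b * (\<integral>s. u a s * u b s \<partial>S)) = (\<Sum>a\<in>I. c a * K a a)" for K
  proof (rule sum.cong[OF refl])
    fix a assume a: "a \<in> I"
    have "(\<Sum>b\<in>I. K a b * (\<integral>s. u a s * u b s \<partial>S)) = (\<Sum>b\<in>I. if a = b then c a * K a a else 0)"
      using a by (intro sum.cong refl) (auto simp: u(2))
    then show "(\<Sum>b\<in>I. K a b * (\<integral>s. u a s * u b s \<partial>S)) = c a * K a a" using I a by simp
  qed
  \<comment> \<open>Integration over the test data removes all off-diagonal terms, so mixed moments
    of different \<open>v a\<close> never have to be evaluated.\<close>
  have int: "(\<integral>s. (\<Sum>a\<in>I. \<Sum>b\<in>I. K a b * (u a s * u b s)) \<partial>S) = (\<Sum>a\<in>I. c a * K a a)" for K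
  proof -
    have "has_bochner_integral S (\<lambda>s. \<Sum>a\<in>I. \<Sum>b\<in>I. K a b * (u a s * u b s))
      (\<Sum>a\<in>I. \<Sum>b\<in>I. K a b * (\<integral>s. u a s * u b s \<partial>S))"
      by (intro has_bochner_integral_sum has_bochner_integral_mult_right has_bochner_integral_integrable u)
    from has_bochner_integral_integral_eq[OF this] show ?thesis unfolding diag .
  qed
  have "sq_bias T S f g = (\<integral>s. (\<Sum>a\<in>I. u a s * (m a - h a))\<^sup>2 \<partial>S)"
    unfolding sq_bias_def mean g by (simp add: right_diff_distrib sum_subtractf)
  also have "\<dots> = (\<Sum>a\<in>I. c a * ((m a - h a) * (m a - h a)))"
    unfolding sq by (rule int)
  finally show "sq_bias T S f g = (\<Sum>a\<in>I. c a * ((\<integral>t. v a t \<partial>T) - h a)\<^sup>2)"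
    by (simp add: m_def power2_eq_square)
  have vv: "integrable T (\<lambda>t. (v a t - m a) * (v b t - m b))" if "a \<in> I" "b \<in> I" for a b
  proof -
    have "(\<lambda>t. (v a t - m a) * (v b t - m b)) = (\<lambda>t. v a t * v b t - m b * v a t - m a * v b t + m a * m b)"
      by (simp add: algebra_simps)
    then show ?thesis
      using that by (simp add: vi integrable_product_of_squares v)
  qed
  have "(\<integral>t. (f t s - (\<integral>t'. f t' s \<partial>T))\<^sup>2 \<partial>T) =
      (\<Sum>a\<in>I. \<Sum>b\<in>I. (\<integral>t. (v a t - m a) * (v b t - m b) \<partial>T) * (u a s * u b s))" for s
  proof -
    have "has_bochner_integral T (\<lambda>t. \<Sum>a\<in>I. \<Sum>b\<in>I. (v a t - m a) * (v b t - m b) * (u a s * u b s))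
      (\<Sum>a\<in>I. \<Sum>b\<in>I. (\<integral>t. (v a t - m a) * (v b t - m b) \<partial>T) * (u a s * u b s))"
      by (intro has_bochner_integral_sum has_bochner_integral_mult_left has_bochner_integral_integrable vv)
    moreover have "(f t s - (\<integral>t'. f t' s \<partial>T))\<^sup>2 =
        (\<Sum>a\<in>I. \<Sum>b\<in>I. (v a t - m a) * (v b t - m b) * (u a s * u b s))" for t
      unfolding mean unfolding f sq[symmetric] by (simp add: right_diff_distrib sum_subtractf)
    ultimately show ?thesis by (simp add: has_bochner_integral_integral_eq)
  qed
  then have "pred_var T S f = (\<Sum>a\<in>I. c a * (\<integral>t. (v a t - m a) * (v a t - m a) \<partial>T))"
    unfolding pred_var_def by (simp only: int)
  also have "\<dots> = (\<Sum>a\<in>I. c a * ((\<integral>t. (v a t)\<^sup>2 \<partial>T) - (m a)\<^sup>2))"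
    using T.variance_eq[OF vi v(2)] by (intro sum.cong refl) (simp add: m_def power2_eq_square)
  finally show "pred_var T S f = (\<Sum>a\<in>I. c a * ((\<integral>t. (v a t)\<^sup>2 \<partial>T) - (\<integral>t. v a t \<partial>T)\<^sup>2))"
    by (simp add: m_def)
qed

section \<open>The predictor as a linear function of signal and noise\<close>

lemma inner_colv_colv:
  assumes "dims d m B"
  shows "inner (colv d f) (B * colv m g) = (\<Sum>j<d. \<Sum>k<m. ent B j k * (f j * g k))"
  unfolding inner_fmat_eq[OF dims_colv] ent_times[OF assms]
  by (simp add: colv.rep_eq sum_distrib_left ac_simps)

text \<open>The coefficient matrix of \<open>\<theta>\<close> in the prediction;
  \<open>rp_noise\<close> is the one of the training noise.\<close>

definition rp_signal ::
  "real \<Rightarrow> nat \<Rightarrow> nat \<Rightarrow> nat \<Rightarrow> (nat \<times> nat \<Rightarrow> real) \<Rightarrow> (nat \<times> nat \<Rightarrow> real) \<Rightarrow> fmat" where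
  "rp_signal l n p d X W = rp_resolvent l n p d X W * gram n d X"

definition rp_noise ::
  "real \<Rightarrow> nat \<Rightarrow> nat \<Rightarrow> nat \<Rightarrow> (nat \<times> nat \<Rightarrow> real) \<Rightarrow> (nat \<times> nat \<Rightarrow> real) \<Rightarrow> fmat" where
  "rp_noise l n p d X W = (1 / real n) *\<^sub>R (rp_resolvent l n p d X W * tp (rmat n d X))"

lemma dims_rp_signal: "0 < l \<Longrightarrow> dims d d (rp_signal l n p d X W)"
  unfolding rp_signal_def using dims_rp_resolvent by blast

lemma dims_rp_noise: "0 < l \<Longrightarrow> dims d n (rp_noise l n p d X W)"
  unfolding rp_noise_def using dims_rp_resolvent by blast

lemma ofv_vec: "ofv (Matrix.vec d f) = colv d f"
  by (rule fmat_eqI) (simp add: ofv_def colv.rep_eq)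

lemma rp_fhat_eq:
  assumes l: "0 < l"
  shows "rp_fhat l n p d (X, E, W) (\<theta>, x) =
    inner (colv d x) (rp_signal l n p d X W * colv d \<theta>) + inner (colv d x) (rp_noise l n p d X W * colv n E)"
proof -
  let ?W = "mat p d W" and ?X = "mat n d X" and ?G = "inv_mat (inner_mat l n p d X W)"
  let ?\<theta> = "Matrix.vec d \<theta>" and ?E = "Matrix.vec n E"
  have G: "?G \<in> carrier_mat p p"
    by (rule inv_mat_adj(4)[OF inner_mat_carrier det_inner_mat[OF l]])
  have c: "?\<theta> \<in> carrier_vec d" "?E \<in> carrier_vec n" "?X \<in> carrier_mat n d" "?W\<^sup>T \<in> carrier_mat d p"
    "?W * ?X\<^sup>T \<in> carrier_mat p n" "?W \<in> carrier_mat p d" "?X\<^sup>T \<in> carrier_mat d n"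
    "Matrix.vec d x \<in> carrier_vec d"
    by auto
  have c': "?X *\<^sub>v ?\<theta> \<in> carrier_vec n" by (rule mult_mat_vec_carrier[OF c(3,1)])
  have c'': "?X *\<^sub>v ?\<theta> + ?E \<in> carrier_vec n" by (rule add_carrier_vec[OF c' c(2)])
  let ?y = "(1 / real n) \<cdot>\<^sub>v ((?W * ?X\<^sup>T) *\<^sub>v (?X *\<^sub>v ?\<theta> + ?E))"
  have y: "?y \<in> carrier_vec p" using mult_mat_vec_carrier[OF c(5) c''] by simp
  have Gy: "?G *\<^sub>v ?y \<in> carrier_vec p" by (rule mult_mat_vec_carrier[OF G y])
  have WGy: "?W\<^sup>T *\<^sub>v (?G *\<^sub>v ?y) \<in> carrier_vec d" by (rule mult_mat_vec_carrier[OF c(4) Gy])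
  have "rp_fhat l n p d (X, E, W) (\<theta>, x) = scalar_prod (Matrix.vec d x) (?W\<^sup>T *\<^sub>v (?G *\<^sub>v ?y))"
    by (simp add: rp_fhat_def rp_predictor_def Let_def inner_mat_def)
  also have "\<dots> = inner (colv d x) (ofv (?W\<^sup>T *\<^sub>v (?G *\<^sub>v ?y)))"
    by (simp add: scalar_prod_ofv[OF c(8) WGy] ofv_vec)
  also have "ofv (?W\<^sup>T *\<^sub>v (?G *\<^sub>v ?y)) =
      tp (rmat p d W) * (ofm ?G * ((1 / real n) *\<^sub>R (rmat p d W * tp (rmat n d X) *
        (rmat n d X * colv d \<theta> + colv n E))))"
    unfolding ofv_mult[OF c(4) Gy] ofv_mult[OF G y] ofv_smult ofv_mult[OF c(5) c''] ofv_add[OF c' c(2)]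
      ofv_mult[OF c(3,1)] ofm_mult[OF c(6,7)] ofm_transpose ofv_vec rmat_def ..
  also have "\<dots> = rp_signal l n p d X W * colv d \<theta> + rp_noise l n p d X W * colv n E"
    by (simp add: rp_signal_def rp_noise_def rp_resolvent_def gram_def algebra_simps mult.assoc)
  finally show ?thesis by (simp add: inner_add_right)
qed

lemma AE_pair_snd:
  assumes "prob_space A" "prob_space B" "AE y in B. Q y"
  shows "AE z in A \<Otimes>\<^sub>M B. Q (snd z)"
proof -
  interpret B: prob_space B by fact
  obtain N where N: "N \<in> null_sets B" "{y \<in> space B. \<not> Q y} \<subseteq> N"
    using assms(3) by (auto simp: eventually_ae_filter)
  then have "space A \<times> N \<in> null_sets (A \<Otimes>\<^sub>M B)"
    by (intro B.times_in_null_sets2) auto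
  then show ?thesis
    by (rule AE_I') (use N(2) in \<open>auto simp: space_pair_measure\<close>)
qed

locale rp_model = entry_moments +
  fixes \<nu> :: "(nat \<times> nat \<Rightarrow> real) measure" and n p d :: nat and l \<alpha> \<sigma> :: real
  assumes n: "0 < n" and d: "0 < d" and l: "0 < l" and prob_\<nu>: "prob_space \<nu>"
    and sets_\<nu>: "sets \<nu> = sets (\<Pi>\<^sub>M ij\<in>{..<p} \<times> {..<d}. borel)"
    and AE_\<nu>: "AE W in \<nu>. rmat p d W * tp (rmat p d W) = idm p"
begin

text \<open>The joint law of \<open>(X, W)\<close> without the noise, over which all coefficient
  matrices are defined.\<close>

definition "U = iid_mat n d \<mu> \<Otimes>\<^sub>M \<nu>"

definition "T = rp_train_law \<mu> \<nu> \<sigma> n d"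

abbreviation "res \<equiv> \<lambda>w. rp_resolvent l n p d (fst w) (snd w)"
abbreviation "sig \<equiv> \<lambda>w. rp_signal l n p d (fst w) (snd w)"
abbreviation "noi \<equiv> \<lambda>w. rp_noise l n p d (fst w) (snd w)"
abbreviation "g \<equiv> \<lambda>w. gram n d (fst w)"
abbreviation "tr \<equiv> \<lambda>w. res_trace l n p d (fst w) (snd w)"
abbreviation "nrm \<equiv> \<lambda>w. res_norm l n p d (fst w) (snd w)"
abbreviation "cross \<equiv> \<lambda>w. res_cross l n p d (fst w) (snd w)"

lemma prob_U: "prob_space U"
  unfolding U_def by (intro prob_space_pair prob_iid prob_\<nu>)

lemma prob_noise: "prob_space (iid_vec n (normal_law 0 \<sigma>))"
  unfolding iid_vec_def using normal_law_moments(1)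
  by (intro prob_space_PiM) (auto simp: real_distribution_def)

lemma prob_T: "prob_space T"
  unfolding T_def rp_train_law_def by (intro prob_space_pair prob_iid prob_\<nu> prob_noise)

lemma AE_U: "AE w in U. fixed_projection \<mu> m4 n p d l (snd w)"
  unfolding U_def
proof (rule AE_pair_snd[OF prob_iid prob_\<nu>])
  show "AE W in \<nu>. fixed_projection \<mu> m4 n p d l W"
    using AE_\<nu>
  proof eventually_elim
    case (elim W)
    then show ?case by unfold_locales (use n l in auto)
  qed
qed

lemma meas_X: "i < n \<Longrightarrow> j < d \<Longrightarrow> (\<lambda>w. fst w (i, j)) \<in> borel_measurable U"
  unfolding U_def by (rule measurable_compose[OF measurable_fst measurable_entry])

lemma meas_W: "i < p \<Longrightarrow> j < d \<Longrightarrow> (\<lambda>w. snd w (i, j)) \<in> borel_measurable U"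
  unfolding U_def
  by (rule measurable_compose[OF measurable_snd])
    (auto simp: measurable_cong_sets[OF sets_\<nu> refl] intro!: measurable_component_singleton)

lemma mmeas_res: "mmeas U res"
  by (intro mmeas_rp_resolvent l meas_X meas_W)

lemma mmeas_g: "mmeas U g"
  by (intro mmeas_gram meas_X)

lemma mmeas_sig: "mmeas U sig"
  unfolding rp_signal_def by (intro mmeas_times[of _ _ _ d d] mmeas_res mmeas_g dims_rp_resolvent l)

lemma mmeas_noi: "mmeas U noi"
  unfolding rp_noise_def
  by (intro mmeas_scaleR mmeas_times[of _ _ _ d d] mmeas_res mmeas_tp mmeas_rmat meas_X dims_rp_resolvent l)

lemma mmeas_proj: "mmeas U (\<lambda>w. proj_of p d (snd w))"
  unfolding proj_of_def by (intro mmeas_times[of _ _ _ d p] mmeas_tp mmeas_rmat meas_W) blast+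

lemma measurable_tr: "tr \<in> borel_measurable U"
  unfolding res_trace_def
  by (intro borel_measurable_divide borel_measurable_const mmeas_inner[of _ _ _ d d] mmeas_proj mmeas_res dims_proj_of)

lemma measurable_nrm: "nrm \<in> borel_measurable U"
  unfolding res_norm_def
  by (intro borel_measurable_divide borel_measurable_power borel_measurable_const mmeas_norm[of _ _ d d] mmeas_res
      dims_rp_resolvent l)

lemma measurable_cross: "cross \<in> borel_measurable U"
  unfolding res_cross_def
  by (intro borel_measurable_divide borel_measurable_power borel_measurable_const mmeas_norm[of _ _ d d]
      mmeas_times[of _ _ _ d d] mmeas_diff mmeas_const mmeas_proj mmeas_g mmeas_res)
    (use dims_rp_resolvent[OF l] in blast)+

lemma integrable_norm_g: "integrable U (\<lambda>w. (norm (g w))\<^sup>2)"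
proof -
  interpret \<nu>: prob_space \<nu> by (rule prob_\<nu>)
  have "integrable (iid_mat n d \<mu> \<Otimes>\<^sub>M \<nu>) (\<lambda>w. (norm (gram n d (fst w)))\<^sup>2 * 1)"
    by (rule pair_integral_product(1)[OF prob_iid prob_\<nu> expectation_norm_gram(1)[OF n]]) simp
  then show ?thesis by (simp add: U_def)
qed

lemma integrable_tr: "integrable U tr"
proof -
  interpret U: prob_space U by (rule prob_U)
  show ?thesis
  proof (rule U.integrable_const_bound[OF _ measurable_tr])
    show "AE w in U. norm (tr w) \<le> real p / l / n"
      using AE_U
    proof eventually_elim
      case (elim w)
      then interpret fixed_projection \<mu> m4 n p d l "snd w" .
      have "inner P (R (fst w)) \<le> real p / l"
        using resolv_trace_le[OF P psd_gram l R] by (simp add: PP)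
      from divide_right_mono[OF this, of n] show ?case
        using resolv_trace_nonneg[OF P psd_gram l R, of "fst w"] by (simp add: res_trace_def)
    qed
  qed
qed

lemma integrable_nrm: "integrable U nrm"
proof -
  interpret U: prob_space U by (rule prob_U)
  show ?thesis
  proof (rule U.integrable_const_bound[OF _ measurable_nrm])
    show "AE w in U. norm (nrm w) \<le> d / (n * l\<^sup>2)"
      using AE_U
    proof eventually_elim
      case (elim w)
      then interpret fixed_projection \<mu> m4 n p d l "snd w" .
      show ?case using res_norm_le[of "fst w"] by (simp add: res_norm_def)
    qed
  qed
qed

lemma integrable_cross: "integrable U cross"
proof (rule Bochner_Integration.integrable_bound)
  show "integrable U (\<lambda>w. (norm (g w))\<^sup>2 / l\<^sup>2 / n)" using integrable_norm_g by simp
  show "AE w in U. norm (cross w) \<le> norm ((norm (g w))\<^sup>2 / l\<^sup>2 / n)"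
    using AE_U
  proof eventually_elim
    case (elim w)
    then interpret fixed_projection \<mu> m4 n p d l "snd w" .
    have "(norm (D * S (fst w) * R (fst w)))\<^sup>2 \<le> (norm (S (fst w)))\<^sup>2 / l\<^sup>2"
      using order.trans[OF norm_AR[of "D * S (fst w)" "fst w"] divide_right_mono[OF norm_DA[of "S (fst w)"]]] by simp
    from divide_right_mono[OF this, of n] show ?case by (simp add: res_cross_def)
  qed
qed (rule measurable_cross)

lemma norm_sig: "AE w in U. (norm (sig w - idm d))\<^sup>2 = n * (l\<^sup>2 * nrm w + cross w) + (real d - real p)"
  using AE_U
proof eventually_elim
  case (elim w)
  then interpret fixed_projection \<mu> m4 n p d l "snd w" .
  show ?case
    using norm_minus_idm[OF P psd_gram l R dims_proj_of dims_gram dims_R, of "fst w"] n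
    by (simp add: rp_signal_def res_norm_def res_cross_def power2_norm_eq_inner[of P] PP distrib_left)
qed

lemma norm_noi: "AE w in U. (norm (noi w))\<^sup>2 = tr w - l * nrm w"
  using AE_U
proof eventually_elim
  case (elim w)
  then interpret fixed_projection \<mu> m4 n p d l "snd w" .
  let ?R = "R (fst w)" and ?X = "rmat n d (fst w)"
  have "inner (?R * tp ?X) (?R * tp ?X) = inner (tp ?X * ?X) (?R * ?R)"
    using inner_times_left[of ?R "tp ?X" "?R * tp ?X"] inner_times_right[of "tp ?X" ?X "?R * ?R"]
    by (simp add: R_facts mult.assoc)
  then have "(norm (noi w))\<^sup>2 = inner (S (fst w)) (?R * ?R) / n"
    unfolding rp_noise_def power2_norm_eq_inner by (simp add: gram_def)
  then show ?case
    using resolv_trace2[OF P psd_gram l R, of "fst w"]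
    by (simp add: res_trace_def res_norm_def diff_divide_distrib[symmetric])
qed

lemma integrable_norm_sig: "integrable U (\<lambda>w. (norm (sig w - idm d))\<^sup>2)"
  "(\<integral>w. (norm (sig w - idm d))\<^sup>2 \<partial>U) = n * (l\<^sup>2 * (\<integral>w. nrm w \<partial>U) + (\<integral>w. cross w \<partial>U)) + (real d - real p)"
proof -
  interpret U: prob_space U by (rule prob_U)
  have m: "(\<lambda>w. (norm (sig w - idm d))\<^sup>2) \<in> borel_measurable U"
    by (intro borel_measurable_power mmeas_norm[of _ _ d d] mmeas_diff mmeas_sig mmeas_const)
      (use dims_rp_signal[OF l] in blast)
  have i: "integrable U (\<lambda>w. n * (l\<^sup>2 * nrm w + cross w) + (real d - real p))"
    using integrable_nrm integrable_cross by simp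
  show "integrable U (\<lambda>w. (norm (sig w - idm d))\<^sup>2)"
    using i norm_sig m by (subst integrable_cong_AE[of _ _ "\<lambda>w. n * (l\<^sup>2 * nrm w + cross w) + (real d - real p)"]) auto
  have "(\<integral>w. (norm (sig w - idm d))\<^sup>2 \<partial>U) = (\<integral>w. n * (l\<^sup>2 * nrm w + cross w) + (real d - real p) \<partial>U)"
    using i norm_sig m by (intro integral_cong_AE) auto
  also have "\<dots> = n * (l\<^sup>2 * (\<integral>w. nrm w \<partial>U) + (\<integral>w. cross w \<partial>U)) + (real d - real p)"
    using integrable_nrm integrable_cross by (simp add: U.prob_space)
  finally show "(\<integral>w. (norm (sig w - idm d))\<^sup>2 \<partial>U) =
    n * (l\<^sup>2 * (\<integral>w. nrm w \<partial>U) + (\<integral>w. cross w \<partial>U)) + (real d - real p)" .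
qed

lemma integrable_norm_noi: "integrable U (\<lambda>w. (norm (noi w))\<^sup>2)"
  "(\<integral>w. (norm (noi w))\<^sup>2 \<partial>U) = (\<integral>w. tr w \<partial>U) - l * (\<integral>w. nrm w \<partial>U)"
proof -
  have m: "(\<lambda>w. (norm (noi w))\<^sup>2) \<in> borel_measurable U"
    by (intro borel_measurable_power mmeas_norm[of _ _ d n] mmeas_noi dims_rp_noise l)
  have i: "integrable U (\<lambda>w. tr w - l * nrm w)"
    using integrable_nrm integrable_tr by simp
  show "integrable U (\<lambda>w. (norm (noi w))\<^sup>2)"
    using i norm_noi m by (subst integrable_cong_AE[of _ _ "\<lambda>w. tr w - l * nrm w"]) auto
  have "(\<integral>w. (norm (noi w))\<^sup>2 \<partial>U) = (\<integral>w. tr w - l * nrm w \<partial>U)"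
    using i norm_noi m by (intro integral_cong_AE) auto
  then show "(\<integral>w. (norm (noi w))\<^sup>2 \<partial>U) = (\<integral>w. tr w \<partial>U) - l * (\<integral>w. nrm w \<partial>U)"
    using integrable_nrm integrable_tr by simp
qed

lemma ent_square_le: "(ent A j k)\<^sup>2 \<le> (norm A)\<^sup>2" if "dims m m' A" for A
proof (cases "j < m \<and> k < m'")
  case True
  have "(ent A j k)\<^sup>2 \<le> (\<Sum>k<m'. (ent A j k)\<^sup>2)"
    using True by (intro member_le_sum) auto
  also have "\<dots> \<le> (\<Sum>j<m. \<Sum>k<m'. (ent A j k)\<^sup>2)"
    using True by (intro member_le_sum[of j "{..<m}" "\<lambda>j. \<Sum>k<m'. (ent A j k)\<^sup>2"]) (auto intro: sum_nonneg)
  finally show ?thesis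
    unfolding power2_norm_eq_inner inner_fmat_eq[OF that] by (simp add: power2_eq_square)
next
  case False
  then show ?thesis using ent_eq_0[OF that False] by simp
qed

lemma ent_meas: "mmeas U A \<Longrightarrow> (\<lambda>w. ent (A w) j k) \<in> borel_measurable U"
  by (simp add: mmeas_def)

lemma integrable_sig2: "integrable U (\<lambda>w. (ent (sig w) j k - of_bool (j = k \<and> k < d))\<^sup>2)"
proof (rule Bochner_Integration.integrable_bound[OF integrable_norm_sig(1)])
  show "(\<lambda>w. (ent (sig w) j k - of_bool (j = k \<and> k < d))\<^sup>2) \<in> borel_measurable U"
    using ent_meas[OF mmeas_sig] by simp
  have "ent (idm d) j k = of_bool (j = k \<and> k < d)" by (simp add: ent_idm)
  moreover have "dims d d (sig w - idm d)" for w using dims_rp_signal[OF l] by blast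
  ultimately show "AE w in U. norm ((ent (sig w) j k - of_bool (j = k \<and> k < d))\<^sup>2) \<le> norm ((norm (sig w - idm d))\<^sup>2)"
    using ent_square_le[of d d "sig w - idm d" j k for w] by simp
qed

lemma integrable_sig: "integrable U (\<lambda>w. ent (sig w) j k)" "integrable U (\<lambda>w. (ent (sig w) j k)\<^sup>2)"
proof -
  interpret U: prob_space U by (rule prob_U)
  let ?b = "of_bool (j = k \<and> k < d) :: real"
  have "integrable U (\<lambda>w. ent (sig w) j k - ?b)"
    by (rule U.square_integrable_imp_integrable[OF _ integrable_sig2]) (use ent_meas[OF mmeas_sig] in simp)
  from Bochner_Integration.integrable_add[OF this U.integrable_const[of ?b]]
  show *: "integrable U (\<lambda>w. ent (sig w) j k)" by simp
  have "integrable U (\<lambda>w. (ent (sig w) j k - ?b)\<^sup>2 + (2 * ?b * ent (sig w) j k - ?b * ?b))"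
    using * integrable_sig2 by (intro Bochner_Integration.integrable_add) auto
  moreover have "(\<lambda>w. (ent (sig w) j k - ?b)\<^sup>2 + (2 * ?b * ent (sig w) j k - ?b * ?b)) = (\<lambda>w. (ent (sig w) j k)\<^sup>2)"
    by (rule ext) (simp add: power2_eq_square algebra_simps)
  ultimately show "integrable U (\<lambda>w. (ent (sig w) j k)\<^sup>2)" by simp
qed

lemma integrable_noi: "integrable U (\<lambda>w. ent (noi w) j i)" "integrable U (\<lambda>w. ent (noi w) j i * ent (noi w) j i')"
proof -
  interpret U: prob_space U by (rule prob_U)
  have sq: "integrable U (\<lambda>w. (ent (noi w) j i)\<^sup>2)" for i
  proof (rule Bochner_Integration.integrable_bound[OF integrable_norm_noi(1)])
    show "AE w in U. norm ((ent (noi w) j i)\<^sup>2) \<le> norm ((norm (noi w))\<^sup>2)"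
      using ent_square_le[OF dims_rp_noise[OF l]] by simp
  qed (use ent_meas[OF mmeas_noi] in simp)
  show "integrable U (\<lambda>w. ent (noi w) j i)"
    by (rule U.square_integrable_imp_integrable[OF ent_meas[OF mmeas_noi] sq])
  show "integrable U (\<lambda>w. ent (noi w) j i * ent (noi w) j i')"
    by (intro integrable_product_of_squares ent_meas mmeas_noi sq)
qed

lemma train_integral:
  fixes f :: "_ \<Rightarrow> real" and h :: "_ \<Rightarrow> real"
  assumes f: "integrable (iid_vec n (normal_law 0 \<sigma>)) f" and h: "integrable U h"
  shows "integrable T (\<lambda>(X, E, W). f E * h (X, W))"
    and "(\<integral>(X, E, W). f E * h (X, W) \<partial>T) = (\<integral>E. f E \<partial>iid_vec n (normal_law 0 \<sigma>)) * (\<integral>w. h w \<partial>U)"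
proof -
  note * = pair_integral_product[OF prob_noise prob_U f h]
  note t = triple_integral[OF prob_iid prob_noise prob_\<nu>, of n d, folded U_def, OF *(1)]
  show "integrable T (\<lambda>(X, E, W). f E * h (X, W))"
    using t(1) by (simp add: T_def rp_train_law_def)
  show "(\<integral>(X, E, W). f E * h (X, W) \<partial>T) = (\<integral>E. f E \<partial>iid_vec n (normal_law 0 \<sigma>)) * (\<integral>w. h w \<partial>U)"
    using t(2) *(2) by (simp add: T_def rp_train_law_def)
qed

text \<open>One index set serves both parts of the predictor: \<open>(j, k)\<close> with
  \<open>k < d\<close> belongs to the signal coordinate \<open>k\<close>, and the extra column
  \<open>k = d\<close> is reserved for the noise, whose test factor contains no
  \<open>\<theta>\<close>.\<close>

definition "test_fun a = (\<lambda>(\<theta>, x). (x (fst a) :: real) * (if snd a < d then \<theta> (snd a) else 1))"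

definition "train_fun a = (\<lambda>(X, E, W). if snd a < d then ent (sig (X, W)) (fst a) (snd a)
   else (\<Sum>i<n. E i * ent (noi (X, W)) (fst a) i))"

abbreviation "idx \<equiv> {..<d} \<times> {..<Suc d}"

lemma test_fun_orthogonal:
  assumes a: "a \<in> idx" and b: "b \<in> idx"
  shows "integrable (signal_test_law \<mu> \<alpha> d) (\<lambda>s. test_fun a s * test_fun b s)"
    and "(\<integral>s. test_fun a s * test_fun b s \<partial>signal_test_law \<mu> \<alpha> d) =
      (if a = b then (if snd a < d then \<alpha>\<^sup>2 / d else 1) else 0)"
proof -
  obtain j k j' k' where ab: "a = (j, k)" "b = (j', k')" by fastforce
  have lt: "j < d" "k < Suc d" "j' < d" "k' < Suc d" using a b ab by auto
  define s where "s = \<alpha> / sqrt (real d)"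
  let ?N = "iid_vec d (normal_law 0 s)" and ?V = "iid_vec d \<mu>"
  interpret N: prob_space ?N
    unfolding iid_vec_def using normal_law_moments(1)
    by (intro prob_space_PiM) (auto simp: real_distribution_def)
  have pV: "prob_space ?V" unfolding iid_vec_def by (rule prob_PiM)
  let ?f = "\<lambda>\<theta>. (if k < d then \<theta> k else 1) * (if k' < d then \<theta> k' else (1::real))"
  have s2: "s\<^sup>2 = \<alpha>\<^sup>2 / d" using d by (simp add: s_def power_divide)
  note N2 = iid_second_moment[OF normal_law_moments(1,2,3,4)[of s] finite_lessThan]
  note N1 = iid_first_moment[OF normal_law_moments(1,2,3,4)[of s] finite_lessThan]
  have f: "integrable ?N ?f"
    "(\<integral>\<theta>. ?f \<theta> \<partial>?N) = (if k = k' then (if k < d then \<alpha>\<^sup>2 / d else 1) else 0)"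
  proof (atomize (full), goal_cases)
    case 1
    consider "k < d" "k' < d" | "k < d" "k' = d" | "k = d" "k' < d" | "k = d" "k' = d"
      using lt by linarith
    then show ?case
    proof cases
      case 1
      with N2[of k d k'] show ?thesis by (simp add: iid_vec_def s2)
    next
      case 2
      with N1[of k d k] show ?thesis by (simp add: iid_vec_def)
    next
      case 3
      with N1[of k' d k'] show ?thesis by (simp add: iid_vec_def)
    qed (simp add: N.prob_space)
  qed
  have x: "integrable ?V (\<lambda>x. x j * x j')" "(\<integral>x. x j * x j' \<partial>?V) = of_bool (j = j')"
    using moment2[of "{..<d}" j j'] lt by (auto simp: iid_vec_def)
  have eq: "(\<lambda>s. test_fun a s * test_fun b s) = (\<lambda>s. ?f (fst s) * (snd s j * snd s j'))"
    by (auto simp: test_fun_def ab)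
  note * = pair_integral_product[OF N.prob_space_axioms pV f(1) x(1)]
  show "integrable (signal_test_law \<mu> \<alpha> d) (\<lambda>s. test_fun a s * test_fun b s)"
    unfolding eq signal_test_law_def using *(1) by (simp add: s_def)
  show "(\<integral>s. test_fun a s * test_fun b s \<partial>signal_test_law \<mu> \<alpha> d) =
      (if a = b then (if snd a < d then \<alpha>\<^sup>2 / d else 1) else 0)"
    unfolding eq signal_test_law_def using *(2) f(2) x(2) by (simp add: s_def ab)
qed

lemma train_fun_signal:
  assumes "k < d"
  shows "integrable T (train_fun (j, k))" "integrable T (\<lambda>t. (train_fun (j, k) t)\<^sup>2)"
    "(\<integral>t. train_fun (j, k) t \<partial>T) = (\<integral>w. ent (sig w) j k \<partial>U)"
    "(\<integral>t. (train_fun (j, k) t)\<^sup>2 \<partial>T) = (\<integral>w. (ent (sig w) j k)\<^sup>2 \<partial>U)"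
proof -
  interpret N: prob_space "iid_vec n (normal_law 0 \<sigma>)" by (rule prob_noise)
  have eq: "train_fun (j, k) = (\<lambda>(X, E, W). 1 * ent (sig (X, W)) j k)"
    "(\<lambda>t. (train_fun (j, k) t)\<^sup>2) = (\<lambda>(X, E, W). 1 * (ent (sig (X, W)) j k)\<^sup>2)"
    using assms by (auto simp: train_fun_def)
  have one: "integrable (iid_vec n (normal_law 0 \<sigma>)) (\<lambda>_. 1 :: real)" by simp
  note * = train_integral[OF one integrable_sig(1)[of j k]] train_integral[OF one integrable_sig(2)[of j k]]
  show "integrable T (train_fun (j, k))" "integrable T (\<lambda>t. (train_fun (j, k) t)\<^sup>2)"
    subgoal unfolding eq(1) using *(1) by simp
    subgoal unfolding eq(2) using *(3) by simp
    done
  show "(\<integral>t. train_fun (j, k) t \<partial>T) = (\<integral>w. ent (sig w) j k \<partial>U)"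
    "(\<integral>t. (train_fun (j, k) t)\<^sup>2 \<partial>T) = (\<integral>w. (ent (sig w) j k)\<^sup>2 \<partial>U)"
    subgoal unfolding eq(1) using *(2) by (simp add: N.prob_space)
    subgoal unfolding eq(2) using *(4) by (simp add: N.prob_space)
    done
qed

lemma train_fun_noise:
  shows "integrable T (train_fun (j, d))" "integrable T (\<lambda>t. (train_fun (j, d) t)\<^sup>2)"
    "(\<integral>t. train_fun (j, d) t \<partial>T) = 0"
    "(\<integral>t. (train_fun (j, d) t)\<^sup>2 \<partial>T) = \<sigma>\<^sup>2 * (\<Sum>i<n. \<integral>w. (ent (noi w) j i)\<^sup>2 \<partial>U)"
proof -
  let ?N = "iid_vec n (normal_law 0 \<sigma>)"
  note N2 = iid_second_moment[OF normal_law_moments(1,2,3,4)[of \<sigma>] finite_lessThan, folded iid_vec_def]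
  note N1 = iid_first_moment[OF normal_law_moments(1,2,3,4)[of \<sigma>] finite_lessThan, folded iid_vec_def]
  have eq: "train_fun (j, d) = (\<lambda>t. \<Sum>i<n. (case t of (X, E, W) \<Rightarrow> E i * ent (noi (X, W)) j i))"
    by (auto simp: train_fun_def)
  have eq2: "(\<lambda>t. (train_fun (j, d) t)\<^sup>2) = (\<lambda>t. \<Sum>i<n. \<Sum>i'<n.
     (case t of (X, E, W) \<Rightarrow> E i * E i' * (ent (noi (X, W)) j i * ent (noi (X, W)) j i')))"
    by (auto simp: train_fun_def power2_eq_square sum_product ac_simps)
  have t1: "has_bochner_integral T (\<lambda>(X, E, W). E i * ent (noi (X, W)) j i) 0" if "i < n" for i
    using train_integral[OF N1(1)[of i n i] integrable_noi(1)[of j i]] N1(2)[of i n i] that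
    by (simp add: has_bochner_integral_iff)
  have t2: "has_bochner_integral T (\<lambda>(X, E, W). E i * E i' * (ent (noi (X, W)) j i * ent (noi (X, W)) j i'))
      (if i = i' then \<sigma>\<^sup>2 * (\<integral>w. (ent (noi w) j i)\<^sup>2 \<partial>U) else 0)" if "i < n" "i' < n" for i i'
    using train_integral[OF N2(1)[of i n i'] integrable_noi(2)[of j i i']] N2(2)[of i n i'] that
    by (simp add: has_bochner_integral_iff power2_eq_square)
  have "has_bochner_integral T (train_fun (j, d)) (\<Sum>i<n. 0)"
    unfolding eq using t1 by (intro has_bochner_integral_sum) auto
  then show "integrable T (train_fun (j, d))" "(\<integral>t. train_fun (j, d) t \<partial>T) = 0"
    by (simp_all add: has_bochner_integral_iff)
  have "has_bochner_integral T (\<lambda>t. (train_fun (j, d) t)\<^sup>2)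
     (\<Sum>i<n. \<Sum>i'<n. if i = i' then \<sigma>\<^sup>2 * (\<integral>w. (ent (noi w) j i)\<^sup>2 \<partial>U) else 0)"
    unfolding eq2 using t2 by (intro has_bochner_integral_sum) auto
  then show "integrable T (\<lambda>t. (train_fun (j, d) t)\<^sup>2)"
    "(\<integral>t. (train_fun (j, d) t)\<^sup>2 \<partial>T) = \<sigma>\<^sup>2 * (\<Sum>i<n. \<integral>w. (ent (noi w) j i)\<^sup>2 \<partial>U)"
    by (simp_all add: has_bochner_integral_iff sum_distrib_left)
qed

lemma sum_idx: "(\<Sum>a\<in>idx. F a) = (\<Sum>j<d. \<Sum>k<d. F (j, k)) + (\<Sum>j<d. F (j, d))" for F :: "_ \<Rightarrow> real"
proof -
  have "(\<Sum>a\<in>idx. F a) = (\<Sum>j<d. \<Sum>k<Suc d. F (j, k))"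
    by (simp only: sum.cartesian_product case_prod_unfold prod.collapse)
  then show ?thesis by (simp add: sum.distrib)
qed

lemma rp_fhat_expansion: "rp_fhat l n p d t s = (\<Sum>a\<in>idx. test_fun a s * train_fun a t)"
proof -
  obtain X E W \<theta> x where ts: "t = (X, E, W)" "s = (\<theta>, x)" by (metis prod.exhaust)
  show ?thesis
    unfolding ts rp_fhat_eq[OF l] sum_idx inner_colv_colv[OF dims_rp_signal[OF l]]
      inner_colv_colv[OF dims_rp_noise[OF l]]
    by (simp add: test_fun_def train_fun_def sum_distrib_left ac_simps)
qed

lemma test_signal_expansion:
  "test_signal d s = (\<Sum>a\<in>idx. test_fun a s * of_bool (fst a = snd a \<and> snd a < d))"
proof -
  obtain \<theta> x where s: "s = (\<theta>, x)" by fastforce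
  have "(\<Sum>a\<in>idx. test_fun a s * of_bool (fst a = snd a \<and> snd a < d)) = (\<Sum>j<d. \<Sum>k<d. if j = k then x j * \<theta> j else 0) + 0"
    unfolding sum_idx s
    by (intro arg_cong2[of _ _ _ _ "(+)"] sum.cong refl sum.neutral) (auto simp: test_fun_def)
  then show ?thesis
    by (simp add: s test_signal_def scalar_prod_def atLeast0LessThan)
qed

lemmas expansion = orthogonal_expansion[OF prob_T, where I = idx and u = test_fun and v = train_fun
    and S = "signal_test_law \<mu> \<alpha> d" and c = "\<lambda>a. if snd a < d then \<alpha>\<^sup>2 / d else 1"
    and f = "rp_fhat l n p d" and g = "test_signal d"
    and h = "\<lambda>a. of_bool (fst a = snd a \<and> snd a < d)", OF _ test_fun_orthogonal _ _ rp_fhat_expansion test_signal_expansion]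

lemma train_fun_integrable:
  assumes "a \<in> idx"
  shows "train_fun a \<in> borel_measurable T" "integrable T (\<lambda>t. (train_fun a t)\<^sup>2)"
proof -
  obtain j k where a: "a = (j, k)" "k < d \<or> k = d" using assms by fastforce
  then have "integrable T (train_fun a)" "integrable T (\<lambda>t. (train_fun a t)\<^sup>2)"
    using train_fun_signal[of k j] train_fun_noise[of j] by blast+
  then show "train_fun a \<in> borel_measurable T" "integrable T (\<lambda>t. (train_fun a t)\<^sup>2)" by auto
qed

text \<open>The noise coefficients have mean zero and target zero, so only the mean signal matrix
  contributes.\<close>

lemma rp_bias_eq:
  "rp_bias \<mu> \<nu> \<alpha> \<sigma> n p d l =
    \<alpha>\<^sup>2 / d * (\<Sum>j<d. \<Sum>k<d. ((\<integral>w. ent (sig w) j k \<partial>U) - of_bool (j = k))\<^sup>2)"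
  unfolding rp_bias_def T_def[symmetric]
  by (subst expansion(1)) (simp_all add: train_fun_integrable sum_idx train_fun_signal train_fun_noise sum_distrib_left
      cong: conj_cong)

text \<open>Squared mean error and variance of an entry add up to its mean square error. Hence the
  unknown mean matrix cancels, and \<open>norm_sig\<close> and \<open>norm_noi\<close> leave three
  scalar expectations.\<close>

lemma rp_bias_var_eq:
  "rp_bias \<mu> \<nu> \<alpha> \<sigma> n p d l + rp_var \<mu> \<nu> \<alpha> \<sigma> n p d l =
    \<alpha>\<^sup>2 / d * (n * (l\<^sup>2 * (\<integral>w. nrm w \<partial>U) + (\<integral>w. cross w \<partial>U)) + (real d - real p))
    + \<sigma>\<^sup>2 * ((\<integral>w. tr w \<partial>U) - l * (\<integral>w. nrm w \<partial>U))"
proof -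
  interpret U: prob_space U by (rule prob_U)
  let ?m = "\<lambda>j k. \<integral>w. ent (sig w) j k \<partial>U"
  have var: "rp_var \<mu> \<nu> \<alpha> \<sigma> n p d l =
     \<alpha>\<^sup>2 / d * (\<Sum>j<d. \<Sum>k<d. (\<integral>w. (ent (sig w) j k)\<^sup>2 \<partial>U) - (?m j k)\<^sup>2)
     + \<sigma>\<^sup>2 * (\<Sum>j<d. \<Sum>i<n. \<integral>w. (ent (noi w) j i)\<^sup>2 \<partial>U)"
    unfolding rp_var_def T_def[symmetric]
    by (subst expansion(2)) (simp_all add: train_fun_integrable sum_idx train_fun_signal train_fun_noise sum_distrib_left)
  have noise: "(\<Sum>j<d. \<Sum>i<n. \<integral>w. (ent (noi w) j i)\<^sup>2 \<partial>U) = (\<integral>w. (norm (noi w))\<^sup>2 \<partial>U)"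
  proof -
    have "has_bochner_integral U (\<lambda>w. \<Sum>j<d. \<Sum>i<n. (ent (noi w) j i)\<^sup>2) (\<Sum>j<d. \<Sum>i<n. \<integral>w. (ent (noi w) j i)\<^sup>2 \<partial>U)"
      using integrable_noi(2) by (intro has_bochner_integral_sum has_bochner_integral_integrable)
        (simp add: power2_eq_square)
    moreover have "(norm (noi w))\<^sup>2 = (\<Sum>j<d. \<Sum>i<n. (ent (noi w) j i)\<^sup>2)" for w
      unfolding power2_norm_eq_inner inner_fmat_eq[OF dims_rp_noise[OF l]] by (simp add: power2_eq_square)
    ultimately show ?thesis by (simp add: has_bochner_integral_iff)
  qed
  have signal: "(\<Sum>j<d. \<Sum>k<d. \<integral>w. (ent (sig w) j k - of_bool (j = k))\<^sup>2 \<partial>U) = (\<integral>w. (norm (sig w - idm d))\<^sup>2 \<partial>U)"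
  proof -
    have "has_bochner_integral U (\<lambda>w. \<Sum>j<d. \<Sum>k<d. (ent (sig w) j k - of_bool (j = k))\<^sup>2)
       (\<Sum>j<d. \<Sum>k<d. \<integral>w. (ent (sig w) j k - of_bool (j = k))\<^sup>2 \<partial>U)"
    proof (intro has_bochner_integral_sum has_bochner_integral_integrable)
      fix j k assume "k \<in> {..<d}"
      then show "integrable U (\<lambda>w. (ent (sig w) j k - of_bool (j = k))\<^sup>2)"
        using integrable_sig2[of j k] by (simp cong: conj_cong)
    qed
    moreover have "(norm (sig w - idm d))\<^sup>2 = (\<Sum>j<d. \<Sum>k<d. (ent (sig w) j k - of_bool (j = k))\<^sup>2)" for w
    proof -
      have "dims d d (sig w - idm d)" using dims_rp_signal[OF l] by blast
      then show ?thesis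
        unfolding power2_norm_eq_inner by (simp add: inner_fmat_eq power2_eq_square ent_idm of_bool_def)
    qed
    ultimately show ?thesis by (simp add: has_bochner_integral_iff)
  qed
  have *: "((?m j k) - of_bool (j = k))\<^sup>2 + ((\<integral>w. (ent (sig w) j k)\<^sup>2 \<partial>U) - (?m j k)\<^sup>2) =
      (\<integral>w. (ent (sig w) j k - of_bool (j = k))\<^sup>2 \<partial>U)" for j k
  proof -
    have "(\<integral>w. (ent (sig w) j k - of_bool (j = k))\<^sup>2 \<partial>U) =
        (\<integral>w. (ent (sig w) j k)\<^sup>2 - 2 * of_bool (j = k) * ent (sig w) j k + of_bool (j = k) \<partial>U)"
      by (intro Bochner_Integration.integral_cong refl) (simp add: power2_eq_square algebra_simps)
    also have "\<dots> = (\<integral>w. (ent (sig w) j k)\<^sup>2 \<partial>U) - 2 * of_bool (j = k) * ?m j k + of_bool (j = k)"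
      using integrable_sig by (simp add: U.prob_space)
    finally show ?thesis by (simp add: power2_eq_square algebra_simps)
  qed
  have "(\<Sum>j<d. \<Sum>k<d. (?m j k - of_bool (j = k))\<^sup>2)
      + (\<Sum>j<d. \<Sum>k<d. (\<integral>w. (ent (sig w) j k)\<^sup>2 \<partial>U) - (?m j k)\<^sup>2) =
      (\<Sum>j<d. \<Sum>k<d. \<integral>w. (ent (sig w) j k - of_bool (j = k))\<^sup>2 \<partial>U)"
    by (simp only: sum.distrib[symmetric] *)
  then have "rp_bias \<mu> \<nu> \<alpha> \<sigma> n p d l + rp_var \<mu> \<nu> \<alpha> \<sigma> n p d l =
     \<alpha>\<^sup>2 / d * (\<Sum>j<d. \<Sum>k<d. \<integral>w. (ent (sig w) j k - of_bool (j = k))\<^sup>2 \<partial>U)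
     + \<sigma>\<^sup>2 * (\<Sum>j<d. \<Sum>i<n. \<integral>w. (ent (noi w) j i)\<^sup>2 \<partial>U)"
    unfolding rp_bias_eq var by (simp only: distrib_left[symmetric] add.assoc[symmetric])
  then show ?thesis
    unfolding noise signal integrable_norm_noi(2) integrable_norm_sig(2) .
qed

end

section \<open>Exchangeability of the coordinates\<close>

text \<open>
  A matrix that is invariant under simultaneous permutations of rows and columns has constant
  diagonal and constant off-diagonal entries; a bound on the sum of its entries then makes the
  off-diagonal part negligible.
\<close>

definition perm_mat :: "nat \<Rightarrow> (nat \<Rightarrow> nat) \<Rightarrow> fmat" where
  "perm_mat d \<pi> = rmat d d (\<lambda>(i, j). of_bool (i = \<pi> j))"

lemma dims_perm_mat [intro]: "dims d d (perm_mat d \<pi>)"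
  unfolding perm_mat_def by blast

lemma ent_times_perm_mat:
  assumes "\<pi> permutes {..<d}" "dims m d A"
  shows "ent (A * perm_mat d \<pi>) i j = (if j < d then ent A i (\<pi> j) else 0)"
proof (cases "j < d")
  case True
  then have "\<pi> j < d" using permutes_in_image[OF assms(1), of j] by simp
  then have "(\<Sum>k<d. ent A i k * ent (perm_mat d \<pi>) k j) = (\<Sum>k<d. if k = \<pi> j then ent A i (\<pi> j) else 0)"
    using True by (intro sum.cong refl) (auto simp: perm_mat_def ent_rmat)
  then show ?thesis using True \<open>\<pi> j < d\<close> by (simp add: ent_times[OF assms(2)])
next
  case False
  then show ?thesis by (simp add: ent_times[OF assms(2)] perm_mat_def ent_rmat)
qed

lemma ent_conj_perm_mat:
  assumes "\<pi> permutes {..<d}" "dims d d A" "j < d" "k < d"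
  shows "ent (tp (perm_mat d \<pi>) * A * perm_mat d \<pi>) j k = ent A (\<pi> j) (\<pi> k)"
proof -
  have d: "dims d d (tp (perm_mat d \<pi>) * A)" "dims d d (tp A)" using assms(2) by blast+
  have "ent (tp (perm_mat d \<pi>) * A) j i = ent (tp A * perm_mat d \<pi>) i j" for i
    by (metis ent_tp tp_simps(6) tp_times)
  then show ?thesis
    using assms by (simp add: ent_times_perm_mat[OF assms(1) d(1)] ent_times_perm_mat[OF assms(1) d(2)])
qed

lemma perm_mat_orthogonal:
  assumes "\<pi> permutes {..<d}"
  shows "perm_mat d \<pi> * tp (perm_mat d \<pi>) = idm d"
proof (rule fmat_eqI)
  fix i j
  show "ent (perm_mat d \<pi> * tp (perm_mat d \<pi>)) i j = ent (idm d) i j"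
  proof (cases "i < d \<and> j < d")
    case True
    have "ent (perm_mat d \<pi> * tp (perm_mat d \<pi>)) i j = (\<Sum>k<d. of_bool (i = \<pi> k) * of_bool (j = \<pi> k))"
      unfolding ent_times[OF dims_perm_mat] using True by (simp add: perm_mat_def ent_rmat)
    also have "\<dots> = (\<Sum>k<d. of_bool (i = k) * of_bool (j = k))"
      by (rule sum.permute[OF assms, of "\<lambda>k. of_bool (i = k) * of_bool (j = k)", unfolded o_def, symmetric])
    also have "\<dots> = (\<Sum>k<d. if k = i then of_bool (i = j) else 0)"
      by (intro sum.cong refl) auto
    finally show ?thesis using True by (simp add: ent_idm)
  next
    case False
    have "dims d d (perm_mat d \<pi> * tp (perm_mat d \<pi>))" by blast
    from ent_eq_0[OF this False] ent_eq_0[OF dims_intros(7) False] show ?thesis by simp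
  qed
qed

lemma resolv_conj:
  assumes R: "resolv P l S R" and QQ: "Q * tp Q = idm d" and d: "dims d d Q" "dims d d P" "dims d d S" "dims d d R"
  shows "resolv (tp Q * P * Q) l (tp Q * S * Q) (tp Q * R * Q)"
proof -
  have *: "Q * (tp Q * (A * B)) = A * B" if "dims d d A" for A B
    using QQ idm_times[OF that] by (simp flip: mult.assoc)
  have "tp Q * (P * S * R + l *\<^sub>R R) * Q = tp Q * P * Q"
    using R by (simp add: resolv_def)
  moreover have "tp Q * (P * R) * Q = tp Q * R * Q" using R by (simp add: resolv_def)
  ultimately show ?thesis
    using R d by (simp add: resolv_def * mult.assoc algebra_simps)
qed

text \<open>The symmetry is required of the projection \<open>proj_of p d W\<close> and not of
  \<open>W\<close>, which covers both models: for the uniform law \<open>\<tau>\<close> multiplies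
  by a permutation matrix, and for the point mass at the identity matrix \<open>\<tau>\<close> can
  be the identity map.\<close>

locale rp_exchangeable = rp_model +
  assumes exchangeable: "\<And>\<pi>. \<pi> permutes {..<d} \<Longrightarrow>
    \<exists>\<tau>. \<tau> \<in> measurable \<nu> \<nu> \<and> distr \<nu> \<nu> \<tau> = \<nu> \<and>
      (AE W in \<nu>. proj_of p d (\<tau> W) = tp (perm_mat d \<pi>) * proj_of p d W * perm_mat d \<pi>)"
begin

abbreviation "mean_sig j k \<equiv> \<integral>w. ent (sig w) j k \<partial>U"

text \<open>Permuting the columns of \<open>X\<close> and applying \<open>\<tau>\<close> to
  \<open>W\<close> preserves the joint law, while Gram matrix, projection and therefore resolvent
  are conjugated by the permutation matrix.\<close>

lemma mean_sig_permute:
  assumes \<pi>: "\<pi> permutes {..<d}" and jk: "j < d" "k < d"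
  shows "mean_sig (\<pi> j) (\<pi> k) = mean_sig j k"
proof -
  interpret \<nu>: prob_space \<nu> by (rule prob_\<nu>)
  let ?Q = "perm_mat d \<pi>" and ?K = "{..<n} \<times> {..<d}"
  obtain \<tau> where \<tau>: "\<tau> \<in> measurable \<nu> \<nu>" "distr \<nu> \<nu> \<tau> = \<nu>"
    and conj: "AE W in \<nu>. proj_of p d (\<tau> W) = tp ?Q * proj_of p d W * ?Q"
    using exchangeable[OF \<pi>] by blast
  \<comment> \<open>Only the columns are permuted, so the new data matrix is \<open>X\<close> times
    \<open>?Q\<close>, and the law with independent identically distributed entries is
    unchanged.\<close>
  define \<rho> :: "nat \<times> nat \<Rightarrow> nat \<times> nat" where "\<rho> = (\<lambda>(i, j). (i, \<pi> j))"
  define T where "T X = (\<lambda>ij\<in>?K. X (\<rho> ij))" for X :: "nat \<times> nat \<Rightarrow> real"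
  have \<pi>d: "\<pi> j < d" if "j < d" for j using permutes_in_image[OF \<pi>, of j] that by simp
  have "distr (iid_mat n d \<mu>) (iid_mat n d \<mu>) T = iid_mat n d \<mu>"
    unfolding iid_mat_def T_def
    by (rule distr_PiM_reindex[where M = "\<lambda>_. \<mu>" and f = \<rho>])
      (use permutes_inj[OF \<pi>] \<pi>d prob_space_axioms in \<open>auto simp: inj_on_def \<rho>_def inj_def\<close>)
  moreover have T: "T \<in> measurable (iid_mat n d \<mu>) (iid_mat n d \<mu>)"
    unfolding iid_mat_def T_def
    by (intro measurable_restrict measurable_component_singleton) (auto simp: \<rho>_def \<pi>d)
  ultimately have D: "distr U U (\<lambda>(X, W). (T X, \<tau> W)) = U"
    unfolding U_def using pair_measure_distr[OF T \<tau>(1)] \<tau>(2) \<nu>.sigma_finite_measure_axioms by simp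
  have m: "(\<lambda>(X, W). (T X, \<tau> W)) \<in> measurable U U"
    unfolding U_def using T \<tau>(1) by measurable
  have "mean_sig j k = (\<integral>w. ent (sig w) j k \<partial>distr U U (\<lambda>(X, W). (T X, \<tau> W)))"
    by (simp only: D)
  also have "\<dots> = (\<integral>w. ent (sig (case w of (X, W) \<Rightarrow> (T X, \<tau> W))) j k \<partial>U)"
    by (rule integral_distr[OF m ent_meas[OF mmeas_sig]])
  also have "\<dots> = mean_sig (\<pi> j) (\<pi> k)"
  proof (rule integral_cong_AE)
    show "(\<lambda>w. ent (sig (case w of (X, W) \<Rightarrow> (T X, \<tau> W))) j k) \<in> borel_measurable U"
      using measurable_compose[OF m ent_meas[OF mmeas_sig]] by simp
    have good: "AE w in U. fixed_projection \<mu> m4 n p d l (snd (case w of (X, W) \<Rightarrow> (T X, \<tau> W)))"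
      by (rule AE_distrD[OF m]) (simp only: D AE_U)
    have "AE w in U. proj_of p d (\<tau> (snd w)) = tp ?Q * proj_of p d (snd w) * ?Q"
      unfolding U_def by (rule AE_pair_snd[OF prob_iid prob_\<nu> conj])
    with good AE_U
    show "AE w in U. ent (sig (case w of (X, W) \<Rightarrow> (T X, \<tau> W))) j k = ent (sig w) (\<pi> j) (\<pi> k)"
    proof eventually_elim
      case (elim w)
      obtain X W where w: "w = (X, W)" by fastforce
      interpret A: fixed_projection \<mu> m4 n p d l "\<tau> W" using elim(1) by (simp add: w)
      interpret B: fixed_projection \<mu> m4 n p d l W using elim(2) by (simp add: w)
      have X: "rmat n d (T X) = rmat n d X * ?Q"
        by (rule fmat_eqI) (simp add: ent_times_perm_mat[OF \<pi> dims_rmat] ent_rmat T_def \<rho>_def \<pi>d)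
      then have S: "gram n d (T X) = tp ?Q * gram n d X * ?Q"
        by (simp add: gram_def mult.assoc)
      \<comment> \<open>The explicit inverse inside the resolvent is never conjugated; uniqueness
        reduces the claim to the resolvent equation.\<close>
      have R: "rp_resolvent l n p d (T X) (\<tau> W) = tp ?Q * rp_resolvent l n p d X W * ?Q"
      proof (rule resolv_unique[OF A.P psd_gram l A.R])
        show "resolv (proj_of p d (\<tau> W)) l (gram n d (T X)) (tp ?Q * rp_resolvent l n p d X W * ?Q)"
          using elim(3) unfolding S w snd_conv
          by (simp only:) (intro resolv_conj[OF B.R perm_mat_orthogonal[OF \<pi>]] dims_perm_mat dims_proj_of dims_gram B.dims_R)
      qed
      have "sig (T X, \<tau> W) = tp ?Q * rp_resolvent l n p d X W * (?Q * tp ?Q * gram n d X) * ?Q"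
        by (simp add: rp_signal_def R S mult.assoc)
      also have "\<dots> = tp ?Q * sig (X, W) * ?Q"
        by (simp add: perm_mat_orthogonal[OF \<pi>] idm_times[OF dims_gram] rp_signal_def mult.assoc)
      finally show ?case
        using ent_conj_perm_mat[OF \<pi> dims_rp_signal[OF l] jk] by (simp add: w)
    qed
  qed (rule ent_meas[OF mmeas_sig])
  finally show ?thesis by simp
qed

lemma mean_sig_diag: "j < d \<Longrightarrow> mean_sig j j = mean_sig 0 0"
  using mean_sig_permute[OF permutes_swap_id[of 0 "{..<d}" j], of 0 0] d by simp

lemma mean_sig_offdiag:
  assumes "j < d" "k < d" "j \<noteq> k"
  shows "mean_sig j k = mean_sig 0 1"
proof -
  have d2: "1 < d" using assms by linarith
  \<comment> \<open>\<open>k'\<close> is the place of \<open>k\<close> after \<open>j\<close> has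
    been moved to \<open>0\<close>. As \<open>k'\<close> is not \<open>0\<close>, a second swap
    takes it to \<open>1\<close> and fixes \<open>0\<close>.\<close>
  define k' where "k' = Transposition.transpose j 0 k"
  have k': "k' < d" "k' \<noteq> 0" using assms d by (auto simp: k'_def Transposition.transpose_def)
  have "mean_sig j k = mean_sig 0 k'"
    using mean_sig_permute[OF permutes_swap_id[of j "{..<d}" 0], of j k] assms d by (simp add: k'_def)
  also have "\<dots> = mean_sig 0 1"
    using mean_sig_permute[OF permutes_swap_id[of k' "{..<d}" 1], of 0 k'] k' d2
    by (simp add: Transposition.transpose_def)
  finally show ?thesis .
qed

text \<open>All diagonal means agree, so their sum is the mean trace of \<open>R S\<close>, which
  \<open>resolv_trace\<close> evaluates.\<close>

lemma sum_mean_sig_diag: "d * mean_sig 0 0 = real p - l * n * (\<integral>w. tr w \<partial>U)"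
proof -
  interpret U: prob_space U by (rule prob_U)
  have "(\<Sum>j<d. mean_sig j j) = (\<Sum>j<d. mean_sig 0 0)"
    by (intro sum.cong refl mean_sig_diag) simp
  then have "d * mean_sig 0 0 = (\<Sum>j<d. mean_sig j j)" by simp
  also have "\<dots> = (\<integral>w. (\<Sum>j<d. ent (sig w) j j) \<partial>U)"
    using integrable_sig(1) by simp
  also have "\<dots> = (\<integral>w. real p - l * n * tr w \<partial>U)"
  proof (rule integral_cong_AE)
    show "(\<lambda>w. \<Sum>j<d. ent (sig w) j j) \<in> borel_measurable U"
      by (intro borel_measurable_sum ent_meas mmeas_sig)
    show "(\<lambda>w. real p - l * n * tr w) \<in> borel_measurable U"
      using measurable_tr by simp
    show "AE w in U. (\<Sum>j<d. ent (sig w) j j) = real p - l * n * tr w"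
      using AE_U
    proof eventually_elim
      case (elim w)
      then interpret fixed_projection \<mu> m4 n p d l "snd w" .
      have "(\<Sum>j<d. ent (sig w) j j) = inner (idm d) (R (fst w) * S (fst w))"
        by (subst inner_idm[OF dims_rp_signal[OF l], symmetric]) (simp add: rp_signal_def)
      also have "\<dots> = inner (R (fst w) * S (fst w)) (idm d)" by (rule inner_commute)
      also have "\<dots> = inner (S (fst w)) (R (fst w))"
        by (simp add: inner_times_left R_facts times_idm[OF dims_R])
      also have "\<dots> = real p - l * inner P (R (fst w))"
        using resolv_trace[OF P psd_gram l R, of "fst w"] by (simp add: PP)
      finally show ?case using n by (simp add: res_trace_def)
    qed
  qed
  also have "\<dots> = real p - l * n * (\<integral>w. tr w \<partial>U)"
    using integrable_tr by (simp add: U.prob_space)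
  finally show ?thesis .
qed

lemma psd_abs_inner_le:
  assumes "psd A"
  shows "\<bar>inner u (A * v)\<bar> \<le> (inner u (A * u) + inner v (A * v)) / 2"
proof -
  have sym: "inner v (A * u) = inner u (A * v)"
    using assms inner_times_left[of A v u] by (simp add: psd_def inner_commute)
  have "0 \<le> inner (u - v) (A * (u - v))" "0 \<le> inner (u + v) (A * (u + v))"
    using assms unfolding psd_def by blast+
  then show ?thesis
    by (simp add: inner_diff_left inner_diff_right inner_add_left inner_add_right distrib_left
        right_diff_distrib sym abs_le_iff)
qed

text \<open>With \<open>one\<close> the column of ones, the sum of the entries of \<open>sig\<close>
  is \<open>inner (R * one) (S * one)\<close>. Positivity of \<open>S\<close> bounds it by half the
  sum of \<open>inner (R * one) (S * (R * one))\<close>, which is at most \<open>d / l\<close>, and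
  \<open>inner one (S * one)\<close>, whose mean is \<open>d\<close>. There are
  \<open>d (d - 1)\<close> equal off-diagonal means, so order \<open>d\<close> for the sum forces
  each to be of order \<open>1 / d\<close>.\<close>

lemma sum_mean_sig: "\<bar>\<Sum>j<d. \<Sum>k<d. mean_sig j k\<bar> \<le> d * (1 / l + 1) / 2"
proof -
  interpret U: prob_space U by (rule prob_U)
  let ?M = "iid_mat n d \<mu>"
  define one where "one = colv d (\<lambda>_. 1)"
  have norm_one: "(norm one)\<^sup>2 = d"
    unfolding one_def power2_norm_eq_inner inner_fmat_eq[OF dims_colv] by (simp add: colv.rep_eq)
  have one: "inner one (A * one) = (\<Sum>j<d. \<Sum>k<d. ent A j k)" if "dims d d A" for A
    unfolding one_def by (simp add: inner_colv_colv[OF that])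
  have gram: "inner one (gram n d X * one) = (\<Sum>j<d. \<Sum>k<d. (\<Sum>i<n. X (i, j) * X (i, k)) / n)" for X
    unfolding one[OF dims_gram] unfolding gram_def
    by (intro sum.cong refl) (simp add: ent_times[OF dims_intros(6)[OF dims_rmat]] ent_rmat)
  have hb: "has_bochner_integral ?M (\<lambda>X. inner one (gram n d X * one))
      (\<Sum>j<d. \<Sum>k<d. (\<Sum>i<n. of_bool (j = k)) / n)"
    unfolding gram
  proof (intro has_bochner_integral_sum has_bochner_integral_divide_zero)
    fix i j k assume "i \<in> {..<n}" "j \<in> {..<d}" "k \<in> {..<d}"
    then show "has_bochner_integral ?M (\<lambda>X. X (i, j) * X (i, k)) (of_bool (j = k))"
      using moment2[of "{..<n} \<times> {..<d}" "(i, j)" "(i, k)"]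
      by (simp add: iid_mat_def has_bochner_integral_iff)
  qed
  have "(\<Sum>j<d. \<Sum>k<d. (\<Sum>i<n. of_bool (j = k)) / n) = (\<Sum>j<d. \<Sum>k<d. if j = k then 1 else (0::real))"
    using n by (intro sum.cong refl) auto
  then have gi: "integrable ?M (\<lambda>X. inner one (gram n d X * one))"
    "(\<integral>X. inner one (gram n d X * one) \<partial>?M) = d"
    using hb by (simp_all add: has_bochner_integral_iff)
  interpret \<nu>: prob_space \<nu> by (rule prob_\<nu>)
  have gU: "integrable U (\<lambda>w. inner one (g w * one))" "(\<integral>w. inner one (g w * one) \<partial>U) = d"
    using pair_integral_product[OF prob_iid prob_\<nu> gi(1), of "\<lambda>_. 1"] gi(2)
    by (simp_all add: U_def \<nu>.prob_space)
  have le: "AE w in U. \<bar>inner one (sig w * one)\<bar> \<le> (d / l + inner one (g w * one)) / 2"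
    using AE_U
  proof eventually_elim
    case (elim w)
    then interpret fixed_projection \<mu> m4 n p d l "snd w" .
    let ?R = "R (fst w)" and ?S = "S (fst w)"
    have "inner (?R * one) (?S * (?R * one)) \<le> inner one (?R * one)"
      using resolv_inner[OF P psd_gram l R, of one "fst w"] l by simp
    also have "\<dots> \<le> d / l"
      using resolv_upper[OF P psd_gram l R, of one "fst w"] by (simp add: norm_one)
    finally have "(inner (?R * one) (?S * (?R * one)) + inner one (?S * one)) / 2 \<le>
        (d / l + inner one (?S * one)) / 2" by (intro divide_right_mono add_right_mono) simp_all
    moreover have "inner one (sig w * one) = inner (?R * one) (?S * one)"
      by (simp add: rp_signal_def inner_times_left R_facts mult.assoc)
    ultimately show ?case
      by (simp only:) (rule order.trans[OF psd_abs_inner_le[OF psd_gram]])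
  qed
  have hs: "has_bochner_integral U (\<lambda>w. inner one (sig w * one)) (\<Sum>j<d. \<Sum>k<d. mean_sig j k)"
    unfolding one[OF dims_rp_signal[OF l]]
    by (intro has_bochner_integral_sum has_bochner_integral_integrable integrable_sig)
  then have si: "integrable U (\<lambda>w. inner one (sig w * one))" by (simp add: has_bochner_integral_iff)
  have "\<bar>\<Sum>j<d. \<Sum>k<d. mean_sig j k\<bar> = \<bar>\<integral>w. inner one (sig w * one) \<partial>U\<bar>"
    using hs by (simp add: has_bochner_integral_iff)
  also have "\<dots> \<le> (\<integral>w. \<bar>inner one (sig w * one)\<bar> \<partial>U)" by (rule integral_abs_bound)
  also have "\<dots> \<le> (\<integral>w. (d / l + inner one (g w * one)) / 2 \<partial>U)"
    using si gU(1) le by (intro integral_mono_AE) auto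
  also have "\<dots> = d * (1 / l + 1) / 2"
    using gU by (simp add: U.prob_space field_simps)
  finally show ?thesis .
qed

text \<open>For the common off-diagonal mean \<open>b\<close>, the bound on the sum of entries keeps
  \<open>(d - 1) b\<close> bounded. The off-diagonal share of the bias is \<open>(d - 1) b^2\<close>
  up to the factor \<open>\<alpha>\<^sup>2\<close>, hence of order \<open>1 / d\<close>.\<close>

lemma rp_bias_close:
  assumes d2: "2 \<le> d"
  defines "A \<equiv> (real p - l * n * (\<integral>w. tr w \<partial>U)) / d"
  shows "\<bar>rp_bias \<mu> \<nu> \<alpha> \<sigma> n p d l - \<alpha>\<^sup>2 * (A - 1)\<^sup>2\<bar> \<le> \<alpha>\<^sup>2 * ((1 / l + 1) / 2 + \<bar>A\<bar>)\<^sup>2 / (real d - 1)"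
proof -
  define b where "b = mean_sig 0 1"
  have A: "mean_sig 0 0 = A" using sum_mean_sig_diag d by (simp add: A_def field_simps)
  have inner_sum: "(\<Sum>k<d. F (mean_sig j k) (j = k)) = F A True + (real d - 1) * F b False"
    if "j < d" for j and F :: "real \<Rightarrow> bool \<Rightarrow> real"
  proof -
    have "(\<Sum>k<d. F (mean_sig j k) (j = k)) = (\<Sum>k<d. F b False + (if k = j then F A True - F b False else 0))"
      using that A mean_sig_diag[of j] mean_sig_offdiag[of j] by (intro sum.cong refl) (auto simp: b_def)
    then show ?thesis using that by (simp add: sum.distrib algebra_simps)
  qed
  have "(\<Sum>j<d. \<Sum>k<d. mean_sig j k) = (\<Sum>j<d. A + (real d - 1) * b)"
    using inner_sum[of _ "\<lambda>x _. x"] by (intro sum.cong refl) auto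
  then have "d * \<bar>A + (real d - 1) * b\<bar> \<le> d * ((1 / l + 1) / 2)"
    using sum_mean_sig by (simp add: abs_mult)
  then have "\<bar>A + (real d - 1) * b\<bar> \<le> (1 / l + 1) / 2" using d by simp
  then have "\<bar>(real d - 1) * b\<bar> \<le> (1 / l + 1) / 2 + \<bar>A\<bar>" by linarith
  then have "((real d - 1) * b)\<^sup>2 \<le> ((1 / l + 1) / 2 + \<bar>A\<bar>)\<^sup>2"
    by (metis abs_ge_zero power2_abs power_mono)
  then have b: "(real d - 1) * b\<^sup>2 \<le> ((1 / l + 1) / 2 + \<bar>A\<bar>)\<^sup>2 / (real d - 1)"
    using d2 by (simp add: pos_le_divide_eq power_mult_distrib) (simp add: power2_eq_square mult_ac)
  have "(\<Sum>j<d. \<Sum>k<d. (mean_sig j k - of_bool (j = k))\<^sup>2) = (\<Sum>j<d. (A - 1)\<^sup>2 + (real d - 1) * b\<^sup>2)"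
    using inner_sum[of _ "\<lambda>x c. (x - of_bool c)\<^sup>2"] by (intro sum.cong refl) auto
  then have "rp_bias \<mu> \<nu> \<alpha> \<sigma> n p d l = \<alpha>\<^sup>2 * ((A - 1)\<^sup>2 + (real d - 1) * b\<^sup>2)"
    using d by (simp add: rp_bias_eq)
  then have "\<bar>rp_bias \<mu> \<nu> \<alpha> \<sigma> n p d l - \<alpha>\<^sup>2 * (A - 1)\<^sup>2\<bar> = \<alpha>\<^sup>2 * ((real d - 1) * b\<^sup>2)"
    using d2 by (simp add: distrib_left)
  also have "\<dots> \<le> \<alpha>\<^sup>2 * (((1 / l + 1) / 2 + \<bar>A\<bar>)\<^sup>2 / (real d - 1))"
    by (intro mult_left_mono b) simp
  finally show ?thesis by simp
qed

end

section \<open>The two models\<close>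

lemma ofm_inject:
  assumes "A \<in> carrier_mat m n" "B \<in> carrier_mat m n" "ofm A = ofm B"
  shows "A = B"
proof (rule eq_matI)
  fix i j assume ij: "i < dim_row B" "j < dim_col B"
  have "ent (ofm A) i j = ent (ofm B) i j" using assms(3) by simp
  then show "A $$ (i, j) = B $$ (i, j)" using assms(1,2) ij by (simp add: ofm.rep_eq)
qed (use assms in auto)

lemma entry_law_moments:
  assumes "entry_law \<mu>"
  shows "entry_moments \<mu> (\<integral>z. z ^ 4 \<partial>\<mu>)"
proof -
  from assms obtain \<eta> where \<eta>: "0 < \<eta>" "integrable \<mu> (\<lambda>z. \<bar>z\<bar> powr (8 + \<eta>))"
    and \<mu>: "real_distribution \<mu>" "(\<integral>z. z \<partial>\<mu>) = 0" "(\<integral>z. z\<^sup>2 \<partial>\<mu>) = 1"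
    unfolding entry_law_def by blast
  interpret real_distribution \<mu> by fact
  have "integrable \<mu> (\<lambda>z. z ^ 4)"
  proof (rule Bochner_Integration.integrable_bound[of _ "\<lambda>z. 1 + \<bar>z\<bar> powr (8 + \<eta>)"])
    show "integrable \<mu> (\<lambda>z. 1 + \<bar>z\<bar> powr (8 + \<eta>))" using \<eta>(2) by simp
    have "\<bar>z ^ 4\<bar> \<le> 1 + \<bar>z\<bar> powr (8 + \<eta>)" for z :: real
    proof (cases "\<bar>z\<bar> \<le> 1")
      case True
      have "\<bar>z ^ 4\<bar> \<le> 1" using power_le_one[of "\<bar>z\<bar>" 4] True by (simp add: power_abs)
      also have "\<dots> \<le> 1 + \<bar>z\<bar> powr (8 + \<eta>)" by simp
      finally show ?thesis .
    next
      case False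
      then have "\<bar>z ^ 4\<bar> = \<bar>z\<bar> powr 4" by (simp add: powr_numeral power_abs)
      also have "\<dots> \<le> \<bar>z\<bar> powr (8 + \<eta>)" using False \<eta>(1) by (intro powr_mono) auto
      finally show ?thesis by simp
    qed
    then show "AE z in \<mu>. norm (z ^ 4) \<le> norm (1 + \<bar>z\<bar> powr (8 + \<eta>))" by simp
  qed simp
  with \<mu> show ?thesis by unfold_locales auto
qed

text \<open>Permutation matrices are orthogonal, so the defining invariance of the uniform law
  applies to them, and \<open>W \<mapsto> W Q\<close> conjugates \<open>W\<^sup>T W\<close> by
  \<open>Q\<close>.\<close>

lemma uniform_stiefel_exchangeable:
  assumes \<nu>: "uniform_stiefel p d \<nu>" and \<mu>: "entry_moments \<mu> m4" and pos: "0 < n" "0 < d" "0 < l"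
  shows "rp_exchangeable \<mu> m4 \<nu> n p d l"
proof -
  interpret entry_moments \<mu> m4 by fact
  have prob: "prob_space \<nu>" and sets: "sets \<nu> = sets (\<Pi>\<^sub>M ij\<in>{..<p} \<times> {..<d}. borel)"
    and AE: "AE W in \<nu>. mat p d W * (mat p d W)\<^sup>T = 1\<^sub>m p"
    and inv: "\<And>Q. Q \<in> carrier_mat d d \<Longrightarrow> Q * Q\<^sup>T = 1\<^sub>m d \<Longrightarrow>
        distr \<nu> \<nu> (\<lambda>W. mat_entries p d (mat p d W * Q)) = \<nu>"
    using \<nu> by (auto simp: uniform_stiefel_def)
  show ?thesis
  proof (intro rp_exchangeable.intro rp_model.intro rp_model_axioms.intro rp_exchangeable_axioms.intro)
    show "AE W in \<nu>. rmat p d W * tp (rmat p d W) = idm p"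
      using AE
    proof eventually_elim
      case (elim W)
      have "rmat p d W * tp (rmat p d W) = ofm (mat p d W * (mat p d W)\<^sup>T)"
        unfolding rmat_def by (subst ofm_mult[of _ p d _ p]) (simp_all add: ofm_transpose)
      then show ?case by (simp add: elim ofm_one)
    qed
  next
    fix \<pi> assume \<pi>: "\<pi> permutes {..<d}"
    let ?Q = "mat d d (\<lambda>(i, j). of_bool (i = \<pi> j)) :: real mat"
    have Q: "?Q \<in> carrier_mat d d" by simp
    have ofmQ: "ofm ?Q = perm_mat d \<pi>" by (simp add: perm_mat_def rmat_def)
    have QQ: "?Q * ?Q\<^sup>T = 1\<^sub>m d"
    proof (rule ofm_inject)
      have "?Q\<^sup>T \<in> carrier_mat d d" by simp
      from ofm_mult[OF Q this] show "ofm (?Q * ?Q\<^sup>T) = ofm (1\<^sub>m d)"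
        by (simp add: ofm_transpose ofmQ perm_mat_orthogonal[OF \<pi>] ofm_one)
    qed auto
    define \<tau> where "\<tau> W = mat_entries p d (mat p d W * ?Q)" for W :: "nat \<times> nat \<Rightarrow> real"
    have "rmat p d (\<tau> W) = rmat p d W * perm_mat d \<pi>" for W
    proof -
      have "ofm (mat p d W * ?Q) = rmat p d W * perm_mat d \<pi>"
        by (subst ofm_mult[of _ p d _ d]) (simp_all add: rmat_def ofmQ)
      moreover have "mat p d (\<tau> W) = mat p d W * ?Q"
        by (rule eq_matI) (auto simp: \<tau>_def mat_entries_def)
      ultimately show ?thesis by (simp add: rmat_def)
    qed
    then have "proj_of p d (\<tau> W) = tp (perm_mat d \<pi>) * proj_of p d W * perm_mat d \<pi>" for W
      by (simp add: proj_of_def mult.assoc)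
    moreover have "distr \<nu> \<nu> \<tau> = \<nu>"
      using inv[OF Q QQ] by (simp add: \<tau>_def[abs_def])
    moreover have "\<tau> \<in> measurable \<nu> \<nu>"
      unfolding measurable_cong_sets[OF sets sets] \<tau>_def mat_entries_def
    proof (rule measurable_restrict)
      fix ij assume "ij \<in> {..<p} \<times> {..<d}"
      then obtain i j where ij: "ij = (i, j)" "i < p" "j < d" by auto
      have "(mat p d W * ?Q) $$ ij = (\<Sum>k<d. W (i, k) * of_bool (k = \<pi> j))" for W
        using ij by (simp add: scalar_prod_def atLeast0LessThan)
      then show "(\<lambda>W. (mat p d W * ?Q) $$ ij) \<in> borel_measurable (\<Pi>\<^sub>M ij\<in>{..<p} \<times> {..<d}. borel)"
        using ij by (simp only:) (intro borel_measurable_sum borel_measurable_times borel_measurable_const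
            measurable_component_singleton; simp)
    qed
    ultimately show "\<exists>\<tau>. \<tau> \<in> measurable \<nu> \<nu> \<and> distr \<nu> \<nu> \<tau> = \<nu> \<and>
      (AE W in \<nu>. proj_of p d (\<tau> W) = tp (perm_mat d \<pi>) * proj_of p d W * perm_mat d \<pi>)"
      by blast
  qed (rule \<mu> pos prob sets)+
qed

definition id_entries :: "nat \<Rightarrow> nat \<times> nat \<Rightarrow> real" where
  "id_entries d = (\<lambda>ij\<in>{..<d} \<times> {..<d}. of_bool (fst ij = snd ij))"

text \<open>The ordinary ridge model is the random projection model with \<open>W = I\<close>.\<close>

definition id_law :: "nat \<Rightarrow> (nat \<times> nat \<Rightarrow> real) measure" where
  "id_law d = return (\<Pi>\<^sub>M ij\<in>{..<d} \<times> {..<d}. borel) (id_entries d)"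

lemma id_entries_space: "id_entries d \<in> space (\<Pi>\<^sub>M ij\<in>{..<d} \<times> {..<d}. borel)"
  by (auto simp: id_entries_def space_PiM)

lemma mat_id_entries: "mat d d (id_entries d) = 1\<^sub>m d"
  by (rule eq_matI) (auto simp: id_entries_def)

lemma rmat_id_entries: "rmat d d (id_entries d) = idm d"
  by (simp add: rmat_def mat_id_entries ofm_one)

lemma id_law_exchangeable:
  assumes \<mu>: "entry_moments \<mu> m4" and pos: "0 < n" "0 < d" "0 < l"
  shows "rp_exchangeable \<mu> m4 (id_law d) n d d l"
proof -
  interpret entry_moments \<mu> m4 by fact
  have sets: "sets (id_law d) = sets (\<Pi>\<^sub>M ij\<in>{..<d} \<times> {..<d}. borel)" by (simp add: id_law_def)
  have AE: "AE W in id_law d. rmat d d W = idm d"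
  proof -
    have "AE W in id_law d. W = id_entries d"
    proof (rule AE_I')
      let ?M = "\<Pi>\<^sub>M ij\<in>{..<d} \<times> {..<d}. (borel :: real measure)"
      have "{id_entries d} = (\<Pi>\<^sub>E ij\<in>{..<d} \<times> {..<d}. {id_entries d ij})"
        by (rule PiE_singleton[symmetric]) (simp add: id_entries_def)
      then have "{id_entries d} \<in> sets ?M" by (simp add: sets_PiM_I_finite)
      then have "space ?M - {id_entries d} \<in> sets ?M" by (rule sets.compl_sets)
      then show "space ?M - {id_entries d} \<in> null_sets (id_law d)"
        by (simp add: null_sets_def id_law_def)
      show "{W \<in> space (id_law d). W \<noteq> id_entries d} \<subseteq> space ?M - {id_entries d}"
        by (auto simp: id_law_def)
    qed
    then show ?thesis by eventually_elim (simp add: rmat_id_entries)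
  qed
  have ii: "idm d * idm d = idm d" by (rule idm_times) blast
  show ?thesis
  proof (intro rp_exchangeable.intro rp_model.intro rp_model_axioms.intro rp_exchangeable_axioms.intro)
    show "prob_space (id_law d)"
      unfolding id_law_def by (rule prob_space_return[OF id_entries_space])
    show "AE W in id_law d. rmat d d W * tp (rmat d d W) = idm d"
      using AE by eventually_elim (simp add: ii)
    fix \<pi> assume \<pi>: "\<pi> permutes {..<d}"
    have pe: "tp (perm_mat d \<pi>) * idm d * perm_mat d \<pi> = idm d"
    proof (rule fmat_eqI)
      fix j k
      have di: "dims d d (tp (perm_mat d \<pi>) * idm d * perm_mat d \<pi>)" by blast
      show "ent (tp (perm_mat d \<pi>) * idm d * perm_mat d \<pi>) j k = ent (idm d) j k"
      proof (cases "j < d \<and> k < d")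
        case True
        then show ?thesis
          using ent_conj_perm_mat[OF \<pi> dims_intros(7), of j k] permutes_inj[OF \<pi>] permutes_in_image[OF \<pi>, of j]
          by (auto simp: ent_idm inj_def)
      next
        case False
        with ent_eq_0[OF di False] ent_eq_0[OF dims_intros(7) False] show ?thesis by simp
      qed
    qed
    have "AE W in id_law d. proj_of d d W = tp (perm_mat d \<pi>) * proj_of d d W * perm_mat d \<pi>"
      using AE by eventually_elim (simp add: proj_of_def ii pe)
    then show "\<exists>\<tau>. \<tau> \<in> measurable (id_law d) (id_law d) \<and> distr (id_law d) (id_law d) \<tau> = id_law d \<and>
      (AE W in id_law d. proj_of d d (\<tau> W) = tp (perm_mat d \<pi>) * proj_of d d W * perm_mat d \<pi>)"
      by (intro exI[of _ "\<lambda>W. W"]) (simp add: distr_id2)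
  qed (rule \<mu> pos sets)+
qed

text \<open>Appending a deterministic component is a push-forward. It transfers integrals between
  the training laws with and without a projection.\<close>

lemma pair_return_eq_distr:
  assumes "prob_space A" "prob_space B" "w \<in> space R"
  shows "A \<Otimes>\<^sub>M (B \<Otimes>\<^sub>M return R w) = distr (A \<Otimes>\<^sub>M B) (A \<Otimes>\<^sub>M (B \<Otimes>\<^sub>M return R w)) (\<lambda>(a, b). (a, b, w))"
proof (rule measure_eqI)
  interpret A: prob_space A by fact
  interpret B: prob_space B by fact
  interpret R: prob_space "return R w" by (rule prob_space_return[OF assms(3)])
  interpret BR: prob_space "B \<Otimes>\<^sub>M return R w"
    by (rule prob_space_pair[OF assms(2) R.prob_space_axioms])
  fix X assume X[measurable]: "X \<in> sets (A \<Otimes>\<^sub>M (B \<Otimes>\<^sub>M return R w))"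
  have m: "(\<lambda>(a, b). (a, b, w)) \<in> measurable (A \<Otimes>\<^sub>M B) (A \<Otimes>\<^sub>M (B \<Otimes>\<^sub>M return R w))"
    using assms(3) by (auto simp: case_prod_unfold intro!: measurable_Pair)
  have "emeasure (A \<Otimes>\<^sub>M (B \<Otimes>\<^sub>M return R w)) X = (\<integral>\<^sup>+t. indicator X t \<partial>(A \<Otimes>\<^sub>M (B \<Otimes>\<^sub>M return R w)))"
    by (rule nn_integral_indicator[OF X, symmetric])
  also have "\<dots> = (\<integral>\<^sup>+a. \<integral>\<^sup>+b. \<integral>\<^sup>+c. indicator X (a, b, c) \<partial>return R w \<partial>B \<partial>A)"
    by (subst BR.nn_integral_fst[symmetric], measurable)
      (auto intro!: nn_integral_cong simp: R.nn_integral_fst[symmetric])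
  also have "\<dots> = (\<integral>\<^sup>+a. \<integral>\<^sup>+b. indicator X (a, b, w) \<partial>B \<partial>A)"
  proof (intro nn_integral_cong)
    fix a b assume ab: "a \<in> space A" "b \<in> space B"
    have "(\<lambda>c. indicator X (a, b, c)) \<in> borel_measurable (return R w)"
      using ab by measurable
    then have "(\<lambda>c. indicator X (a, b, c) :: ennreal) \<in> borel_measurable R" by simp
    from nn_integral_return[OF assms(3) this]
    show "(\<integral>\<^sup>+c. indicator X (a, b, c) \<partial>return R w) = indicator X (a, b, w)" .
  qed
  also have "\<dots> = (\<integral>\<^sup>+t. indicator X (case t of (a, b) \<Rightarrow> (a, b, w)) \<partial>(A \<Otimes>\<^sub>M B))"
    by (subst B.nn_integral_fst[symmetric]) (use m in \<open>auto intro!: measurable_compose[OF m]\<close>)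
  also have "\<dots> = (\<integral>\<^sup>+t. indicator X t
      \<partial>distr (A \<Otimes>\<^sub>M B) (A \<Otimes>\<^sub>M (B \<Otimes>\<^sub>M return R w)) (\<lambda>(a, b). (a, b, w)))"
    by (rule nn_integral_distr[OF m, symmetric]) simp
  also have "\<dots> = emeasure (distr (A \<Otimes>\<^sub>M B) (A \<Otimes>\<^sub>M (B \<Otimes>\<^sub>M return R w)) (\<lambda>(a, b). (a, b, w))) X"
    by (rule nn_integral_indicator) (simp add: X del: sets_return)
  finally show "emeasure (A \<Otimes>\<^sub>M (B \<Otimes>\<^sub>M return R w)) X =
    emeasure (distr (A \<Otimes>\<^sub>M B) (A \<Otimes>\<^sub>M (B \<Otimes>\<^sub>M return R w)) (\<lambda>(a, b). (a, b, w))) X" .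
qed simp

lemma ridge_fhat_eq:
  assumes l: "0 < l"
  shows "ridge_fhat l n d (X, E) s = rp_fhat l n d d (X, E, id_entries d) s"
proof -
  obtain \<theta> x where s: "s = (\<theta>, x)" by fastforce
  let ?X = "mat n d X"
  let ?G = "inv_mat ((1 / real n) \<cdot>\<^sub>m (?X\<^sup>T * ?X) + l \<cdot>\<^sub>m 1\<^sub>m d)"
  have c: "?X\<^sup>T \<in> carrier_mat d n" "?X\<^sup>T * ?X \<in> carrier_mat d d" by auto
  have "transpose_mat (1\<^sub>m d :: real mat) = 1\<^sub>m d" by (rule transpose_one)
  then have e: "1\<^sub>m d * ?X\<^sup>T * ?X * (1\<^sub>m d)\<^sup>T = ?X\<^sup>T * ?X" "1\<^sub>m d * ?X\<^sup>T = ?X\<^sup>T"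
    "?X\<^sup>T * ?X * (1\<^sub>m d)\<^sup>T = ?X\<^sup>T * ?X"
    using left_mult_one_mat[OF c(1)] right_mult_one_mat[OF c(2)] by simp_all
  define z where "z = ?G *\<^sub>v ((1 / real n) \<cdot>\<^sub>v (?X\<^sup>T *\<^sub>v (?X *\<^sub>v Matrix.vec d \<theta> + Matrix.vec n E)))"
  have 1: "rp_fhat l n d d (X, E, id_entries d) s = scalar_prod (Matrix.vec d x) ((1\<^sub>m d)\<^sup>T *\<^sub>v z)"
    unfolding s rp_fhat_def rp_predictor_def Let_def prod.case mat_id_entries
    by (simp only: dim_row_mat index_one_mat e z_def)
  have 2: "ridge_fhat l n d (X, E) s = scalar_prod (Matrix.vec d x) z"
    unfolding s ridge_fhat_def ridge_predictor_def Let_def z_def by simp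
  have "?G \<in> carrier_mat d d"
    using inv_mat_adj(4)[OF inner_mat_carrier det_inner_mat[OF l], of n d d X "id_entries d"]
    unfolding inner_mat_def mat_id_entries e(1) .
  moreover have "?X *\<^sub>v Matrix.vec d \<theta> \<in> carrier_vec n"
    by (rule mult_mat_vec_carrier[of _ n d]) auto
  then have Y: "?X *\<^sub>v Matrix.vec d \<theta> + Matrix.vec n E \<in> carrier_vec n"
    by (rule add_carrier_vec) simp
  have "(1 / real n) \<cdot>\<^sub>v (?X\<^sup>T *\<^sub>v (?X *\<^sub>v Matrix.vec d \<theta> + Matrix.vec n E)) \<in> carrier_vec d"
    unfolding smult_carrier_vec by (rule mult_mat_vec_carrier[OF c(1) Y])
  ultimately have "z \<in> carrier_vec d" unfolding z_def by (rule mult_mat_vec_carrier)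
  then have "(1\<^sub>m d)\<^sup>T *\<^sub>v z = z" by (simp add: transpose_one)
  with 1 2 show ?thesis by simp
qed

lemma ridge_eq_rp:
  assumes \<mu>: "entry_moments \<mu> m4" and pos: "0 < n" "0 < d" "0 < l"
  shows "ridge_bias \<mu> \<alpha> \<sigma> n d l = rp_bias \<mu> (id_law d) \<alpha> \<sigma> n d d l"
    and "ridge_var \<mu> \<alpha> \<sigma> n d l = rp_var \<mu> (id_law d) \<alpha> \<sigma> n d d l"
proof -
  interpret model: rp_exchangeable \<mu> m4 "id_law d" n d d l \<alpha> \<sigma>
    by (rule id_law_exchangeable[OF \<mu> pos])
  let ?T' = "ridge_train_law \<mu> \<sigma> n d" and ?\<phi> = "\<lambda>(X, E). (X, E, id_entries d)"
  let ?T = "rp_train_law \<mu> (id_law d) \<sigma> n d"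
  have T: "?T = distr ?T' ?T ?\<phi>"
    unfolding rp_train_law_def ridge_train_law_def id_law_def
    by (rule pair_return_eq_distr[OF model.prob_iid model.prob_noise id_entries_space])
  have \<phi>: "?\<phi> \<in> measurable ?T' ?T"
    unfolding rp_train_law_def ridge_train_law_def id_law_def
    using id_entries_space[of d] by (auto simp: case_prod_unfold intro!: measurable_Pair)
  \<comment> \<open>Measurability is read off the finite expansion, whose training factors are
    already known to be measurable.\<close>
  have fhat: "(\<lambda>t. rp_fhat l n d d t s) \<in> borel_measurable ?T" for s
    unfolding model.rp_fhat_expansion using model.train_fun_integrable(1)
    by (intro borel_measurable_sum borel_measurable_times borel_measurable_const) (simp add: model.T_def)
  have eq: "rp_fhat l n d d (?\<phi> t) s = ridge_fhat l n d t s" for t s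
    using ridge_fhat_eq[OF pos(3), of n d "fst t" "snd t" s] by (simp add: case_prod_unfold)
  have int: "(\<integral>t. F (rp_fhat l n d d t s) \<partial>?T) = (\<integral>t. F (ridge_fhat l n d t s) \<partial>?T')"
    if [measurable]: "F \<in> borel_measurable borel" for F :: "real \<Rightarrow> real" and s
  proof -
    have "(\<integral>t. F (rp_fhat l n d d t s) \<partial>distr ?T' ?T ?\<phi>) = (\<integral>t. F (rp_fhat l n d d (?\<phi> t) s) \<partial>?T')"
      by (rule integral_distr[OF \<phi>]) (rule measurable_compose[OF fhat that])
    then show ?thesis unfolding T[symmetric] eq .
  qed
  have mean: "(\<integral>t. rp_fhat l n d d t s \<partial>?T) = (\<integral>t. ridge_fhat l n d t s \<partial>?T')" for s
    using int[of "\<lambda>x. x" s] by simp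
  show "ridge_bias \<mu> \<alpha> \<sigma> n d l = rp_bias \<mu> (id_law d) \<alpha> \<sigma> n d d l"
    by (simp add: ridge_bias_def rp_bias_def sq_bias_def mean)
  show "ridge_var \<mu> \<alpha> \<sigma> n d l = rp_var \<mu> (id_law d) \<alpha> \<sigma> n d d l"
    unfolding ridge_var_def rp_var_def pred_var_def mean
    by (intro Bochner_Integration.integral_cong refl int[symmetric]) simp
qed

section \<open>Limits\<close>

context rp_model
begin

text \<open>Uniformity in \<open>W\<close> pays off here: by Tonelli a bound on the integral over
  \<open>X\<close>, the same for all admissible \<open>W\<close>, passes to the joint mean.\<close>

lemma abs_mean_le:
  assumes h[measurable]: "h \<in> borel_measurable U" and b: "0 \<le> b"
    and le: "\<And>W. fixed_projection \<mu> m4 n p d l W \<Longrightarrow>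
      (\<integral>\<^sup>+X. ennreal \<bar>h (X, W)\<bar> \<partial>iid_mat n d \<mu>) \<le> ennreal b"
  shows "\<bar>\<integral>w. h w \<partial>U\<bar> \<le> b"
proof -
  interpret \<nu>: prob_space \<nu> by (rule prob_\<nu>)
  interpret X: prob_space "iid_mat n d \<mu>" by (rule prob_iid)
  interpret P: pair_sigma_finite "iid_mat n d \<mu>" \<nu> ..
  have good: "AE W in \<nu>. fixed_projection \<mu> m4 n p d l W"
    using AE_\<nu>
  proof eventually_elim
    case (elim W)
    then show ?case by unfold_locales (use n l in auto)
  qed
  have "(\<lambda>w. ennreal \<bar>h w\<bar>) \<in> borel_measurable (iid_mat n d \<mu> \<Otimes>\<^sub>M \<nu>)"
    using h unfolding U_def by measurable
  from P.nn_integral_snd[OF this]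
  have "(\<integral>\<^sup>+w. ennreal \<bar>h w\<bar> \<partial>U) = (\<integral>\<^sup>+W. (\<integral>\<^sup>+X. ennreal \<bar>h (X, W)\<bar> \<partial>iid_mat n d \<mu>) \<partial>\<nu>)"
    by (simp add: U_def)
  also have "\<dots> \<le> (\<integral>\<^sup>+W. ennreal b \<partial>\<nu>)"
    using good by (intro nn_integral_mono_AE) (auto elim!: eventually_mono intro: le)
  also have "\<dots> = ennreal b" by (simp add: \<nu>.emeasure_space_1)
  finally have nn: "(\<integral>\<^sup>+w. ennreal \<bar>h w\<bar> \<partial>U) \<le> ennreal b" .
  have "(\<integral>\<^sup>+w. ennreal (norm (h w)) \<partial>U) < \<infinity>"
    using nn by (simp add: order_le_less_trans[OF _ ennreal_less_top])
  then have int: "integrable U h" by (intro integrableI_bounded h)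
  then have "ennreal (\<integral>w. \<bar>h w\<bar> \<partial>U) \<le> ennreal b"
    using nn by (subst nn_integral_eq_integral[symmetric]) auto
  then have "(\<integral>w. \<bar>h w\<bar> \<partial>U) \<le> b" using b by (simp add: ennreal_le_iff)
  then show ?thesis using integral_abs_bound[of U h] by linarith
qed

text \<open>The bounds of \<open>fixed_projection\<close>, restated where no particular
  \<open>W\<close> is fixed.\<close>

definition "tr_error c = (\<bar>p / n - c\<bar> + sqrt (m4 + 2) * sqrt (d / l\<^sup>2) / n + 1 / (n * l)) / l"

definition "nrm_error c = ((1 + 2 * (d / (n * l\<^sup>2))) * tr_error c
    + sqrt (m4 + 2) * sqrt (d / l\<^sup>2 / l\<^sup>2) / n + 2 / (n * l\<^sup>2)
    + 2 * (d / (n * l\<^sup>2)) * (sqrt (m4 + 2) * sqrt (d / l\<^sup>2) / n + 1 / (n * l))) / l"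

definition "cross_error om = sqrt (m4 + 2) * sqrt (gram_bound n d / (l\<^sup>2 * l\<^sup>2)) / n
    + sqrt (m4 + 2) * sqrt (gram_bound n d / l\<^sup>2) / n / l
    + (sqrt (m4 + 2) * sqrt d / n + \<bar>(real d - real p) / n - om\<bar>) / l"

lemma mean_tr:
  assumes z: "0 \<le> z" "c - l * z = z / (1 + z)"
  shows "\<bar>(\<integral>w. tr w \<partial>U) - z\<bar> \<le> tr_error c"
proof -
  interpret U: prob_space U by (rule prob_U)
  have "\<bar>\<integral>w. tr w - z \<partial>U\<bar> \<le> tr_error c"
  proof (rule abs_mean_le)
    show "(\<lambda>w. tr w - z) \<in> borel_measurable U" using measurable_tr by simp
    show "0 \<le> tr_error c" using l m4_nonneg by (simp add: tr_error_def)
    fix W assume "fixed_projection \<mu> m4 n p d l W"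
    then interpret fixed_projection \<mu> m4 n p d l W .
    show "(\<integral>\<^sup>+X. ennreal \<bar>res_trace l n p d (fst (X, W)) (snd (X, W)) - z\<bar> \<partial>iid_mat n d \<mu>) \<le> ennreal (tr_error c)"
      using trace_deviation[OF z] by (simp add: trace_bound_def \<rho>_def tr_error_def)
  qed
  then show ?thesis using integrable_tr by (simp add: U.prob_space)
qed

lemma mean_nrm:
  assumes z: "0 \<le> z" "c - l * z = z / (1 + z)"
  shows "\<bar>(\<integral>w. nrm w \<partial>U) - z / (l + 1 / (1 + z)\<^sup>2)\<bar> \<le> nrm_error c"
proof -
  interpret U: prob_space U by (rule prob_U)
  have "\<bar>\<integral>w. nrm w - z / (l + 1 / (1 + z)\<^sup>2) \<partial>U\<bar> \<le> nrm_error c"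
  proof (rule abs_mean_le)
    show "(\<lambda>w. nrm w - z / (l + 1 / (1 + z)\<^sup>2)) \<in> borel_measurable U" using measurable_nrm by simp
    have "0 \<le> tr_error c" using l m4_nonneg by (simp add: tr_error_def)
    then show "0 \<le> nrm_error c" using l m4_nonneg by (simp add: nrm_error_def)
    fix W assume "fixed_projection \<mu> m4 n p d l W"
    then interpret fixed_projection \<mu> m4 n p d l W .
    show "(\<integral>\<^sup>+X. ennreal \<bar>res_norm l n p d (fst (X, W)) (snd (X, W)) - z / (l + 1 / (1 + z)\<^sup>2)\<bar>
        \<partial>iid_mat n d \<mu>) \<le> ennreal (nrm_error c)"
      using norm_deviation[OF z] by (simp add: norm_bound_def trace_bound_def \<rho>_def tr_error_def nrm_error_def)
  qed
  then show ?thesis using integrable_nrm by (simp add: U.prob_space)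
qed

lemma mean_cross:
  "\<bar>(\<integral>w. cross w \<partial>U) - om * ((\<integral>w. tr w \<partial>U) - l * (\<integral>w. nrm w \<partial>U))\<bar> \<le> cross_error om"
proof -
  have "\<bar>\<integral>w. cross w - om * (tr w - l * nrm w) \<partial>U\<bar> \<le> cross_error om"
  proof (rule abs_mean_le)
    show "(\<lambda>w. cross w - om * (tr w - l * nrm w)) \<in> borel_measurable U"
      using measurable_nrm measurable_tr measurable_cross by simp
    show "0 \<le> cross_error om" using l m4_nonneg gram_bound_nonneg[of n d] by (simp add: cross_error_def)
    fix W assume "fixed_projection \<mu> m4 n p d l W"
    then interpret fixed_projection \<mu> m4 n p d l W .
    show "(\<integral>\<^sup>+X. ennreal \<bar>res_cross l n p d (fst (X, W)) (snd (X, W)) - om *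
       (res_trace l n p d (fst (X, W)) (snd (X, W)) - l * res_norm l n p d (fst (X, W)) (snd (X, W)))\<bar>
        \<partial>iid_mat n d \<mu>) \<le> ennreal (cross_error om)"
      using cross_deviation[of om] by (simp add: cross_bound_def \<rho>_def cross_error_def)
  qed
  then show ?thesis using integrable_tr integrable_nrm integrable_cross by simp
qed

end

lemma sqrt_div_nat: "sqrt x / real n = sqrt (x / (real n)\<^sup>2)"
  by (simp add: real_sqrt_divide)

text \<open>The model assumptions hold only eventually, since for small \<open>d\<close> the sample
  size or \<open>d\<close> itself may be zero.\<close>

locale rp_sequence =
  fixes \<mu> :: "real measure" and m4 :: real and \<nu> :: "nat \<Rightarrow> (nat \<times> nat \<Rightarrow> real) measure"
    and n p :: "nat \<Rightarrow> nat" and l \<pi> \<delta> T :: real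
  assumes l: "0 < l" and \<delta>: "0 < \<delta>"
    and pd: "(\<lambda>d. real (p d) / real d) \<longlonglongrightarrow> \<pi>" and dn: "(\<lambda>d. real d / real (n d)) \<longlonglongrightarrow> \<delta>"
    and model: "\<forall>\<^sub>F d in sequentially. rp_exchangeable \<mu> m4 (\<nu> d) (n d) (p d) d l"
    and T: "0 \<le> T" "\<pi> * \<delta> - l * T = T / (1 + T)"
begin

definition "u d = iid_mat (n d) d \<mu> \<Otimes>\<^sub>M \<nu> d"
definition "mean_tr d = (\<integral>w. res_trace l (n d) (p d) d (fst w) (snd w) \<partial>u d)"
definition "mean_nrm d = (\<integral>w. res_norm l (n d) (p d) d (fst w) (snd w) \<partial>u d)"
definition "mean_cross d = (\<integral>w. res_cross l (n d) (p d) d (fst w) (snd w) \<partial>u d)"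
definition "\<tau> = T / (l + 1 / (1 + T)\<^sup>2)"

lemma inverse_n: "(\<lambda>d. 1 / real (n d)) \<longlonglongrightarrow> 0"
proof -
  have "(\<lambda>d. real d / real (n d) * (1 / real d)) \<longlonglongrightarrow> \<delta> * 0"
    by (intro tendsto_mult dn lim_1_over_n)
  moreover have "\<forall>\<^sub>F d in sequentially. real d / real (n d) * (1 / real d) = 1 / real (n d)"
    using eventually_gt_at_top[of 0] by eventually_elim simp
  ultimately show ?thesis using Lim_transform_eventually by fastforce
qed

lemma pn: "(\<lambda>d. real (p d) / real (n d)) \<longlonglongrightarrow> \<pi> * \<delta>"
proof -
  have "(\<lambda>d. real (p d) / real d * (real d / real (n d))) \<longlonglongrightarrow> \<pi> * \<delta>"
    by (intro tendsto_mult dn pd)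
  moreover have "\<forall>\<^sub>F d in sequentially. real (p d) / real d * (real d / real (n d)) = real (p d) / real (n d)"
    using eventually_gt_at_top[of 0] by eventually_elim simp
  ultimately show ?thesis by (rule Lim_transform_eventually)
qed

lemma nd: "(\<lambda>d. real (n d) / real d) \<longlonglongrightarrow> 1 / \<delta>"
  using tendsto_inverse[OF dn] \<delta> by (simp add: inverse_eq_divide)

lemma sqrt_d_over_n: "(\<lambda>d. sqrt (real d / c) / real (n d)) \<longlonglongrightarrow> 0"
proof -
  have eq: "sqrt (real d / c) / real (n d) = sqrt (real d / real (n d) * (1 / real (n d)) * (1 / c))" for d
    unfolding sqrt_div_nat by (simp add: power2_eq_square)
  have "(\<lambda>d. sqrt (real d / real (n d) * (1 / real (n d)) * (1 / c))) \<longlonglongrightarrow> sqrt (\<delta> * 0 * (1 / c))"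
    by (intro tendsto_intros dn inverse_n)
  then show ?thesis unfolding eq by simp
qed

lemma sqrt_gram_bound_over_n:
  "(\<lambda>d. sqrt ((real d + (real d)\<^sup>2 / real (n d) + m * real d / real (n d)) / c) / real (n d)) \<longlonglongrightarrow> 0"
proof -
  have eq: "sqrt ((real d + (real d)\<^sup>2 / real (n d) + m * real d / real (n d)) / c) / real (n d) =
    sqrt ((real d / real (n d) * (1 / real (n d)) + (real d / real (n d))\<^sup>2 * (1 / real (n d))
      + m * (real d / real (n d)) * (1 / real (n d))\<^sup>2) * (1 / c))" for d
    unfolding sqrt_div_nat by (rule arg_cong[of _ _ sqrt]) (simp add: power2_eq_square add_divide_distrib mult_ac)
  have "(\<lambda>d. sqrt ((real d / real (n d) * (1 / real (n d)) + (real d / real (n d))\<^sup>2 * (1 / real (n d))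
      + m * (real d / real (n d)) * (1 / real (n d))\<^sup>2) * (1 / c))) \<longlonglongrightarrow>
      sqrt ((\<delta> * 0 + \<delta>\<^sup>2 * 0 + m * \<delta> * 0\<^sup>2) * (1 / c))"
    by (intro tendsto_intros dn inverse_n)
  then show ?thesis unfolding eq by simp
qed

lemma mean_tr_tendsto: "mean_tr \<longlonglongrightarrow> T"
  and mean_nrm_tendsto: "mean_nrm \<longlonglongrightarrow> \<tau>"
proof -
  define K where "K = sqrt (m4 + 2)"
  define e where "e d = (\<bar>p d / n d - \<pi> * \<delta>\<bar> + K * (sqrt (d / l\<^sup>2) / n d) + 1 / n d * (1 / l)) / l" for d
  have "(\<lambda>d. e d) \<longlonglongrightarrow> (\<bar>\<pi> * \<delta> - \<pi> * \<delta>\<bar> + K * 0 + 0 * (1 / l)) / l"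
    unfolding e_def using l by (intro tendsto_intros pn sqrt_d_over_n inverse_n) auto
  then have e: "e \<longlonglongrightarrow> 0" by simp
  have "\<forall>\<^sub>F d in sequentially. norm (mean_tr d - T) \<le> e d"
    using model
  proof eventually_elim
    case (elim d)
    then interpret rp_exchangeable \<mu> m4 "\<nu> d" "n d" "p d" d l .
    show ?case
      using mean_tr[OF T] by (simp add: mean_tr_def tr_error_def u_def U_def e_def K_def)
  qed
  from Lim_null_comparison[OF this e] show "mean_tr \<longlonglongrightarrow> T"
    by (rule LIM_zero_cancel)
  define f where "f d = ((1 + 2 * (d / n d * (1 / l\<^sup>2))) * e d
    + K * (sqrt (d / (l\<^sup>2 * l\<^sup>2)) / n d) + 2 * (1 / n d) * (1 / l\<^sup>2)
    + 2 * (d / n d * (1 / l\<^sup>2)) * (K * (sqrt (d / l\<^sup>2) / n d) + 1 / n d * (1 / l))) / l" for d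
  have "(\<lambda>d. f d) \<longlonglongrightarrow> ((1 + 2 * (\<delta> * (1 / l\<^sup>2))) * 0 + K * 0 + 2 * 0 * (1 / l\<^sup>2)
    + 2 * (\<delta> * (1 / l\<^sup>2)) * (K * 0 + 0 * (1 / l))) / l"
    unfolding f_def using l by (intro tendsto_intros pn sqrt_d_over_n inverse_n dn e) auto
  then have f: "f \<longlonglongrightarrow> 0" by simp
  have "\<forall>\<^sub>F d in sequentially. norm (mean_nrm d - \<tau>) \<le> f d"
    using model
  proof eventually_elim
    case (elim d)
    then interpret rp_exchangeable \<mu> m4 "\<nu> d" "n d" "p d" d l .
    show ?case
      using mean_nrm[OF T] by (simp add: mean_nrm_def tr_error_def nrm_error_def u_def U_def e_def f_def K_def \<tau>_def)
  qed
  from Lim_null_comparison[OF this f] show "mean_nrm \<longlonglongrightarrow> \<tau>"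
    by (rule LIM_zero_cancel)
qed

lemma mean_cross_tendsto: "mean_cross \<longlonglongrightarrow> \<delta> * (1 - \<pi>) * (T - l * \<tau>)"
proof -
  \<comment> \<open>The limit of \<open>(d - p) / n\<close>, which is the normalised trace of the
    complementary projection.\<close>
  define om where "om = \<delta> * (1 - \<pi>)"
  define K where "K = sqrt (m4 + 2)"
  let ?G = "\<lambda>d c. sqrt ((real d + (real d)\<^sup>2 / real (n d) + m4 * real d / real (n d)) / c) / real (n d)"
  define e where "e d = K * ?G d (l\<^sup>2 * l\<^sup>2) + K * ?G d (l\<^sup>2) / l
    + (K * (sqrt (d / 1) / n d) + \<bar>d / n d - p d / n d - om\<bar>) / l" for d
  have "(\<lambda>d. e d) \<longlonglongrightarrow> K * 0 + K * 0 / l + (K * 0 + \<bar>\<delta> - \<pi> * \<delta> - om\<bar>) / l"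
    unfolding e_def using l by (intro tendsto_intros pn sqrt_d_over_n sqrt_gram_bound_over_n dn) auto
  then have e: "e \<longlonglongrightarrow> 0" by (simp add: om_def algebra_simps)
  have "\<forall>\<^sub>F d in sequentially. norm (mean_cross d - om * (mean_tr d - l * mean_nrm d)) \<le> e d"
    using model
  proof eventually_elim
    case (elim d)
    then interpret rp_exchangeable \<mu> m4 "\<nu> d" "n d" "p d" d l .
    show ?case
      using mean_cross[of om]
      by (simp add: mean_cross_def mean_nrm_def mean_tr_def cross_error_def u_def U_def e_def K_def gram_bound_def
          diff_divide_distrib)
  qed
  from Lim_null_comparison[OF this e]
  have "(\<lambda>d. (mean_cross d - om * (mean_tr d - l * mean_nrm d)) + om * (mean_tr d - l * mean_nrm d))
      \<longlonglongrightarrow> 0 + om * (T - l * \<tau>)"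
    by (intro tendsto_add tendsto_mult tendsto_diff tendsto_const mean_tr_tendsto mean_nrm_tendsto)
  then show ?thesis by (simp add: om_def)
qed

lemma rp_bias_tendsto:
  "(\<lambda>d. rp_bias \<mu> (\<nu> d) \<alpha> \<sigma> (n d) (p d) d l) \<longlonglongrightarrow> \<alpha>\<^sup>2 * (\<pi> - l * T / \<delta> - 1)\<^sup>2"
proof -
  \<comment> \<open>The common diagonal mean of \<open>sig\<close>; the factor \<open>n / d\<close>
    converts the normalisation of the trace from \<open>n\<close> to \<open>d\<close>.\<close>
  define A where "A d = p d / d - l * (n d / d) * mean_tr d" for d
  have A: "A \<longlonglongrightarrow> \<pi> - l * (1 / \<delta>) * T"
    unfolding A_def by (intro tendsto_intros pd nd mean_tr_tendsto)
  have d1: "(\<lambda>d. 1 / (real d - 1)) \<longlonglongrightarrow> 0"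
  proof (rule LIMSEQ_offset[of _ 1])
    show "(\<lambda>d. 1 / (real (d + 1) - 1)) \<longlonglongrightarrow> 0" using lim_1_over_n by simp
  qed
  have "(\<lambda>d. \<alpha>\<^sup>2 * ((1 / l + 1) / 2 + \<bar>A d\<bar>)\<^sup>2 * (1 / (real d - 1))) \<longlonglongrightarrow>
      \<alpha>\<^sup>2 * ((1 / l + 1) / 2 + \<bar>\<pi> - l * (1 / \<delta>) * T\<bar>)\<^sup>2 * 0"
    by (intro tendsto_intros A d1)
  then have z: "(\<lambda>d. \<alpha>\<^sup>2 * ((1 / l + 1) / 2 + \<bar>A d\<bar>)\<^sup>2 / (real d - 1)) \<longlonglongrightarrow> 0"
    by simp
  have "\<forall>\<^sub>F d in sequentially. norm (rp_bias \<mu> (\<nu> d) \<alpha> \<sigma> (n d) (p d) d l - \<alpha>\<^sup>2 * (A d - 1)\<^sup>2) \<le>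
      \<alpha>\<^sup>2 * ((1 / l + 1) / 2 + \<bar>A d\<bar>)\<^sup>2 / (real d - 1)"
    using model eventually_ge_at_top[of 2]
  proof eventually_elim
    case (elim d)
    then interpret rp_exchangeable \<mu> m4 "\<nu> d" "n d" "p d" d l \<alpha> \<sigma> by simp
    show ?case
      using rp_bias_close[OF elim(2)] by (simp add: mean_tr_def u_def U_def A_def diff_divide_distrib)
  qed
  from Lim_null_comparison[OF this z]
  have "(\<lambda>d. (rp_bias \<mu> (\<nu> d) \<alpha> \<sigma> (n d) (p d) d l - \<alpha>\<^sup>2 * (A d - 1)\<^sup>2) + \<alpha>\<^sup>2 * (A d - 1)\<^sup>2) \<longlonglongrightarrow>
      0 + \<alpha>\<^sup>2 * (\<pi> - l * (1 / \<delta>) * T - 1)\<^sup>2"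
    by (intro tendsto_intros A)
  then show ?thesis by simp
qed

lemma rp_bias_var_tendsto:
  "(\<lambda>d. rp_bias \<mu> (\<nu> d) \<alpha> \<sigma> (n d) (p d) d l + rp_var \<mu> (\<nu> d) \<alpha> \<sigma> (n d) (p d) d l) \<longlonglongrightarrow>
    \<alpha>\<^sup>2 * ((l\<^sup>2 * \<tau> + \<delta> * (1 - \<pi>) * (T - l * \<tau>)) / \<delta> + (1 - \<pi>)) + \<sigma>\<^sup>2 * (T - l * \<tau>)"
proof -
  define F where "F d = \<alpha>\<^sup>2 * (n d / d * (l\<^sup>2 * mean_nrm d + mean_cross d) + (1 - p d / d))
     + \<sigma>\<^sup>2 * (mean_tr d - l * mean_nrm d)" for d
  have "F \<longlonglongrightarrow> \<alpha>\<^sup>2 * (1 / \<delta> * (l\<^sup>2 * \<tau> + \<delta> * (1 - \<pi>) * (T - l * \<tau>)) + (1 - \<pi>)) + \<sigma>\<^sup>2 * (T - l * \<tau>)"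
    unfolding F_def
    by (intro tendsto_intros nd pd mean_tr_tendsto mean_nrm_tendsto mean_cross_tendsto)
  moreover have "\<forall>\<^sub>F d in sequentially.
      F d = rp_bias \<mu> (\<nu> d) \<alpha> \<sigma> (n d) (p d) d l + rp_var \<mu> (\<nu> d) \<alpha> \<sigma> (n d) (p d) d l"
    using model eventually_gt_at_top[of 0]
  proof eventually_elim
    case (elim d)
    then interpret rp_exchangeable \<mu> m4 "\<nu> d" "n d" "p d" d l \<alpha> \<sigma> by simp
    show ?case
      unfolding rp_bias_var_eq using elim(2)
      by (simp add: mean_tr_def mean_nrm_def mean_cross_def u_def U_def F_def field_simps)
  qed
  ultimately show ?thesis using Lim_transform_eventually by fastforce
qed

end

text \<open>Clearing the denominator gives \<open>l T^2 + (l + 1 - g) T - g = 0\<close>. The product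
  of the roots is negative, and the quadratic formula with the plus sign gives the positive
  one.\<close>

lemma fixed_point_exists:
  fixes g l :: real
  assumes "0 < g" "0 < l"
  obtains T where "0 < T" "g - l * T = T / (1 + T)"
proof -
  define b where "b = l + 1 - g"
  define s where "s = sqrt (b\<^sup>2 + 4 * l * g)"
  define T where "T = (s - b) / (2 * l)"
  have s2: "s\<^sup>2 = b\<^sup>2 + 4 * l * g" using assms by (simp add: s_def)
  have "\<bar>b\<bar> < s"
    unfolding s_def using assms by (intro real_less_rsqrt) simp
  then have T: "0 < T" using assms by (simp add: T_def)
  have "2 * l * T = s - b" using assms by (simp add: T_def)
  then have "(2 * l * T + b)\<^sup>2 = b\<^sup>2 + 4 * l * g" using s2 by simp
  then have "4 * l * (l * T\<^sup>2 + b * T - g) = 0" by (simp add: power2_eq_square algebra_simps)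
  then have "l * T\<^sup>2 + b * T - g = 0" using assms by simp
  then have "(g - l * T) * (1 + T) = T" by (simp add: b_def power2_eq_square algebra_simps)
  then have "g - l * T = T / (1 + T)" using T by (simp add: field_simps)
  with T show thesis by (rule that)
qed

section \<open>Optimal regularization and equivalence\<close>

text \<open>
  The right-hand side is the limiting error at \<open>l\<close>, up to a positive factor and an additive
  constant.  It exceeds the left-hand side by \<open>g (S - T)\<^sup>2\<close> divided by a positive number.
\<close>

lemma fixed_point_optimal:
  fixes g k l S T :: real
  assumes pos: "0 < g" "0 < k" "0 < l" "0 < S" "0 < T"
    and T: "g - l * T = T / (1 + T)" and S: "g - k * S = S / (1 + S)"
  shows "k * S \<le> l\<^sup>2 * (T / (l + 1 / (1 + T)\<^sup>2)) + k * (T - l * (T / (l + 1 / (1 + T)\<^sup>2)))"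
proof -
  define a where "a = l + 1 / (1 + T)\<^sup>2"
  have a: "0 < a" using pos by (simp add: a_def add_pos_pos)
  \<comment> \<open>Each fixed point equation is solved for its parameter, so that the claim becomes
    one about rational functions of \<open>g\<close>, \<open>S\<close> and \<open>T\<close>.\<close>
  have l: "l = g / T - 1 / (1 + T)" and k: "k = g / S - 1 / (1 + S)"
  proof -
    have *: "x = c / y - 1 / (1 + y)" if "c - x * y = y / (1 + y)" "0 < y" for c x y :: real
    proof -
      have xy: "x * y = c - y / (1 + y)" using that(1) by linarith
      have "x = x * y / y" using that(2) by simp
      also have "\<dots> = c / y - 1 / (1 + y)"
        unfolding xy using that(2) by (simp add: diff_divide_distrib)
      finally show ?thesis .
    qed
    show "l = g / T - 1 / (1 + T)" by (rule *[OF T pos(5)])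
    show "k = g / S - 1 / (1 + S)" by (rule *[OF S pos(4)])
  qed
  have a_eq: "a = g / T - T / (1 + T)\<^sup>2"
  proof -
    have "T / (1 + T)\<^sup>2 = (1 + T) / (1 + T)\<^sup>2 - 1 / (1 + T)\<^sup>2"
      by (simp flip: diff_divide_distrib)
    also have "(1 + T) / (1 + T)\<^sup>2 = 1 / (1 + T)"
      using pos by (simp add: power2_eq_square)
    finally show ?thesis unfolding a_def l by simp
  qed
  define b where "b = g / (S * T) - 1 / ((1 + T) * (1 + S))"
  have lk: "l - k = (S - T) * b"
    unfolding l k b_def using pos by (simp add: divide_simps) (simp add: algebra_simps)
  have lT: "l * T = g - T / (1 + T)" using T by linarith
  have "l * T * (l - k) + k * (T - S) * a = (S - T) * (l * T * b - k * a)"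
    unfolding lk by (simp add: algebra_simps)
  also have "l * T * b - k * a = (g - T / (1 + T)) * (g / (S * T) - 1 / ((1 + T) * (1 + S)))
        - (g / S - 1 / (1 + S)) * (g / T - T / (1 + T)\<^sup>2)"
    unfolding lT a_eq b_def by (subst k) (rule refl)
  \<comment> \<open>The terms in \<open>g^2\<close> and those free of \<open>g\<close> cancel; the
    coefficient of \<open>g\<close> supplies a second factor \<open>S - T\<close>, which completes
    the square.\<close>
  also have "(g - T / (1 + T)) * (g / (S * T) - 1 / ((1 + T) * (1 + S)))
        - (g / S - 1 / (1 + S)) * (g / T - T / (1 + T)\<^sup>2) = g * (S - T) / (S * T * (1 + S) * (1 + T)\<^sup>2)"
    using pos by (simp add: divide_simps power2_eq_square) (simp add: algebra_simps)
  finally have "l * T * (l - k) + k * (T - S) * a = g * (S - T)\<^sup>2 / (S * T * (1 + S) * (1 + T)\<^sup>2)"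
    by (simp add: power2_eq_square mult_ac)
  also have "\<dots> \<ge> 0" using pos by simp
  finally have "0 \<le> (l * T * (l - k) + k * (T - S) * a) / a" using a by simp
  also have "\<dots> = l\<^sup>2 * (T / a) + k * (T - l * (T / a)) - k * S"
    using a by (simp add: field_simps power2_eq_square)
  finally show ?thesis unfolding a_def by simp
qed

text \<open>Here the optimal parameter originates: leakage and noise multiply the same quantity
  \<open>y\<close>, with total weight \<open>\<alpha>\<^sup>2 (1 - \<pi>) + \<sigma>\<^sup>2 =
  \<alpha>\<^sup>2 k / \<delta>\<close>.\<close>

lemma limiting_error_eq:
  fixes \<alpha> :: real
  assumes "0 < \<alpha>" "0 < \<delta>" and k: "k = \<delta> * (1 - \<pi> + \<sigma>\<^sup>2 / \<alpha>\<^sup>2)"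
  shows "\<alpha>\<^sup>2 * ((x + \<delta> * (1 - \<pi>) * y) / \<delta> + (1 - \<pi>)) + \<sigma>\<^sup>2 * y =
    \<alpha>\<^sup>2 / \<delta> * (x + k * y) + \<alpha>\<^sup>2 * (1 - \<pi>)"
proof -
  have *: "k * \<alpha>\<^sup>2 = \<delta> * ((1 - \<pi>) * \<alpha>\<^sup>2 + \<sigma>\<^sup>2)"
    using assms by (simp add: field_simps)
  have "\<alpha>\<^sup>2 / \<delta> * (k * y) = k * \<alpha>\<^sup>2 * y / \<delta>" by simp
  also have "\<dots> = ((1 - \<pi>) * \<alpha>\<^sup>2 + \<sigma>\<^sup>2) * y"
    unfolding * using assms(2) by simp
  finally have "\<alpha>\<^sup>2 / \<delta> * (x + k * y) = \<alpha>\<^sup>2 / \<delta> * x + ((1 - \<pi>) * \<alpha>\<^sup>2 + \<sigma>\<^sup>2) * y"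
    by (simp only: distrib_left)
  then show ?thesis using assms(2) by (simp add: field_simps)
qed

text \<open>Serves both models. The free constant \<open>c\<close> stands for the test noise, which
  in ordinary ridge differs from the square of the training noise level.\<close>

lemma rp_limits_at_optimum:
  fixes \<alpha> \<sigma> \<pi> \<delta> k S c :: real
  assumes \<alpha>: "0 < \<alpha>" and \<delta>: "0 < \<delta>" and \<pi>: "0 < \<pi>"
    and pd: "(\<lambda>d. real (p d) / real d) \<longlonglongrightarrow> \<pi>" and dn: "(\<lambda>d. real d / real (n d)) \<longlonglongrightarrow> \<delta>"
    and model: "\<forall>l>0. \<forall>\<^sub>F d in sequentially. rp_exchangeable \<mu> m4 (\<nu> d) (n d) (p d) d l"
    and k: "k = \<delta> * (1 - \<pi> + \<sigma>\<^sup>2 / \<alpha>\<^sup>2)" "0 < k"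
    and S: "0 < S" "\<pi> * \<delta> - k * S = S / (1 + S)"
  defines "bias \<equiv> \<lambda>d l. rp_bias \<mu> (\<nu> d) \<alpha> \<sigma> (n d) (p d) d l"
    and "var \<equiv> \<lambda>d l. rp_var \<mu> (\<nu> d) \<alpha> \<sigma> (n d) (p d) d l"
  shows "(\<lambda>d. bias d k) \<longlonglongrightarrow> \<alpha>\<^sup>2 * (\<pi> - k * S / \<delta> - 1)\<^sup>2"
    and "(\<lambda>d. bias d k + var d k) \<longlonglongrightarrow> \<alpha>\<^sup>2 / \<delta> * (k * S) + \<alpha>\<^sup>2 * (1 - \<pi>)"
    and "optimal_regularization (\<lambda>d l. bias d l + var d l + c) k"
proof -
  have seq: "rp_sequence \<mu> m4 \<nu> n p l \<pi> \<delta> T" if "0 < l" "0 < T" "\<pi> * \<delta> - l * T = T / (1 + T)" for l T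
    using that \<delta> pd dn model by unfold_locales auto
  have lim: "(\<lambda>d. bias d l + var d l) \<longlonglongrightarrow> \<alpha>\<^sup>2 / \<delta> * (l\<^sup>2 * (T / (l + 1 / (1 + T)\<^sup>2))
        + k * (T - l * (T / (l + 1 / (1 + T)\<^sup>2)))) + \<alpha>\<^sup>2 * (1 - \<pi>)"
    if lT: "0 < l" "0 < T" "\<pi> * \<delta> - l * T = T / (1 + T)" for l T
    using rp_sequence.rp_bias_var_tendsto[OF seq[OF lT], of \<alpha> \<sigma>]
    unfolding rp_sequence.\<tau>_def[OF seq[OF lT]] limiting_error_eq[OF \<alpha> \<delta> k(1)]
    by (simp add: bias_def var_def)
  show "(\<lambda>d. bias d k) \<longlonglongrightarrow> \<alpha>\<^sup>2 * (\<pi> - k * S / \<delta> - 1)\<^sup>2"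
    unfolding bias_def by (rule rp_sequence.rp_bias_tendsto[OF seq[OF k(2) S]])
  \<comment> \<open>At \<open>l = k\<close> the two terms with the limit of the squared resolvent
    norm cancel, and \<open>k * S\<close> is left.\<close>
  show 2: "(\<lambda>d. bias d k + var d k) \<longlonglongrightarrow> \<alpha>\<^sup>2 / \<delta> * (k * S) + \<alpha>\<^sup>2 * (1 - \<pi>)"
    using lim[OF k(2) S] by (simp add: power2_eq_square algebra_simps)
  show "optimal_regularization (\<lambda>d l. bias d l + var d l + c) k"
    unfolding optimal_regularization_def
  proof (rule conjI[OF k(2)], rule exI[of _ "\<alpha>\<^sup>2 / \<delta> * (k * S) + \<alpha>\<^sup>2 * (1 - \<pi>) + c"],
      intro conjI allI impI)
    show "(\<lambda>d. bias d k + var d k + c) \<longlonglongrightarrow> \<alpha>\<^sup>2 / \<delta> * (k * S) + \<alpha>\<^sup>2 * (1 - \<pi>) + c"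
      by (intro tendsto_add 2 tendsto_const)
    fix l :: real assume l: "0 < l"
    have g: "0 < \<pi> * \<delta>" using \<pi> \<delta> by simp
    obtain T where T: "0 < T" "\<pi> * \<delta> - l * T = T / (1 + T)"
      by (rule fixed_point_exists[OF g l])
    let ?L = "\<alpha>\<^sup>2 / \<delta> * (l\<^sup>2 * (T / (l + 1 / (1 + T)\<^sup>2))
        + k * (T - l * (T / (l + 1 / (1 + T)\<^sup>2)))) + \<alpha>\<^sup>2 * (1 - \<pi>) + c"
    have "(\<lambda>d. bias d l + var d l + c) \<longlonglongrightarrow> ?L"
      by (intro tendsto_add lim[OF l T] tendsto_const)
    moreover have "\<alpha>\<^sup>2 / \<delta> * (k * S) + \<alpha>\<^sup>2 * (1 - \<pi>) + c \<le> ?L"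
      using fixed_point_optimal[OF g k(2) l S(1) T(1) T(2) S(2)] \<delta>
      by (intro add_right_mono mult_left_mono) auto
    ultimately show "\<exists>M'. (\<lambda>d. bias d l + var d l + c) \<longlonglongrightarrow> M' \<and>
        \<alpha>\<^sup>2 / \<delta> * (k * S) + \<alpha>\<^sup>2 * (1 - \<pi>) + c \<le> M'"
      by blast
  qed
qed

text \<open>Division by zero gives zero, so a positive quotient makes both \<open>n d\<close> and
  \<open>d\<close> positive.\<close>

lemma eventually_n_pos:
  assumes "(\<lambda>d. real d / real (n d)) \<longlonglongrightarrow> \<delta>" "0 < \<delta>"
  shows "\<forall>\<^sub>F d in sequentially. 0 < n d \<and> 0 < d"
proof -
  have "\<forall>\<^sub>F d in sequentially. 0 < real d / real (n d)"
    by (rule order_tendstoD(1)[OF assms])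
  then show ?thesis by eventually_elim (simp add: zero_less_divide_iff)
qed

text \<open>
  With \<open>y = 1 + 1 / S\<close> the fixed point equation reads \<open>g y\<^sup>2 - c y + 1 = 0\<close>; its left-hand side is
  negative at \<open>1\<close>, so \<open>y > 1\<close> is the larger root.
\<close>

lemma fixed_point_formula:
  fixes g k S :: real
  assumes pos: "0 < g" "0 < k" "0 < S" and S: "g - k * S = S / (1 + S)" and c: "c = g + k + 1"
  shows "1 + 1 / S = (c + sqrt (c\<^sup>2 - 4 * g)) / (2 * g)"
proof -
  define y where "y = 1 + 1 / S"
  have y: "1 < y" using pos by (simp add: y_def)
  have "g - k * S = 1 / y" using S pos by (simp add: y_def field_simps)
  then have "(g - k * S) * y = 1" using y by simp
  moreover have "S * (y - 1) = 1" using pos by (simp add: y_def)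
  ultimately have q: "g * y\<^sup>2 - c * y + 1 = 0"
  proof -
    have "g * y\<^sup>2 - c * y + 1 = (y - 1) * ((g - k * S) * y - 1) + k * y * (S * (y - 1) - 1)"
      by (simp add: c algebra_simps power2_eq_square)
    with \<open>(g - k * S) * y = 1\<close> \<open>S * (y - 1) = 1\<close> show ?thesis by simp
  qed
  \<comment> \<open>Left of the vertex \<open>c / (2 * g)\<close> the quadratic is decreasing, so
    its value \<open>- k\<close> at \<open>1\<close> could not lie below its value \<open>0\<close>
    at the larger point \<open>y\<close>.\<close>
  have "c \<le> 2 * g * y"
  proof (rule ccontr)
    assume "\<not> c \<le> 2 * g * y"
    then have "g - c + g * y \<le> g * (1 - y)" by (simp add: algebra_simps)
    also have "\<dots> < 0" using pos y by (simp add: mult_pos_neg)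
    finally have "0 < (1 - y) * (g - c + g * y)"
      using y by (simp add: mult_neg_neg)
    also have "(1 - y) * (g - c + g * y) = - k"
    proof -
      have "(1 - y) * (g - c + g * y) = g - c + 1 - (g * y\<^sup>2 - c * y + 1)"
        by (simp add: algebra_simps power2_eq_square)
      then show ?thesis unfolding q by (simp add: c)
    qed
    finally show False using pos by simp
  qed
  moreover have "(2 * g * y - c)\<^sup>2 = c\<^sup>2 - 4 * g"
  proof -
    have "(2 * g * y - c)\<^sup>2 = 4 * g * (g * y\<^sup>2 - c * y + 1) + (c\<^sup>2 - 4 * g)"
      by (simp add: algebra_simps power2_eq_square)
    then show ?thesis unfolding q by simp
  qed
  ultimately have "sqrt (c\<^sup>2 - 4 * g) = 2 * g * y - c"
    by (metis diff_ge_0_iff_ge real_sqrt_abs abs_of_nonneg)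
  then show ?thesis using pos by (simp add: y_def)
qed

theorem mainTheorem11:
  fixes \<alpha> \<sigma> \<pi> \<delta> \<gamma> \<sigma>' lopt lopt' :: real
  assumes "\<alpha> > 0" and "\<sigma> \<ge> 0" and "0 < \<pi>" and "\<pi> \<le> 1" and "\<delta> > 0"
    and "\<not> (\<pi> = 1 \<and> \<sigma> = 0)"
    and "\<gamma> = \<pi> * \<delta>"
    and "\<sigma>' \<ge> 0"
    and "\<sigma>'\<^sup>2 = \<sigma>\<^sup>2 + \<alpha>\<^sup>2 * (1 - \<pi>) *
           ((\<delta> * (1 + \<sigma>\<^sup>2 / \<alpha>\<^sup>2) + 1 + sqrt ((\<delta> * (1 + \<sigma>\<^sup>2 / \<alpha>\<^sup>2) + 1)\<^sup>2 - 4 * \<gamma>)) / (2 * \<gamma>))"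
    and "lopt = \<delta> * (1 - \<pi> + \<sigma>\<^sup>2 / \<alpha>\<^sup>2)"
    and "lopt' = \<delta> * \<sigma>'\<^sup>2 / \<alpha>\<^sup>2"
  shows "\<exists>B V M :: real.
    (\<forall>\<mu> n p \<nu>. entry_law \<mu> \<and> rp_regime \<pi> \<delta> n p \<nu> \<longrightarrow>
       optimal_regularization (\<lambda>d. rp_mse \<mu> (\<nu> d) \<alpha> \<sigma> (n d) (p d) d) lopt \<and>
       (\<lambda>d. rp_bias \<mu> (\<nu> d) \<alpha> \<sigma> (n d) (p d) d lopt) \<longlonglongrightarrow> B \<and>
       (\<lambda>d. rp_var \<mu> (\<nu> d) \<alpha> \<sigma> (n d) (p d) d lopt) \<longlonglongrightarrow> V \<and>
       (\<lambda>d. rp_mse \<mu> (\<nu> d) \<alpha> \<sigma> (n d) (p d) d lopt) \<longlonglongrightarrow> M) \<and>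
    (\<forall>\<mu> n. entry_law \<mu> \<and> ridge_regime \<delta> n \<longrightarrow>
       optimal_regularization (\<lambda>d. ridge_mse \<mu> \<alpha> \<sigma>' \<sigma> (n d) d) lopt' \<and>
       (\<lambda>d. ridge_bias \<mu> \<alpha> \<sigma>' (n d) d lopt') \<longlonglongrightarrow> B \<and>
       (\<lambda>d. ridge_var \<mu> \<alpha> \<sigma>' (n d) d lopt') \<longlonglongrightarrow> V \<and>
       (\<lambda>d. ridge_mse \<mu> \<alpha> \<sigma>' \<sigma> (n d) d lopt') \<longlonglongrightarrow> M)"
proof -
  note \<alpha> = assms(1) and \<pi> = assms(3) and \<pi>1 = assms(4) and \<delta> = assms(5)
  have lopt: "0 < lopt"
  proof -
    have "0 < 1 - \<pi> + \<sigma>\<^sup>2 / \<alpha>\<^sup>2"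
    proof (cases "\<pi> = 1")
      case True
      with assms(6) \<alpha> show ?thesis by simp
    next
      case False
      with \<pi>1 show ?thesis by (intro add_pos_nonneg) auto
    qed
    with \<delta> show ?thesis by (simp add: assms(10))
  qed
  have g: "0 < \<pi> * \<delta>" using \<pi> \<delta> by simp
  obtain S where S: "0 < S" "\<pi> * \<delta> - lopt * S = S / (1 + S)"
    by (rule fixed_point_exists[OF g lopt])
  have c: "\<delta> * (1 + \<sigma>\<^sup>2 / \<alpha>\<^sup>2) + 1 = \<pi> * \<delta> + lopt + 1"
    by (simp add: assms(10) algebra_simps)
  have "\<sigma>'\<^sup>2 = \<sigma>\<^sup>2 + \<alpha>\<^sup>2 * (1 - \<pi>) * (1 + 1 / S)"
    unfolding assms(9) assms(7) fixed_point_formula[OF g lopt S(1) S(2) c] ..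
  then have "\<sigma>'\<^sup>2 / \<alpha>\<^sup>2 = \<sigma>\<^sup>2 / \<alpha>\<^sup>2 + (1 - \<pi>) * (1 + 1 / S)"
    using \<alpha> by (simp add: add_divide_distrib)
  then have "lopt' = \<delta> * (\<sigma>\<^sup>2 / \<alpha>\<^sup>2 + (1 - \<pi>) * (1 + 1 / S))"
    unfolding assms(11) by (metis times_divide_eq_right)
  then have lopt'_eq: "lopt' = lopt + \<delta> * (1 - \<pi>) / S"
    by (simp add: assms(10) algebra_simps)
  then have lopt': "0 < lopt'"
    using lopt \<delta> \<pi>1 S(1) by (simp add: add_pos_nonneg)
  have lS: "lopt' * S = lopt * S + \<delta> * (1 - \<pi>)"
    using S(1) by (simp add: lopt'_eq field_simps)
  \<comment> \<open>The same \<open>S\<close> solves the equation of ordinary ridge: raising the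
    constant by \<open>\<delta> * (1 - \<pi>)\<close> is balanced by the increase of
    \<open>lopt * S\<close> to \<open>lopt' * S\<close>.\<close>
  have S': "1 * \<delta> - lopt' * S = S / (1 + S)"
    using S(2) lS by (simp add: algebra_simps)
  have lopt'_form: "lopt' = \<delta> * (1 - 1 + \<sigma>'\<^sup>2 / \<alpha>\<^sup>2)" by (simp add: assms(11))
  define B where "B = \<alpha>\<^sup>2 * (\<pi> - lopt * S / \<delta> - 1)\<^sup>2"
  define N where "N = \<alpha>\<^sup>2 / \<delta> * (lopt * S) + \<alpha>\<^sup>2 * (1 - \<pi>)"
  have B': "\<alpha>\<^sup>2 * (1 - lopt' * S / \<delta> - 1)\<^sup>2 = B"
    unfolding lS B_def using \<delta> by (simp add: field_simps power2_eq_square)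
  have N': "\<alpha>\<^sup>2 / \<delta> * (lopt' * S) + \<alpha>\<^sup>2 * (1 - 1) = N"
    unfolding lS N_def using \<delta> by (simp add: field_simps)
  show ?thesis
  \<comment> \<open>\<open>N\<close> is the limit of squared bias plus variance, so the variance
    limit is obtained by subtraction. All limits depend on \<open>S\<close> and the parameters only,
    which is why one triple serves all entry laws and sequences.\<close>
  proof (rule exI[of _ B], rule exI[of _ "N - B"], rule exI[of _ "N + \<sigma>\<^sup>2"],
      intro conjI allI impI; elim conjE)
    fix \<mu> n p \<nu> assume \<mu>: "entry_law \<mu>" and reg: "rp_regime \<pi> \<delta> n p \<nu>"
    from reg have pd: "(\<lambda>d. real (p d) / real d) \<longlonglongrightarrow> \<pi>" and dn: "(\<lambda>d. real d / real (n d)) \<longlonglongrightarrow> \<delta>"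
      and \<nu>: "\<And>d. uniform_stiefel (p d) d (\<nu> d)"
      by (auto simp: rp_regime_def)
    have model: "\<forall>l>0. \<forall>\<^sub>F d in sequentially. rp_exchangeable \<mu> (\<integral>z. z ^ 4 \<partial>\<mu>) (\<nu> d) (n d) (p d) d l"
      using eventually_n_pos[OF dn \<delta>]
      by (intro allI impI, elim eventually_mono) (use \<nu> entry_law_moments[OF \<mu>] in \<open>auto intro: uniform_stiefel_exchangeable\<close>)
    note lim = rp_limits_at_optimum[OF \<alpha> \<delta> \<pi> pd dn model assms(10) lopt S, folded B_def N_def]
    show "optimal_regularization (\<lambda>d. rp_mse \<mu> (\<nu> d) \<alpha> \<sigma> (n d) (p d) d) lopt"
      using lim(3)[of "\<sigma>\<^sup>2"] by (simp add: rp_mse_def[abs_def])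
    show b: "(\<lambda>d. rp_bias \<mu> (\<nu> d) \<alpha> \<sigma> (n d) (p d) d lopt) \<longlonglongrightarrow> B" by (rule lim(1))
    show "(\<lambda>d. rp_var \<mu> (\<nu> d) \<alpha> \<sigma> (n d) (p d) d lopt) \<longlonglongrightarrow> N - B"
      using tendsto_diff[OF lim(2) b] by simp
    show "(\<lambda>d. rp_mse \<mu> (\<nu> d) \<alpha> \<sigma> (n d) (p d) d lopt) \<longlonglongrightarrow> N + \<sigma>\<^sup>2"
      unfolding rp_mse_def by (intro tendsto_add lim(2) tendsto_const)
  next
    fix \<mu> n assume \<mu>: "entry_law \<mu>" and reg: "ridge_regime \<delta> n"
    then have dn: "(\<lambda>d. real d / real (n d)) \<longlonglongrightarrow> \<delta>" by (simp add: ridge_regime_def)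
    have "\<forall>\<^sub>F d in sequentially. real d / real d = 1"
      using eventually_gt_at_top[of 0] by eventually_elim simp
    then have pd: "(\<lambda>d. real d / real d) \<longlonglongrightarrow> 1"
      by (rule tendsto_eventually)
    have one: "0 < (1 :: real)" by simp
    note em = entry_law_moments[OF \<mu>]
    have model: "\<forall>l>0. \<forall>\<^sub>F d in sequentially. rp_exchangeable \<mu> (\<integral>z. z ^ 4 \<partial>\<mu>) (id_law d) (n d) d d l"
      using eventually_n_pos[OF dn \<delta>]
      by (intro allI impI, elim eventually_mono) (use em in \<open>auto intro: id_law_exchangeable\<close>)
    note lim = rp_limits_at_optimum[where p = "\<lambda>d. d" and n = n and \<nu> = id_law and \<pi> = 1
          and \<sigma> = \<sigma>' and \<mu> = \<mu> and k = lopt' and S = S,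
        OF \<alpha> \<delta> one pd dn model lopt'_form lopt' S(1) S', unfolded B' N']
    have eq: "\<forall>\<^sub>F d in sequentially. rp_bias \<mu> (id_law d) \<alpha> \<sigma>' (n d) d d l = ridge_bias \<mu> \<alpha> \<sigma>' (n d) d l \<and>
        rp_var \<mu> (id_law d) \<alpha> \<sigma>' (n d) d d l = ridge_var \<mu> \<alpha> \<sigma>' (n d) d l" if "0 < l" for l
      using eventually_n_pos[OF dn \<delta>] by eventually_elim (simp add: ridge_eq_rp[OF em] that)
    have mse: "(\<lambda>d. ridge_mse \<mu> \<alpha> \<sigma>' \<sigma> (n d) d l) \<longlonglongrightarrow> x"
      if "0 < l" "(\<lambda>d. rp_bias \<mu> (id_law d) \<alpha> \<sigma>' (n d) d d l + rp_var \<mu> (id_law d) \<alpha> \<sigma>' (n d) d d l + \<sigma>\<^sup>2) \<longlonglongrightarrow> x"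
      for l x
      by (rule Lim_transform_eventually[OF that(2)])
        (use eq[OF that(1)] in \<open>auto elim!: eventually_mono simp: ridge_mse_def\<close>)
    show "optimal_regularization (\<lambda>d. ridge_mse \<mu> \<alpha> \<sigma>' \<sigma> (n d) d) lopt'"
    proof -
      \<comment> \<open>Optimality is transferred from the model with \<open>W = I\<close>: the two
        errors agree for all large \<open>d\<close>, and the definition only involves
        limits.\<close>
      let ?mse = "\<lambda>d l. rp_bias \<mu> (id_law d) \<alpha> \<sigma>' (n d) d d l + rp_var \<mu> (id_law d) \<alpha> \<sigma>' (n d) d d l + \<sigma>\<^sup>2"
      obtain m where m: "(\<lambda>d. ?mse d lopt') \<longlonglongrightarrow> m"
        and min: "\<And>l. 0 < l \<Longrightarrow> \<exists>m'. (\<lambda>d. ?mse d l) \<longlonglongrightarrow> m' \<and> m \<le> m'"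
        using lim(3)[of "\<sigma>\<^sup>2"] unfolding optimal_regularization_def by blast
      show ?thesis
        unfolding optimal_regularization_def
      proof (rule conjI[OF lopt'], rule exI[of _ m], intro conjI allI impI)
        show "(\<lambda>d. ridge_mse \<mu> \<alpha> \<sigma>' \<sigma> (n d) d lopt') \<longlonglongrightarrow> m" by (rule mse[OF lopt' m])
        fix l :: real assume l: "0 < l"
        then obtain m' where "(\<lambda>d. ?mse d l) \<longlonglongrightarrow> m'" "m \<le> m'" using min by blast
        then show "\<exists>m'. (\<lambda>d. ridge_mse \<mu> \<alpha> \<sigma>' \<sigma> (n d) d l) \<longlonglongrightarrow> m' \<and> m \<le> m'"
          using mse[OF l] by blast
      qed
    qed
    show b: "(\<lambda>d. ridge_bias \<mu> \<alpha> \<sigma>' (n d) d lopt') \<longlonglongrightarrow> B"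
      by (rule Lim_transform_eventually[OF lim(1)]) (use eq[OF lopt'] in \<open>auto elim!: eventually_mono\<close>)
    have bv: "(\<lambda>d. ridge_bias \<mu> \<alpha> \<sigma>' (n d) d lopt' + ridge_var \<mu> \<alpha> \<sigma>' (n d) d lopt') \<longlonglongrightarrow> N"
      by (rule Lim_transform_eventually[OF lim(2)]) (use eq[OF lopt'] in \<open>auto elim!: eventually_mono\<close>)
    show "(\<lambda>d. ridge_var \<mu> \<alpha> \<sigma>' (n d) d lopt') \<longlonglongrightarrow> N - B"
      using tendsto_diff[OF bv b] by simp
    show "(\<lambda>d. ridge_mse \<mu> \<alpha> \<sigma>' \<sigma> (n d) d lopt') \<longlonglongrightarrow> N + \<sigma>\<^sup>2"
      unfolding ridge_mse_def by (intro tendsto_add bv tendsto_const)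
  qed
qed

end
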